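(* Let $\alpha\ge 2$, and consider the minimization problem $$\min_{z\in\mathbb{H}}\big(\mathcal{K}(\alpha;z)-b\,\mathcal{K}(2\alpha;z)\big).$$ Then there exist two thresholds $b_{c_1}<b_{c_2}$, where $b_{c_1}$ depends on $\alpha$ and satisfies $b_{c_1}\in(2,2\sqrt2)$, and $b_{c_2}=2\sqrt2$ is independent of $\alpha$, such that, up to the action of the group $\mathcal{G}$: (1) for $b\le b_{c_1}$, the minimizer is $e^{i\pi/3}$ (corresponding to the hexagonal lattice); (2) for $b_{c_1}<b<b_{c_2}$, the minimizer is $\frac12+iy_b$ with some $y_b>\frac{\sqrt3}{2}$ (corresponding to a skinny-rhombic lattice); furthermore, $y_b\to+\infty$ as $b\to 2\sqrt2$ (from below); (3) for $b\ge b_{c_2}$, the minimizer does not exist.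
   Context: $\mathbb{H}=\{z\in\mathbb{C}:\operatorname{Im}(z)>0\}$. For $\alpha>0$ and $z\in\mathbb{H}$, $$\mathcal{K}(\alpha;z)=\sum_{(m,n)\in\mathbb{Z}^2}\frac{|mz+n|^2}{\operatorname{Im}(z)}\,e^{-\pi\alpha\frac{|mz+n|^2}{\operatorname{Im}(z)}}.$$ $\mathcal{G}$ (called the modular group in the paper) is the group of transformations of $\mathbb{H}$ generated by $\tau\mapsto-1/\tau$, $\tau\mapsto\tau+1$, $\tau\mapsto-\overline{\tau}$. The function $z\mapsto\mathcal{K}(\alpha;z)-b\,\mathcal{K}(2\alpha;z)$ is $\mathcal{G}$-invariant, so minimizers are described up to the action of $\mathcal{G}$. The parameter $b$ is real.
   Formalization: At the endpoint b = b_{c1}, case (1) is proved only in the sense that e^{iπ/3} attains the minimum; uniqueness up to 𝒢 is claimed for b < b_{c1} only, because at b = b_{c1} another point in a different orbit also attains the minimum. *)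

theory Defs
  imports "HOL-Analysis.Analysis" "HOL-Algebra.Elementary_Groups" "HOL-Algebra.Group_Action"
begin

definition upper_half_plane :: "complex set" where
  "upper_half_plane = {z. Im z > 0}"

definition K :: "real \<Rightarrow> complex \<Rightarrow> real" where
  "K \<alpha> z = (\<Sum>\<^sub>\<infinity>(m, n)\<in>(UNIV :: (int \<times> int) set).
     (cmod (of_int m * z + of_int n))\<^sup>2 / Im z
       * exp (- pi * \<alpha> * ((cmod (of_int m * z + of_int n))\<^sup>2 / Im z)))"

definition modular_generators :: "(complex \<Rightarrow> complex) set" where
  "modular_generators =
     {\<lambda>\<tau>\<in>upper_half_plane. - 1 / \<tau>,
      \<lambda>\<tau>\<in>upper_half_plane. \<tau> + 1,
      \<lambda>\<tau>\<in>upper_half_plane. - cnj \<tau>}"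

definition modular_group :: "(complex \<Rightarrow> complex) monoid" where
  "modular_group = subgroup_generated (BijGroup upper_half_plane) modular_generators"

(* subgroup_generated ignores generators outside the carrier; here there are none. *)
lemma modular_generators_subset: "modular_generators \<subseteq> carrier (BijGroup upper_half_plane)"
proof -
  have Im_neg_inverse: "Im (- 1 / z) > 0" if "Im z > 0" for z
    using that by (simp add: Im_divide sum_power2_gt_zero_iff)
  have "bij_betw (\<lambda>\<tau>. - 1 / \<tau>) upper_half_plane upper_half_plane"
    by (rule bij_betwI[where g = "\<lambda>\<tau>. - 1 / \<tau>"])
      (use Im_neg_inverse in \<open>auto simp: upper_half_plane_def\<close>)
  moreover have "bij_betw (\<lambda>\<tau>. \<tau> + 1) upper_half_plane upper_half_plane"
    by (rule bij_betwI[where g = "\<lambda>\<tau>. \<tau> - 1"]) (auto simp: upper_half_plane_def)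
  moreover have "bij_betw (\<lambda>\<tau>. - cnj \<tau>) upper_half_plane upper_half_plane"
    by (rule bij_betwI[where g = "\<lambda>\<tau>. - cnj \<tau>"]) (auto simp: upper_half_plane_def)
  ultimately show ?thesis
    by (auto simp: modular_generators_def BijGroup_def Bij_def bij_betw_restrict_eq)
qed

definition modular_orbit :: "complex \<Rightarrow> complex set" where
  "modular_orbit z = orbit modular_group (\<lambda>g. g) z"

definition is_minimizer :: "real \<Rightarrow> real \<Rightarrow> complex \<Rightarrow> bool" where
  "is_minimizer \<alpha> b z \<longleftrightarrow>
     is_arg_min (\<lambda>w. K \<alpha> w - b * K (2 * \<alpha>) w) (\<lambda>w. w \<in> upper_half_plane) z"

end

theory Submission
  imports Defs "HOL-Probability.Probability" "HOL-Real_Asymp.Real_Asymp"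
begin

text \<open>
  Every point of the half plane has an image in the fundamental domain
  \<open>0 \<le> x \<le> 1/2\<close>, \<open>|z| \<ge> 1\<close>, which is cut at height \<open>y = 3\<alpha>\<close>. With \<open>h b w = w e\<^sup>-\<^sup>w - b w e\<^sup>-\<^sup>2\<^sup>w\<close>
  the energy times \<open>\<pi>\<alpha>\<close> is the sum of \<open>h b (\<pi>\<alpha> Q(v))\<close> over the lattice, \<open>Q\<close> being the quadratic form
  of \<open>z\<close>. Below the cut the six shortest vectors dominate; the values
  \<open>Q\<^sub>1, Q\<^sub>2, Q\<^sub>3\<close> of \<open>Q\<close> at a superbase satisfy
  \<open>(Q\<^sub>1 + Q\<^sub>2 + Q\<^sub>3)\<^sup>2 - 2 (Q\<^sub>1\<^sup>2 + Q\<^sub>2\<^sup>2 + Q\<^sub>3\<^sup>2) = 4\<close> (Heron), and this together with the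
  convexity of \<open>h b\<close> makes the hexagonal point the strict minimizer there for \<open>0 \<le> b \<le> 2\<surd>2\<close>. For \<open>b = 0\<close>
  the same holds on the whole domain.

  Above the cut Poisson summation in \<open>n\<close> gives, with \<open>t = y/\<alpha>\<close>, \<open>s = \<pi>t\<close> and \<open>\<beta> = b/(2\<surd>2)\<close>, the expansion
  \<open>\<surd>t ((1 - \<beta>)/2 + \<beta> (s - 1) e\<^sup>-\<^sup>s\<^sup>/\<^sup>2 - (2s - 1) e\<^sup>-\<^sup>s + \<dots>)\<close> of the energy, independent of \<open>x\<close> up to far smaller
  terms. These are strictly smallest on \<open>x = 1/2\<close>, where the energy is strictly convex
  in \<open>\<surd>t\<close>. For \<open>\<beta> = 1\<close> the energy is positive and tends to 0, for \<open>\<beta> > 1\<close> it is unbounded below, and for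
  \<open>\<beta> < 1\<close> it tends to infinity.

  The threshold is the infimum over \<open>z\<close> of the \<open>b\<close> at which \<open>z\<close> and the hexagonal point have equal energy. Beyond
  it some point above the cut beats the hexagonal point, and convexity gives the unique minimizer.
\<close>

section \<open>The modular group and the fundamental domain\<close>

text \<open>The cut at \<open>3 * \<alpha>\<close> has to serve two regimes. Below it every nonzero
  vector has \<open>pi * \<alpha> * qform z v\<close> at least pi/3, and exp (pi/3) exceeds 2 sqrt 2
  by less than one percent, so no pair energy is negative; above it s >= 3 pi > 9, enough for the
  first harmonics to control the dual series. The energy is affine in \<open>b\<close>, and the case
  b = 0 at parameter 2 alpha shows that the hexagonal point strictly minimizes
  \<open>K (2 * \<alpha>)\<close>. So for each other point of the domain the values of
  \<open>b\<close> at which the hexagonal point wins form a half-line; this covers negative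
  \<open>b\<close> and makes the infimum of the endpoints the threshold. The bound 21/10 for it also
  gives beta >= 7/10, on which the convexity estimate draws. At b = 2 sqrt 2 the constant dual terms
  cancel: going from alpha to 2 alpha, the factors 1/(pi alpha) and sqrt (y/alpha) contribute 1/2
  and 1/sqrt 2. Near the hexagonal point, with common value w and total displacement s, Heron's
  identity turns the second-order gain into about w s, against a first-order loss of about (w - 1)
  s. The difference is small compared with either, which is why the pair estimates need sharp
  constants.\<close>

definition qform :: "complex \<Rightarrow> int \<times> int \<Rightarrow> real" where
  "qform z v = (cmod (of_int (fst v) * z + of_int (snd v)))\<^sup>2 / Im z"

lemma qform_0_1: "qform z (0, 1) = 1 / Im z"
  by (simp add: qform_def)

lemma qform_minus_inverse:
  assumes "Im z > 0"
  shows "qform (- 1 / z) (m, n) = qform z (n, - m)"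
proof -
  have z: "z \<noteq> 0" using assms by auto
  have "of_int m * (- 1 / z) + of_int n = (of_int n * z + of_int (- m)) / z"
    using z by (simp add: field_simps)
  moreover have "Im (- 1 / z) = Im z / (cmod z)\<^sup>2"
    by (simp add: Im_divide cmod_power2)
  ultimately show ?thesis
    using z assms by (simp add: qform_def norm_divide power_divide)
qed

lemma qform_plus_1: "qform (z + 1) (m, n) = qform z (m, n + m)"
  by (simp add: qform_def algebra_simps)

lemma qform_minus_cnj: "qform (- cnj z) (m, n) = qform z (- m, n)"
proof -
  have "of_int m * (- cnj z) + of_int n = cnj (of_int (- m) * z + of_int n)" by simp
  then show ?thesis
    unfolding qform_def fst_conv snd_conv by (simp only: complex_mod_cnj) simp
qed

text \<open>Each generator amounts to a unimodular change of basis of the lattice, which merely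
  relabels the index pairs; every sum over all pairs is then invariant.\<close>

lemma qform_generator:
  assumes "g \<in> modular_generators" "z \<in> upper_half_plane"
  obtains \<sigma> where "bij \<sigma>" "qform (g z) = qform z \<circ> \<sigma>"
proof -
  have z: "Im z > 0" using assms by (simp add: upper_half_plane_def)
  have 1: "bij (\<lambda>(m, n). (n, - m) :: int \<times> int)"
    by (rule o_bij[where g = "\<lambda>(m, n). (- n, m)"]) (auto simp: fun_eq_iff)
  have 2: "bij (\<lambda>(m, n). (m, n + m) :: int \<times> int)"
    by (rule o_bij[where g = "\<lambda>(m, n). (m, n - m)"]) (auto simp: fun_eq_iff)
  have 3: "bij (\<lambda>(m, n). (- m, n) :: int \<times> int)"
    by (rule o_bij[where g = "\<lambda>(m, n). (- m, n)"]) (auto simp: fun_eq_iff)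
  consider "g z = - 1 / z" | "g z = z + 1" | "g z = - cnj z"
    using assms by (auto simp: modular_generators_def)
  then show ?thesis
  proof cases
    case 1
    show ?thesis
      by (rule that[OF \<open>bij (\<lambda>(m, n). (n, - m))\<close>])
        (use qform_minus_inverse[OF z] in \<open>auto simp: fun_eq_iff 1 simp del: minus_divide_left\<close>)
  next
    case 2
    show ?thesis
      by (rule that[OF \<open>bij (\<lambda>(m, n). (m, n + m))\<close>]) (auto simp: fun_eq_iff 2 qform_plus_1)
  next
    case 3
    show ?thesis
      by (rule that[OF \<open>bij (\<lambda>(m, n). (- m, n))\<close>]) (auto simp: fun_eq_iff 3 qform_minus_cnj)
  qed
qed

section \<open>Orbits of the group and invariant functions\<close>

lemma carrier_modular_group_subset:
  "carrier modular_group \<subseteq> carrier (BijGroup upper_half_plane)"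
  unfolding modular_group_def
  by (rule group.carrier_subgroup_generated_subset[OF group_BijGroup])

lemma generator_in_modular_group:
  "g \<in> modular_generators \<Longrightarrow> g \<in> carrier modular_group"
  using modular_generators_subset
  by (auto simp: modular_group_def carrier_subgroup_generated intro!: generate.incl)

lemma subgroup_modular_group: "subgroup (carrier modular_group) (BijGroup upper_half_plane)"
  unfolding modular_group_def
  by (rule group.subgroup_subgroup_generated[OF group_BijGroup])

lemma BijGroup_app:
  "g \<in> carrier (BijGroup S) \<Longrightarrow> z \<in> S \<Longrightarrow> g z \<in> S"
  by (auto simp: BijGroup_def Bij_def bij_betw_def)

lemma BijGroup_mult_app:
  assumes "g \<in> carrier (BijGroup S)" "h \<in> carrier (BijGroup S)" "z \<in> S"
  shows "(g \<otimes>\<^bsub>BijGroup S\<^esub> h) z = g (h z)"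
  using assms by (auto simp: BijGroup_def compose_def)

lemma BijGroup_inv_app:
  assumes "g \<in> carrier (BijGroup S)" "z \<in> S"
  shows "g ((inv\<^bsub>BijGroup S\<^esub> g) z) = z" "(inv\<^bsub>BijGroup S\<^esub> g) (g z) = z"
proof -
  interpret group "BijGroup S" by (rule group_BijGroup)
  have one: "\<one>\<^bsub>BijGroup S\<^esub> z = z" using assms by (simp add: BijGroup_def)
  show "g ((inv\<^bsub>BijGroup S\<^esub> g) z) = z"
    using BijGroup_mult_app[OF assms(1) inv_closed[OF assms(1)] assms(2)] one assms(1) by simp
  show "(inv\<^bsub>BijGroup S\<^esub> g) (g z) = z"
    using BijGroup_mult_app[OF inv_closed[OF assms(1)] assms(1) assms(2)] one assms(1) by simp
qed

text \<open>Induction over the generated subgroup. It is applied with \<open>\<phi>\<close> a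
  lattice sum, with \<open>\<phi>\<close> the range of \<open>qform\<close>, and with a constant
  \<open>\<phi>\<close> when only membership in the half plane is wanted.\<close>

lemma modular_orbit_invariant:
  assumes gen: "\<And>g u. g \<in> modular_generators \<Longrightarrow> u \<in> upper_half_plane \<Longrightarrow> \<phi> (g u) = \<phi> u"
    and w: "w \<in> modular_orbit z" and z: "z \<in> upper_half_plane"
  shows "w \<in> upper_half_plane" "\<phi> w = \<phi> z"
proof -
  let ?B = "BijGroup upper_half_plane"
  interpret group ?B by (rule group_BijGroup)
  obtain g where g: "g \<in> carrier modular_group" "w = g z"
    using w by (auto simp: modular_orbit_def orbit_def)
  show "w \<in> upper_half_plane"
    using BijGroup_app[of g upper_half_plane z] g z carrier_modular_group_subset by auto
  have "g \<in> generate ?B (carrier ?B \<inter> modular_generators)"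
    using g(1) by (simp add: modular_group_def carrier_subgroup_generated)
  then have "g \<in> carrier ?B \<and> (\<forall>u\<in>upper_half_plane. \<phi> (g u) = \<phi> u)"
  proof (induction rule: generate.induct)
    case one
    show ?case by (rule conjI[OF one_closed]) (simp add: BijGroup_def)
  next
    case (incl h)
    then show ?case using gen by auto
  next
    case (inv h)
    then have h: "h \<in> carrier ?B" "h \<in> modular_generators" by auto
    have "\<phi> ((inv\<^bsub>?B\<^esub> h) u) = \<phi> u" if u: "u \<in> upper_half_plane" for u
      using gen[OF h(2) BijGroup_app[OF inv_closed[OF h(1)] u]] BijGroup_inv_app(1)[OF h(1) u] by simp
    then show ?case using h by auto
  next
    case (eng h1 h2)
    then show ?case by (auto simp: BijGroup_mult_app BijGroup_app)
  qed
  then show "\<phi> w = \<phi> z" using g z by auto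
qed

lemma modular_orbit_refl: "z \<in> upper_half_plane \<Longrightarrow> z \<in> modular_orbit z"
  unfolding modular_orbit_def orbit_def
  using subgroup.one_closed[OF subgroup_modular_group]
  by (auto simp: BijGroup_def intro!: exI[of _ "\<lambda>x\<in>upper_half_plane. x"])

lemma modular_orbit_trans:
  assumes "v \<in> modular_orbit w" "w \<in> modular_orbit z" "z \<in> upper_half_plane"
  shows "v \<in> modular_orbit z"
proof -
  obtain g h where gh: "g \<in> carrier modular_group" "v = g w" "h \<in> carrier modular_group" "w = h z"
    using assms by (auto simp: modular_orbit_def orbit_def)
  have "v = (g \<otimes>\<^bsub>BijGroup upper_half_plane\<^esub> h) z"
    using gh assms(3) carrier_modular_group_subset by (subst BijGroup_mult_app) auto
  then show ?thesis
    using subgroup.m_closed[OF subgroup_modular_group gh(1,3)]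
    by (auto simp: modular_orbit_def orbit_def)
qed

lemma modular_orbit_sym:
  assumes "w \<in> modular_orbit z" "z \<in> upper_half_plane"
  shows "z \<in> modular_orbit w"
proof -
  obtain g where g: "g \<in> carrier modular_group" "w = g z"
    using assms by (auto simp: modular_orbit_def orbit_def)
  then have "z = (inv\<^bsub>BijGroup upper_half_plane\<^esub> g) w"
    using BijGroup_inv_app(2)[OF _ assms(2)] carrier_modular_group_subset by auto
  then show ?thesis
    using subgroup.m_inv_closed[OF subgroup_modular_group g(1)]
    by (auto simp: modular_orbit_def orbit_def)
qed

lemma modular_orbit_step:
  assumes "g \<in> modular_generators" "z \<in> upper_half_plane"
  shows "g z \<in> modular_orbit z"
  using generator_in_modular_group[OF assms(1)] by (auto simp: modular_orbit_def orbit_def)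

lemma K_qform:
  "K \<alpha> z = (\<Sum>\<^sub>\<infinity>v. qform z v * exp (- pi * \<alpha> * qform z v))"
  by (simp add: K_def qform_def case_prod_unfold)

lemma infsum_qform_orbit:
  fixes f :: "real \<Rightarrow> real"
  assumes "w \<in> modular_orbit z" "z \<in> upper_half_plane"
  shows "(\<Sum>\<^sub>\<infinity>v. f (qform w v)) = (\<Sum>\<^sub>\<infinity>v. f (qform z v))"
proof (rule modular_orbit_invariant(2)[OF _ assms, where \<phi> = "\<lambda>u. \<Sum>\<^sub>\<infinity>v. f (qform u v)"])
  fix g u assume "g \<in> modular_generators" "u \<in> upper_half_plane"
  then obtain \<sigma> where "bij \<sigma>" "qform (g u) = qform u \<circ> \<sigma>" by (rule qform_generator)
  then show "(\<Sum>\<^sub>\<infinity>v. f (qform (g u) v)) = (\<Sum>\<^sub>\<infinity>v. f (qform u v))"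
    using infsum_reindex_bij_betw[of \<sigma> UNIV UNIV "\<lambda>v. f (qform u v)"] by simp
qed

lemma K_orbit:
  "w \<in> modular_orbit z \<Longrightarrow> z \<in> upper_half_plane \<Longrightarrow> K \<alpha> w = K \<alpha> z"
  unfolding K_qform by (rule infsum_qform_orbit)

text \<open>An ellipse contains finitely many lattice points: the imaginary part bounds
  \<open>m\<close>, then the triangle inequality bounds \<open>n\<close>.\<close>

lemma finite_qform_le:
  assumes "Im z > 0"
  shows "finite {v. qform z v \<le> c}"
proof -
  define B where "B = sqrt (\<bar>c\<bar> * Im z)"
  define M where "M = \<lceil>B / Im z\<rceil>"
  define N where "N = \<lceil>B + of_int M * cmod z\<rceil>"
  have "v \<in> {-M..M} \<times> {-N..N}" if "qform z v \<le> c" for v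
  proof -
    obtain m n where v: "v = (m, n)" by (cases v)
    let ?w = "of_int m * z + of_int n"
    have "(cmod ?w)\<^sup>2 \<le> c * Im z"
      using that assms by (simp add: qform_def v divide_le_eq)
    also have "\<dots> \<le> \<bar>c\<bar> * Im z" using assms by (simp add: mult_right_mono)
    finally have w: "cmod ?w \<le> B" unfolding B_def by (rule real_le_rsqrt)
    have "\<bar>of_int m * Im z\<bar> \<le> cmod ?w" using abs_Im_le_cmod[of ?w] by simp
    then have "\<bar>of_int m\<bar> * Im z \<le> B" using w assms by (simp add: abs_mult)
    then have "\<bar>real_of_int m\<bar> \<le> B / Im z" using assms by (simp add: le_divide_eq)
    also have "\<dots> \<le> of_int M" by (simp add: M_def)
    finally have m: "\<bar>real_of_int m\<bar> \<le> of_int M" .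
    have "of_int n = ?w - of_int m * z" by simp
    then have "cmod (of_int n) \<le> cmod ?w + cmod (of_int m * z)" by (metis norm_triangle_ineq4)
    then have "\<bar>real_of_int n\<bar> \<le> B + of_int M * cmod z"
      using w m mult_right_mono[OF m, of "cmod z"] by (simp add: norm_mult)
    also have "\<dots> \<le> of_int N" by (simp add: N_def)
    finally have n: "\<bar>real_of_int n\<bar> \<le> of_int N" .
    show ?thesis using m n by (auto simp: v abs_le_iff)
  qed
  then have "{v. qform z v \<le> c} \<subseteq> {-M..M} \<times> {-N..N}" by blast
  then show ?thesis by (rule finite_subset) auto
qed

section \<open>Reduction to the fundamental domain\<close>

definition fundamental_domain :: "complex set" where
  "fundamental_domain = {z. 0 < Im z \<and> 0 \<le> Re z \<and> Re z \<le> 1 / 2 \<and> 1 \<le> cmod z}"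

lemma orbit_translate:
  assumes "z \<in> upper_half_plane"
  shows "z + of_int k \<in> modular_orbit z"
proof -
  let ?T = "\<lambda>\<tau>\<in>upper_half_plane. \<tau> + 1"
  have T: "?T \<in> modular_generators" by (simp add: modular_generators_def)
  have mem: "z + of_int j \<in> upper_half_plane" for j using assms by (simp add: upper_half_plane_def)
  have up: "z + of_int (j + 1) \<in> modular_orbit (z + of_int j)" for j
    using modular_orbit_step[OF T mem[of j]] mem[of j] by (simp add: algebra_simps)
  show ?thesis
  proof (induction k rule: int_induct[where k = 0])
    case base
    then show ?case using modular_orbit_refl[OF assms] by simp
  next
    case (step1 i)
    then show ?case using modular_orbit_trans[OF up _ assms] by blast
  next
    case (step2 i)
    have "z + of_int (i - 1) \<in> modular_orbit (z + of_int i)"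
      using modular_orbit_sym[OF up[of "i - 1"] mem] by simp
    then show ?case using modular_orbit_trans[OF _ step2(2) assms] by blast
  qed
qed

text \<open>Since 1 / Im is the value of the form at (0, 1) and the whole orbit shares one set of
  values, only finitely many heights reach that of \<open>z\<close>. A highest orbit point,
  translated and reflected, has modulus at least 1 because its inversion is no higher.\<close>

lemma fundamental_domain_reduction:
  assumes "z \<in> upper_half_plane"
  obtains w where "w \<in> fundamental_domain" "w \<in> modular_orbit z"
proof -
  have Imz: "Im z > 0" using assms by (simp add: upper_half_plane_def)
  define A where "A = {1 / Im w |w. w \<in> modular_orbit z \<and> 1 / Im w \<le> 1 / Im z}"
  have rng: "range (qform w) = range (qform z)" if "w \<in> modular_orbit z" for w
  proof (rule modular_orbit_invariant(2)[OF _ that assms, where \<phi> = "\<lambda>u. range (qform u)"])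
    fix g u assume "g \<in> modular_generators" "u \<in> upper_half_plane"
    then obtain \<sigma> where "bij \<sigma>" "qform (g u) = qform u \<circ> \<sigma>" by (rule qform_generator)
    then show "range (qform (g u)) = range (qform u)"
      by (metis bij_is_surj fun.set_map)
  qed
  have "A \<subseteq> qform z ` {v. qform z v \<le> 1 / Im z}"
  proof
    fix a assume "a \<in> A"
    then obtain w where w: "w \<in> modular_orbit z" "a = qform w (0, 1)" "a \<le> 1 / Im z"
      by (auto simp: A_def qform_0_1)
    then have "a \<in> range (qform z)" using rng by blast
    then show "a \<in> qform z ` {v. qform z v \<le> 1 / Im z}" using w(3) by auto
  qed
  then have fin: "finite A" using finite_qform_le[OF Imz] by (meson finite_imageI finite_subset)
  have ne: "A \<noteq> {}" unfolding A_def using modular_orbit_refl[OF assms] by blast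
  obtain w where w: "w \<in> modular_orbit z" "1 / Im w = Min A" "1 / Im w \<le> 1 / Im z"
  proof -
    have "Min A \<in> A" by (rule Min_in[OF fin ne])
    then show ?thesis using that unfolding A_def mem_Collect_eq by metis
  qed
  have uhp: "u \<in> upper_half_plane" if "u \<in> modular_orbit z" for u
    using modular_orbit_invariant(1)[of "\<lambda>_. ()", OF _ that assms] by simp
  have max: "Im u \<le> Im w" if "u \<in> modular_orbit z" for u
  proof (rule ccontr)
    assume *: "\<not> Im u \<le> Im w"
    have pos: "Im w > 0" "Im u > 0" using uhp[OF w(1)] uhp[OF that] by (auto simp: upper_half_plane_def)
    then have lt: "1 / Im u < 1 / Im w" using * by (simp add: frac_less2)
    then have "1 / Im u \<in> A" using w(3) that by (auto simp: A_def intro!: exI[of _ u])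
    then show False using Min_le[OF fin] w(2) lt by fastforce
  qed
  define u where "u = w + of_int (- round (Re w))"
  have u: "u \<in> modular_orbit z"
    unfolding u_def using modular_orbit_trans[OF orbit_translate[OF uhp[OF w(1)]] w(1) assms] .
  have Re_u: "\<bar>Re u\<bar> \<le> 1 / 2" using of_int_round_abs_le[of "Re w"] by (simp add: u_def abs_minus_commute)
  define v where "v = (if Re u \<ge> 0 then u else - cnj u)"
  have "- cnj u \<in> modular_orbit u"
    using modular_orbit_step[of "\<lambda>\<tau>\<in>upper_half_plane. - cnj \<tau>", OF _ uhp[OF u]] uhp[OF u]
    by (simp add: modular_generators_def)
  then have v: "v \<in> modular_orbit z"
    unfolding v_def using u modular_orbit_trans[OF _ u assms] by auto
  have Imv: "Im v = Im w" "Im v > 0"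
    using uhp[OF w(1)] by (auto simp: v_def u_def upper_half_plane_def)
  have "- 1 / v \<in> modular_orbit v"
    using modular_orbit_step[of "\<lambda>\<tau>\<in>upper_half_plane. - 1 / \<tau>", OF _ uhp[OF v]] uhp[OF v]
    by (simp add: modular_generators_def)
  then have "Im (- 1 / v) \<le> Im v" using max modular_orbit_trans[OF _ v assms] Imv by metis
  then have "Im v / (cmod v)\<^sup>2 \<le> Im v" by (simp add: Im_divide cmod_power2)
  moreover have "0 < (cmod v)\<^sup>2" using Imv by auto
  ultimately have "1 \<le> (cmod v)\<^sup>2" using Imv by (simp add: divide_le_eq)
  then have "1 \<le> cmod v" using power2_le_imp_le[of 1 "cmod v"] by simp
  then have "v \<in> fundamental_domain"
    using Re_u Imv by (auto simp: fundamental_domain_def v_def)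
  then show ?thesis using v that by blast
qed

section \<open>Poisson summation\<close>

lemma abs_le_power2_int: "\<bar>real_of_int k\<bar> \<le> (real_of_int k)\<^sup>2"
proof -
  have "\<bar>k\<bar> * 1 \<le> \<bar>k\<bar> * \<bar>k\<bar>" by (cases "k = 0") (simp, intro mult_left_mono, auto)
  then have "real_of_int \<bar>k\<bar> \<le> real_of_int (\<bar>k\<bar> * \<bar>k\<bar>)" by (simp only: of_int_le_iff mult_1_right)
  then show ?thesis by (simp add: power2_eq_square)
qed

lemma has_sum_diff_real:
  fixes f g :: "'a \<Rightarrow> real"
  assumes "(f has_sum a) A" "(g has_sum b) A"
  shows "((\<lambda>x. f x - g x) has_sum (a - b)) A"
  using has_sum_add[OF assms(1) has_sum_cmult_right[OF assms(2), of "- 1"]] by simp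

lemma has_sum_power_abs_int:
  fixes q :: real
  assumes "0 \<le> q" "q < 1"
  shows "((\<lambda>k::int. q ^ nat \<bar>k\<bar>) has_sum ((1 + q) / (1 - q))) UNIV"
proof -
  have nonneg: "((\<lambda>n. q ^ n) has_sum (1 / (1 - q))) UNIV"
    using assms by (intro sums_nonneg_imp_has_sum geometric_sums) auto
  have neg: "((\<lambda>n. q ^ Suc n) has_sum (q * (1 / (1 - q)))) UNIV"
    using has_sum_cmult_right[OF nonneg, of q] by simp
  have "((\<lambda>k::int. q ^ nat \<bar>k\<bar>) has_sum (1 / (1 - q))) {0..}"
  proof (subst has_sum_reindex_bij_betw[symmetric, where g = int and A = UNIV])
    show "bij_betw int UNIV {0..}" by (rule bij_betwI[where g = nat]) auto
  qed (use nonneg in simp)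
  moreover have "((\<lambda>k::int. q ^ nat \<bar>k\<bar>) has_sum (q * (1 / (1 - q)))) {..<0}"
  proof (subst has_sum_reindex_bij_betw[symmetric, where g = "\<lambda>n. - int (Suc n)" and A = UNIV])
    show "bij_betw (\<lambda>n. - int (Suc n)) UNIV {..<0}"
      by (rule bij_betwI[where g = "\<lambda>k. nat (- k - 1)"]) auto
    have "nat \<bar>- int (Suc n)\<bar> = Suc n" for n by (simp add: nat_eq_iff)
    then show "((\<lambda>n. q ^ nat \<bar>- int (Suc n)\<bar>) has_sum (q * (1 / (1 - q)))) UNIV"
      using neg by (simp only:)
  qed
  ultimately have "((\<lambda>k::int. q ^ nat \<bar>k\<bar>) has_sum (1 / (1 - q) + q * (1 / (1 - q)))) ({0..} \<union> {..<0})"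
    by (rule has_sum_Un_disjoint) auto
  moreover have "{0..} \<union> {..<0} = (UNIV :: int set)" by auto
  moreover have "1 / (1 - q) + q * (1 / (1 - q)) = (1 + q) / (1 - q)"
    by (simp add: add_divide_distrib)
  ultimately show ?thesis by simp
qed

lemma has_sum_power_abs_int2:
  fixes q :: real
  assumes "0 \<le> q" "q < 1"
  shows "((\<lambda>v::int \<times> int. q ^ nat \<bar>fst v\<bar> * q ^ nat \<bar>snd v\<bar>) has_sum ((1 + q) / (1 - q))\<^sup>2) UNIV"
proof -
  let ?S = "(1 + q) / (1 - q)"
  note 1 = has_sum_power_abs_int[OF assms]
  have "((\<lambda>v::int \<times> int. q ^ nat \<bar>fst v\<bar> * q ^ nat \<bar>snd v\<bar>) has_sum (?S * ?S)) (UNIV \<times> UNIV)"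
  proof (rule has_sum_SigmaI)
    fix m :: int
    show "((\<lambda>k. q ^ nat \<bar>fst (m, k)\<bar> * q ^ nat \<bar>snd (m, k)\<bar>) has_sum (q ^ nat \<bar>m\<bar> * ?S)) UNIV"
      using has_sum_cmult_right[OF 1, of "q ^ nat \<bar>m\<bar>"] by simp
  next
    show "((\<lambda>m::int. q ^ nat \<bar>m\<bar> * ?S) has_sum (?S * ?S)) UNIV"
      by (rule has_sum_cmult_left[OF 1])
  next
    have "(\<lambda>v. q ^ nat \<bar>fst v\<bar> * q ^ nat \<bar>snd v\<bar>) summable_on (UNIV \<times> UNIV :: (int \<times> int) set)"
    proof (rule summable_on_SigmaI[where g = "\<lambda>m. q ^ nat \<bar>m\<bar> * ?S"])
      show "(\<lambda>m::int. q ^ nat \<bar>m\<bar> * ?S) summable_on UNIV"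
        using has_sum_cmult_left[OF 1] has_sum_imp_summable by blast
    qed (use has_sum_cmult_right[OF 1] assms in auto)
    then show "(\<lambda>v. q ^ nat \<bar>fst v\<bar> * q ^ nat \<bar>snd v\<bar>) summable_on (UNIV \<times> UNIV :: (int \<times> int) set)" .
  qed
  then show ?thesis by (simp add: power2_eq_square)
qed

lemma exp_power_abs_int: "exp (- a) ^ nat \<bar>k\<bar> = exp (- a * \<bar>real_of_int k\<bar>)"
  by (simp add: exp_of_nat_mult[symmetric] mult.commute)

lemma gauss_summable:
  assumes "0 < a"
  shows "(\<lambda>n::int. exp (- a * (real_of_int n + s)\<^sup>2)) summable_on UNIV"
proof (rule summable_on_comparison_test)
  show "(\<lambda>n::int. exp (a * (\<bar>s\<bar> + 1)) * exp (- a) ^ nat \<bar>n\<bar>) summable_on UNIV"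
    using has_sum_power_abs_int[of "exp (- a)"] assms
    by (intro summable_on_cmult_right) (auto dest: has_sum_imp_summable)
  fix n :: int
  have "0 \<le> (\<bar>real_of_int n + s\<bar> - 1 / 2)\<^sup>2" by simp
  then have "\<bar>real_of_int n + s\<bar> - 1 / 4 \<le> (real_of_int n + s)\<^sup>2"
    by (simp add: power2_eq_square algebra_simps)
  then have "\<bar>real_of_int n\<bar> - (\<bar>s\<bar> + 1) \<le> (real_of_int n + s)\<^sup>2" by linarith
  then have "- a * (real_of_int n + s)\<^sup>2 \<le> - a * (\<bar>real_of_int n\<bar> - (\<bar>s\<bar> + 1))"
    using assms by simp
  then have "exp (- a * (real_of_int n + s)\<^sup>2) \<le> exp (a * (\<bar>s\<bar> + 1) + - a * \<bar>real_of_int n\<bar>)"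
    by (simp add: algebra_simps)
  then show "exp (- a * (real_of_int n + s)\<^sup>2) \<le> exp (a * (\<bar>s\<bar> + 1)) * exp (- a) ^ nat \<bar>n\<bar>"
    unfolding exp_power_abs_int exp_add .
qed auto

lemma gauss_summable0: "0 < a \<Longrightarrow> (\<lambda>n::int. exp (- a * (real_of_int n)\<^sup>2)) summable_on UNIV"
  using gauss_summable[of a 0] by simp

text \<open>The enumeration \<open>int_decode\<close> carries sums over the integers to
  \<open>suminf\<close>, where the Weierstrass test and termwise differentiation are
  available.\<close>

lemma summable_int_decode:
  fixes f :: "int \<Rightarrow> real"
  assumes "f summable_on UNIV"
  shows "summable (\<lambda>i. f (int_decode i))"
  using assms summable_on_reindex_bij_betw[OF bij_int_decode, of f]
  by (auto intro: summable_on_imp_summable)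

lemma infsum_int_decode:
  fixes f :: "int \<Rightarrow> real"
  assumes "f summable_on UNIV"
  shows "(\<Sum>\<^sub>\<infinity>n. f n) = (\<Sum>i. f (int_decode i))"
proof -
  have "((\<lambda>i. f (int_decode i)) has_sum (\<Sum>\<^sub>\<infinity>n. f n)) UNIV"
    using has_sum_reindex_bij_betw[OF bij_int_decode, of f] assms by simp
  then show ?thesis using has_sum_imp_sums sums_unique by blast
qed

text \<open>The powers of \<open>cos\<^sup>2 (\<pi> x)\<close> are trigonometric polynomials that concentrate at 0.\<close>

lemma fourier_coefficients_zero:
  fixes D :: "real \<Rightarrow> complex"
  assumes cont: "continuous_on {- 1 / 2..1 / 2} D"
    and zero: "\<And>k::int. integral {- 1 / 2..1 / 2} (\<lambda>x. D x * cis (2 * pi * k * x)) = 0"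
  shows "D 0 = 0"
proof (rule ccontr)
  assume D0: "D 0 \<noteq> 0"
  let ?I = "{- 1 / 2..1 / 2 :: real}"
  define w where "w x = (cos (pi * x))\<^sup>2" for x :: real
  have w_cis: "complex_of_real (w x) = (2 + cis (2 * pi * x) + cis (- (2 * pi * x))) / 4" for x
    unfolding w_def complex_eq_iff by (simp add: cos_double_cos[of "pi * x"] mult.assoc)
  have intD: "(\<lambda>x. D x * cis (2 * pi * of_int k * x) * complex_of_real (w x) ^ N) integrable_on ?I" for k N
    unfolding w_def by (intro integrable_continuous_interval continuous_intros cont)
  \<comment> \<open>The index \<open>k\<close> must stay arbitrary in the induction: multiplication
    by \<open>w\<close> shifts the frequency by one in both directions.\<close>
  have zeroN: "integral ?I (\<lambda>x. D x * cis (2 * pi * of_int k * x) * complex_of_real (w x) ^ N) = 0" for N k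
  proof (induction N arbitrary: k)
    case 0
    then show ?case using zero by simp
  next
    case (Suc N)
    let ?f = "\<lambda>k x. D x * cis (2 * pi * of_int k * x) * complex_of_real (w x) ^ N"
    have eq: "?f k x * complex_of_real (w x) = (1 / 4) * (2 * ?f k x + ?f (k + 1) x + ?f (k - 1) x)" for x
    proof -
      have "cis (2 * pi * of_int (k + 1) * x) = cis (2 * pi * of_int k * x) * cis (2 * pi * x)"
        "cis (2 * pi * of_int (k - 1) * x) = cis (2 * pi * of_int k * x) * cis (- (2 * pi * x))"
        by (simp_all add: cis_mult algebra_simps)
      then show ?thesis unfolding w_cis by (simp add: algebra_simps)
    qed
    have "(\<lambda>x. D x * cis (2 * pi * of_int k * x) * complex_of_real (w x) ^ Suc N)
        = (\<lambda>x. (1 / 4) * (2 * ?f k x + ?f (k + 1) x + ?f (k - 1) x))"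
      unfolding power_Suc2 eq[symmetric] by (simp only: mult.assoc)
    then have "integral ?I (\<lambda>x. D x * cis (2 * pi * of_int k * x) * complex_of_real (w x) ^ Suc N)
        = integral ?I (\<lambda>x. (1 / 4) * (2 * ?f k x + ?f (k + 1) x + ?f (k - 1) x))"
      by (simp only:)
    also have "\<dots> = (1 / 4) * (2 * integral ?I (?f k) + integral ?I (?f (k + 1)) + integral ?I (?f (k - 1)))"
      using intD[of k N] intD[of "k + 1" N] intD[of "k - 1" N]
      by (simp add: integral_add integrable_add integrable_on_mult_right)
    also have "\<dots> = 0" unfolding Suc by simp
    finally show ?case .
  qed
  \<comment> \<open>Multiplication by the conjugate of D 0 reduces the claim to a real function that
    is positive near 0.\<close>
  define r where "r x = Re (cnj (D 0) * D x)" for x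
  have cont_r: "continuous_on ?I r" unfolding r_def by (intro continuous_intros cont)
  have "r 0 = (cmod (D 0))\<^sup>2" by (simp add: r_def cmod_power2) (simp add: power2_eq_square)
  then have r0: "r 0 > 0" using D0 by simp
  have int_r: "(\<lambda>x. r x * w x ^ N) integrable_on ?I" for N
    unfolding w_def by (intro integrable_continuous_interval continuous_intros cont_r)
  have zero_r: "integral ?I (\<lambda>x. r x * w x ^ N) = 0" for N
  proof -
    have "((\<lambda>x. D x * complex_of_real (w x) ^ N) has_integral 0) ?I"
      using zeroN[of 0 N] intD[of 0 N] by (simp add: has_integral_iff)
    then have "((\<lambda>x. cnj (D 0) * (D x * complex_of_real (w x) ^ N)) has_integral (cnj (D 0) * 0)) ?I"
      by (rule has_integral_mult_right)
    then have "((\<lambda>x. Re (cnj (D 0) * (D x * complex_of_real (w x) ^ N))) has_integral Re (cnj (D 0) * 0)) ?I"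
      by (rule has_integral_Re)
    moreover have "Re (cnj (D 0) * (D x * complex_of_real (w x) ^ N)) = r x * w x ^ N" for x
      unfolding r_def of_real_power[symmetric] by (simp add: algebra_simps)
    ultimately show ?thesis by (simp add: integral_unique)
  qed
  have "0 \<in> ?I" by simp
  then obtain d where d: "d > 0" "\<And>x. x \<in> ?I \<Longrightarrow> \<bar>x\<bar> < d \<Longrightarrow> \<bar>r x - r 0\<bar> < r 0 / 2"
    using cont_r r0 unfolding continuous_on_iff dist_real_def
    by (metis diff_zero half_gt_zero)
  define e where "e = min (d / 2) (1 / 4)"
  have e: "0 < e" "e \<le> 1 / 4" "e < d" using d(1) by (auto simp: e_def)
  have "compact (r ` ?I)" by (intro compact_continuous_image cont_r) auto
  then obtain M where M: "\<And>x. x \<in> ?I \<Longrightarrow> \<bar>r x\<bar> \<le> M" "M > 0"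
    using compact_imp_bounded bounded_pos by (metis imageI real_norm_def)
  \<comment> \<open>The kernel is at least \<open>q\<close> for |x| <= e/2 and at most p < q for |x|
    >= e; in between only the sign of \<open>r\<close> is used. Comparing \<open>q ^ N\<close> with
    \<open>p ^ N\<close> for large \<open>N\<close> gives the contradiction.\<close>
  define p where "p = w e"
  define q where "q = w (e / 2)"
  have cos_anti: "w y \<le> w x" if "\<bar>x\<bar> \<le> \<bar>y\<bar>" "\<bar>y\<bar> \<le> 1 / 2" for x y
  proof -
    have "pi * \<bar>y\<bar> \<le> pi * (1 / 2)" using that by (intro mult_left_mono) auto
    moreover have "- (pi / 2) \<le> pi * \<bar>y\<bar>"
      using pi_gt_zero mult_nonneg_nonneg[of pi "\<bar>y\<bar>"] by linarith
    ultimately have "cos (pi * \<bar>y\<bar>) \<le> cos (pi * \<bar>x\<bar>)" "0 \<le> cos (pi * \<bar>y\<bar>)"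
      using that by (auto intro!: cos_monotone_0_pi_le cos_ge_zero mult_left_mono)
    then have "(cos (pi * \<bar>y\<bar>))\<^sup>2 \<le> (cos (pi * \<bar>x\<bar>))\<^sup>2" by (rule power_mono)
    moreover have "cos (pi * \<bar>u\<bar>) = cos (pi * u)" for u by (cases "u \<ge> 0") auto
    ultimately show ?thesis by (simp add: w_def)
  qed
  have pq: "0 < p" "p < q"
  proof -
    have lt: "pi * e \<le> pi * (1 / 4)" using e by (intro mult_left_mono) auto
    then have c: "0 < cos (pi * e)" using e by (intro cos_gt_zero) auto
    then show "0 < p" by (simp add: p_def w_def)
    have "cos (pi * e) < cos (pi * (e / 2))"
      using lt e by (intro cos_monotone_0_pi) auto
    then show "p < q" using c by (simp add: p_def q_def w_def power_strict_mono)
  qed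
  have w0: "w x \<ge> 0" for x by (simp add: w_def)
  have lower: "(if x \<in> {- e / 2..e / 2} then r 0 / 2 * q ^ N else 0) - M * p ^ N \<le> r x * w x ^ N"
    if x: "x \<in> ?I" for x N
  proof (cases "\<bar>x\<bar> \<le> e")
    case True
    then have rx: "r x \<ge> r 0 / 2" using d(2)[OF x] e by (auto simp: abs_if split: if_splits)
    show ?thesis
    proof (cases "x \<in> {- e / 2..e / 2}")
      case True
      then have "q ^ N \<le> w x ^ N"
        unfolding q_def using e by (intro power_mono cos_anti w0) auto
      then have "r 0 / 2 * q ^ N \<le> r x * w x ^ N" using rx r0 pq by (intro mult_mono) auto
      moreover have "M * p ^ N \<ge> 0" using M pq by simp
      ultimately show ?thesis unfolding if_P[OF True] by linarith
    next
      case False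
      have "M * p ^ N \<ge> 0" "r x * w x ^ N \<ge> 0" using M pq rx r0 w0 by auto
      then show ?thesis unfolding if_not_P[OF False] by linarith
    qed
  next
    case False
    have "w x ^ N \<le> p ^ N" unfolding p_def using e False x by (intro power_mono cos_anti w0) auto
    moreover have "- M \<le> r x" "- r x \<le> M" using M(1)[OF x] by auto
    ultimately have "- r x * w x ^ N \<le> M * p ^ N"
      using M w0 by (intro mult_mono) auto
    moreover have "x \<notin> {- e / 2..e / 2}" using False e by auto
    ultimately show ?thesis unfolding if_not_P[OF \<open>x \<notin> {- e / 2..e / 2}\<close>] by linarith
  qed
  have key: "e * (r 0 / 2) * q ^ N \<le> M * p ^ N" for N
  proof -
    have sub: "{- e / 2..e / 2} \<subseteq> ?I" using e by auto
    have "((\<lambda>x. r 0 / 2 * q ^ N) has_integral (e * (r 0 / 2 * q ^ N))) {- e / 2..e / 2}"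
      using has_integral_const_real[of "r 0 / 2 * q ^ N" "- e / 2" "e / 2"] e by simp
    then have 1: "((\<lambda>x. if x \<in> {- e / 2..e / 2} then r 0 / 2 * q ^ N else 0) has_integral (e * (r 0 / 2 * q ^ N))) ?I"
      using has_integral_restrict[OF sub, of "\<lambda>_. r 0 / 2 * q ^ N"] by simp
    have 2: "((\<lambda>x. M * p ^ N) has_integral (M * p ^ N)) ?I"
      using has_integral_const_real[of "M * p ^ N" "- 1 / 2" "1 / 2"] by simp
    have "e * (r 0 / 2 * q ^ N) - M * p ^ N \<le> integral ?I (\<lambda>x. r x * w x ^ N)"
      by (rule has_integral_le[OF has_integral_diff[OF 1 2] integrable_integral[OF int_r]]) (rule lower)
    then show ?thesis using zero_r by simp
  qed
  have "(\<lambda>N. (p / q) ^ N) \<longlonglongrightarrow> 0" using pq by (intro LIMSEQ_power_zero) auto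
  moreover have "0 < e * (r 0 / 2) / M" using e r0 M by simp
  ultimately obtain N where "(p / q) ^ N < e * (r 0 / 2) / M"
    by (metis (mono_tags, lifting) order_tendstoD(2) eventually_happens sequentially_bot)
  then have "M * p ^ N < e * (r 0 / 2) * q ^ N"
    using pq M by (simp add: power_divide field_simps)
  then show False using key[of N] by simp
qed

text \<open>Rescaling by c = sqrt (2 pi / t) turns this into the characteristic function of the
  standard normal distribution.\<close>

lemma gauss_fourier_transform:
  fixes t u :: real
  assumes "0 < t"
  shows "integrable lborel (\<lambda>x. complex_of_real (exp (- (pi / t) * x\<^sup>2)) * cis (2 * pi * u * x))"
    and "(CLINT x|lborel. complex_of_real (exp (- (pi / t) * x\<^sup>2)) * cis (2 * pi * u * x))
      = complex_of_real (sqrt t * exp (- pi * t * u\<^sup>2))"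
proof -
  define c where "c = sqrt (2 * pi / t)"
  have c: "c > 0" "c\<^sup>2 = 2 * pi / t" using assms by (auto simp: c_def)
  define w where "w = 2 * pi * u / c"
  let ?g = "\<lambda>x. std_normal_density x *\<^sub>R iexp (w * x)"
  have "w\<^sup>2 / 2 = pi * t * u\<^sup>2"
    using c assms by (simp add: w_def power_divide power_mult_distrib) (simp add: power2_eq_square)
  then have 1: "(CLINT x|lborel. ?g x) = complex_of_real (exp (- pi * t * u\<^sup>2))"
    using char_std_normal_distribution
    by (simp add: char_def fun_eq_iff integral_density normal_density_nonneg)
  have int_g: "integrable lborel ?g"
  proof (rule Bochner_Integration.integrable_bound[where f = std_normal_density])
    show "integrable lborel std_normal_density" by simp
  qed (auto simp: normal_density_nonneg)
  have g_c: "?g (0 + c * x) = complex_of_real (1 / sqrt (2 * pi)) *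
      (complex_of_real (exp (- (pi / t) * x\<^sup>2)) * cis (2 * pi * u * x))" for x
  proof -
    have "(c * x)\<^sup>2 / 2 = pi / t * x\<^sup>2" using c by (simp add: power_mult_distrib)
    moreover have "w * (c * x) = 2 * pi * u * x" using c by (simp add: w_def)
    then have "iexp (w * (c * x)) = cis (2 * pi * u * x)" by (simp only: cis_conv_exp)
    ultimately show ?thesis
      by (simp add: normal_density_def scaleR_conv_of_real)
  qed
  let ?f = "\<lambda>x. complex_of_real (exp (- (pi / t) * x\<^sup>2)) * cis (2 * pi * u * x)"
  have "integrable lborel (\<lambda>x. ?g (0 + c * x))"
    using lborel_integrable_real_affine[OF int_g, of c 0] c by simp
  then have "integrable lborel (\<lambda>x. complex_of_real (sqrt (2 * pi)) * (complex_of_real (1 / sqrt (2 * pi)) * ?f x))"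
    unfolding g_c by (rule integrable_mult_right)
  moreover have "complex_of_real (sqrt (2 * pi)) * (complex_of_real (1 / sqrt (2 * pi)) * z) = z" for z
    by simp
  ultimately show int_f: "integrable lborel ?f" by (simp only:)
  have "(CLINT x|lborel. ?g x) = c *\<^sub>R (CLINT x|lborel. ?g (0 + c * x))"
    using lborel_integral_real_affine[of c ?g 0] c by simp
  also have "\<dots> = complex_of_real (c / sqrt (2 * pi)) * (CLINT x|lborel. ?f x)"
    unfolding g_c by (simp add: scaleR_conv_of_real)
  also have "c / sqrt (2 * pi) = 1 / sqrt t"
    by (simp add: c_def real_sqrt_divide)
  finally have "complex_of_real (exp (- pi * t * u\<^sup>2)) = complex_of_real (1 / sqrt t) * (CLINT x|lborel. ?f x)"
    using 1 by simp
  then show "(CLINT x|lborel. ?f x) = complex_of_real (sqrt t * exp (- pi * t * u\<^sup>2))"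
    using assms by (simp add: field_simps)
qed

lemma integral_cis_period:
  fixes k :: int
  shows "((\<lambda>x. cis (2 * pi * k * x)) has_integral (if k = 0 then 1 else 0)) {- 1 / 2..1 / 2 :: real}"
proof (cases "k = 0")
  case True
  then show ?thesis using has_integral_const_real[of "1::complex" "- 1 / 2" "1 / 2"] by simp
next
  case False
  define c where "c = 2 * pi * real_of_int k"
  have c: "c \<noteq> 0" using False by (simp add: c_def)
  have "((\<lambda>x. cis (c * x)) has_integral (cis (c * (1 / 2)) / (\<i> * c) - cis (c * (- 1 / 2)) / (\<i> * c))) {- 1 / 2..1 / 2}"
  proof (rule fundamental_theorem_of_calculus)
    fix x :: real
    have "((\<lambda>x. exp (\<i> * (c * x)) / (\<i> * c)) has_vector_derivative exp (\<i> * (c * x))) (at x within {- 1 / 2..1 / 2})"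
      using c by (auto intro!: derivative_eq_intros has_vector_derivative_real_field simp: field_simps)
    then show "((\<lambda>x. cis (c * x) / (\<i> * c)) has_vector_derivative cis (c * x)) (at x within {- 1 / 2..1 / 2})"
      by (simp add: cis_conv_exp)
  qed simp
  moreover have "cis (c * (1 / 2)) = cis (c * (- 1 / 2))"
  proof -
    have "cis (c * (1 / 2)) = cis (c * (- 1 / 2)) * cis c" by (simp add: cis_mult)
    also have "cis c = 1" unfolding c_def using cis_multiple_2pi[of "of_int k"] by simp
    finally show ?thesis by simp
  qed
  ultimately show ?thesis using False by (simp add: c_def)
qed

text \<open>The Weierstrass test gives uniform convergence, which survives multiplication by a
  character of modulus 1, and uniform limits commute with integration over a compact
  interval.\<close>

lemma fourier_series_termwise:
  fixes \<phi> :: "nat \<Rightarrow> real \<Rightarrow> complex" and k :: int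
  assumes cont: "\<And>i. continuous_on {- 1 / 2..1 / 2} (\<phi> i)"
    and bound: "\<And>i x. x \<in> {- 1 / 2..1 / 2} \<Longrightarrow> norm (\<phi> i x) \<le> M i" and M: "summable M"
  shows "continuous_on {- 1 / 2..1 / 2} (\<lambda>x. \<Sum>i. \<phi> i x)"
    and "(\<lambda>i. integral {- 1 / 2..1 / 2} (\<lambda>x. \<phi> i x * cis (2 * pi * k * x)))
      sums integral {- 1 / 2..1 / 2} (\<lambda>x. (\<Sum>i. \<phi> i x) * cis (2 * pi * k * x))"
proof -
  let ?I = "{- 1 / 2..1 / 2 :: real}"
  have ul: "uniform_limit ?I (\<lambda>n x. \<Sum>i<n. \<phi> i x) (\<lambda>x. \<Sum>i. \<phi> i x) sequentially"
    using bound M by (intro Weierstrass_m_test)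
  show "continuous_on ?I (\<lambda>x. \<Sum>i. \<phi> i x)"
    by (rule uniform_limit_theorem[OF always_eventually[OF allI] ul])
      (rule continuous_on_sum[OF cont], rule sequentially_bot)
  have ul': "uniform_limit ?I (\<lambda>n x. \<Sum>i<n. \<phi> i x * cis (2 * pi * k * x))
      (\<lambda>x. \<Sum>i. \<phi> i x * cis (2 * pi * k * x)) sequentially"
    using bound M by (intro Weierstrass_m_test[where M = M]) (auto simp: norm_mult)
  have int: "(\<lambda>x. \<phi> i x * cis (2 * pi * k * x)) integrable_on ?I" for i
    by (intro integrable_continuous_interval continuous_intros cont)
  have cont': "continuous_on ?I (\<lambda>x. \<Sum>i<n. \<phi> i x * cis (2 * pi * k * x))" for n
    by (intro continuous_intros cont)
  obtain I J where IJ: "\<And>n. ((\<lambda>x. \<Sum>i<n. \<phi> i x * cis (2 * pi * k * x)) has_integral I n) ?I"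
    "((\<lambda>x. \<Sum>i. \<phi> i x * cis (2 * pi * k * x)) has_integral J) ?I" "I \<longlonglongrightarrow> J"
    by (rule uniform_limit_integral[OF ul' cont' sequentially_bot]) blast
  have "I n = (\<Sum>i<n. integral ?I (\<lambda>x. \<phi> i x * cis (2 * pi * k * x)))" for n
    using integral_unique[OF IJ(1)[of n]] integral_sum[of "{..<n}", OF _ int] by simp
  then have I_eq: "I = (\<lambda>n. \<Sum>i<n. integral ?I (\<lambda>x. \<phi> i x * cis (2 * pi * k * x)))" by blast
  have sums_J: "(\<lambda>i. integral ?I (\<lambda>x. \<phi> i x * cis (2 * pi * k * x))) sums J"
    using IJ(3) unfolding I_eq sums_def .
  have "(\<Sum>i. \<phi> i x * cis (2 * pi * k * x)) = (\<Sum>i. \<phi> i x) * cis (2 * pi * k * x)"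
    if "x \<in> ?I" for x
    using suminf_mult2[of "\<lambda>i. \<phi> i x"] summable_comparison_test'[OF M] bound[OF that] by metis
  then have "integral ?I (\<lambda>x. \<Sum>i. \<phi> i x * cis (2 * pi * k * x))
      = integral ?I (\<lambda>x. (\<Sum>i. \<phi> i x) * cis (2 * pi * k * x))"
    by (rule integral_cong)
  then have "J = integral ?I (\<lambda>x. (\<Sum>i. \<phi> i x) * cis (2 * pi * k * x))"
    using integral_unique[OF IJ(2)] by simp
  then show "(\<lambda>i. integral ?I (\<lambda>x. \<phi> i x * cis (2 * pi * k * x)))
      sums integral ?I (\<lambda>x. (\<Sum>i. \<phi> i x) * cis (2 * pi * k * x))"
    using sums_J by (simp only:)
qed

text \<open>Half-open intervals form a genuine partition of the line; each is then closed at the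
  cost of a null set, so that the gauge integral over a compact interval applies.\<close>

lemma unit_interval_tiling:
  fixes f :: "real \<Rightarrow> complex"
  assumes int: "integrable lborel f" and cont: "continuous_on UNIV f"
  shows "(\<Sum>i. integral {- 1 / 2..1 / 2} (\<lambda>x. f (s + x + int_decode i))) = (CLINT x|lborel. f x)"
proof -
  define A where "A i = {s + int_decode i - 1 / 2..<s + int_decode i + 1 / 2}" for i
  have "x \<in> A (int_encode \<lfloor>x - s + 1 / 2\<rfloor>)" for x
    unfolding A_def by simp linarith
  then have UN: "(\<Union>i. A i) = UNIV" by blast
  have "A i \<inter> A j = {}" if "i \<noteq> j" for i j
  proof -
    have "int_decode i \<noteq> int_decode j" using that by (simp add: int_decode_eq)
    then have "int_decode i + 1 \<le> int_decode j \<or> int_decode j + 1 \<le> int_decode i" by linarith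
    then have "real_of_int (int_decode i) + 1 \<le> int_decode j \<or> real_of_int (int_decode j) + 1 \<le> int_decode i" by linarith
    then show ?thesis unfolding A_def by auto
  qed
  then have "(CLINT x:(\<Union>i. A i)|lborel. f x) = (\<Sum>i. (CLINT x:A i|lborel. f x))"
  proof (intro lebesgue_integral_countable_add)
    show "set_integrable lborel (\<Union>i. A i) f" using int by (simp add: UN set_integrable_def)
  qed (auto simp: A_def)
  moreover have "(CLINT x:A i|lborel. f x) = integral {- 1 / 2..1 / 2} (\<lambda>x. f (s + x + int_decode i))" for i
  proof -
    let ?g = "\<lambda>x. f (s + x + int_decode i)"
    have cont_g: "continuous_on {- 1 / 2..1 / 2} ?g"
      by (intro continuous_on_compose2[OF cont] continuous_intros) auto
    have "(CLINT x:A i|lborel. f x) = (CLINT x:{- 1 / 2..<1 / 2}|lborel. ?g x)"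
      unfolding set_lebesgue_integral_def
      by (subst lborel_integral_real_affine[of 1 _ "s + int_decode i"])
        (auto simp: A_def indicator_def algebra_simps intro!: Bochner_Integration.integral_cong)
    also have "\<dots> = (CLINT x:{- 1 / 2..1 / 2}|lborel. ?g x)"
    proof (rule set_integral_null_delta)
      show "integrable lborel ?g"
        using lborel_integrable_real_affine[OF int, of 1 "s + int_decode i"] by (simp add: algebra_simps)
      have "sym_diff {- 1 / 2..<1 / 2} {- 1 / 2..1 / 2 :: real} = {1 / 2}" by auto
      moreover have "{1 / 2 :: real} \<in> null_sets lborel" by (rule finite_imp_null_set_lborel) simp
      ultimately show "sym_diff {- 1 / 2..<1 / 2} {- 1 / 2..1 / 2 :: real} \<in> null_sets lborel"
        by (simp only:)
    qed simp_all
    also have "\<dots> = integral {- 1 / 2..1 / 2} ?g"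
      by (rule set_borel_integral_eq_integral(2)[OF borel_integrable_atLeastAtMost'[OF cont_g]])
    finally show ?thesis .
  qed
  ultimately show ?thesis by (simp add: UN set_lebesgue_integral_def)
qed

text \<open>A majorant independent of \<open>x\<close> over one period, as the Weierstrass test
  requires; it comes from (n + s + 2 x)^2 >= 0.\<close>

lemma gauss_shift_bound:
  fixes a n s x :: real
  assumes "0 < a" "\<bar>x\<bar> \<le> 1 / 2"
  shows "exp (- a * (s + x + n)\<^sup>2) \<le> exp (a / 4) * exp (- (a / 2) * (n + s)\<^sup>2)"
proof -
  have "x\<^sup>2 \<le> (1 / 2)\<^sup>2" using assms(2) by (metis abs_le_square_iff abs_of_pos half_gt_zero zero_less_one)
  moreover have "0 \<le> (n + s + 2 * x)\<^sup>2" by simp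
  ultimately have "(n + s)\<^sup>2 / 2 - 1 / 4 \<le> (s + x + n)\<^sup>2"
    by (simp add: power2_eq_square algebra_simps)
  then have "a * ((n + s)\<^sup>2 / 2 - 1 / 4) \<le> a * (s + x + n)\<^sup>2" using assms(1) by simp
  then show ?thesis by (simp add: algebra_simps flip: exp_add)
qed

text \<open>With s + x in place of \<open>s\<close>, both sides are continuous in \<open>x\<close>
  over one period and have the same Fourier coefficients: by unfolding to an integral over the line
  on the left, by orthogonality on the right. Uniqueness is needed at x = 0 only.\<close>

lemma poisson_gauss:
  fixes t s :: real
  assumes "0 < t"
  shows "(\<Sum>\<^sub>\<infinity>n::int. exp (- (pi / t) * (n + s)\<^sup>2))
    = sqrt t * (\<Sum>\<^sub>\<infinity>k::int. exp (- pi * t * (real_of_int k)\<^sup>2) * cos (2 * pi * k * s))"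
proof -
  let ?I = "{- 1 / 2..1 / 2 :: real}"
  let ?e = "\<lambda>i. real_of_int (int_decode i)"
  define \<phi> where "\<phi> i x = complex_of_real (exp (- (pi / t) * (s + x + ?e i)\<^sup>2))" for i x
  define \<psi> where "\<psi> i x = complex_of_real (sqrt t * exp (- pi * t * (?e i)\<^sup>2)) * cis (2 * pi * ?e i * (s + x))" for i x
  define A where "A i = exp (pi / t / 4) * exp (- (pi / t / 2) * (?e i + s)\<^sup>2)" for i
  define B where "B i = sqrt t * exp (- (pi * t) * (?e i)\<^sup>2)" for i
  have summA: "summable A"
    unfolding A_def using assms by (intro summable_mult summable_int_decode gauss_summable) auto
  have summB: "summable B"
    unfolding B_def using assms by (intro summable_mult summable_int_decode gauss_summable0) auto
  have contphi: "continuous_on ?I (\<phi> i)" for i unfolding \<phi>_def by (intro continuous_intros)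
  have contpsi: "continuous_on ?I (\<psi> i)" for i unfolding \<psi>_def by (intro continuous_intros)
  have boundphi: "norm (\<phi> i x) \<le> A i" if "x \<in> ?I" for i x
    using gauss_shift_bound[of "pi / t" x s "?e i"] assms that by (auto simp: \<phi>_def A_def abs_le_iff)
  have boundpsi: "norm (\<psi> i x) \<le> B i" for i x
    using assms by (simp add: \<psi>_def B_def norm_mult)
  note F = fourier_series_termwise[OF contphi boundphi summA]
  note G = fourier_series_termwise[OF contpsi boundpsi summB]
  have coeff_phi: "integral ?I (\<lambda>x. (\<Sum>i. \<phi> i x) * cis (2 * pi * k * x))
      = cis (- (2 * pi * k * s)) * complex_of_real (sqrt t * exp (- pi * t * (real_of_int k)\<^sup>2))" for k :: int
  proof -
    let ?f = "\<lambda>x. complex_of_real (exp (- (pi / t) * x\<^sup>2)) * cis (2 * pi * real_of_int k * x)"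
    have "\<phi> i x * cis (2 * pi * k * x) = cis (- (2 * pi * k * s)) * ?f (s + x + ?e i)" for i x
    proof -
      have "2 * pi * real_of_int k * (s + x + ?e i)
          = 2 * pi * k * s + 2 * pi * k * x + 2 * pi * real_of_int (k * int_decode i)"
        by (simp add: algebra_simps)
      moreover have "cis (2 * pi * real_of_int (k * int_decode i)) = 1"
        by (rule cis_multiple_2pi) (rule Ints_of_int)
      ultimately have "cis (2 * pi * real_of_int k * (s + x + ?e i)) = cis (2 * pi * k * s) * cis (2 * pi * k * x)"
        by (simp only: cis_mult[symmetric] mult_1_right)
      then have "cis (- (2 * pi * k * s)) * ?f (s + x + ?e i)
          = (cis (- (2 * pi * k * s)) * cis (2 * pi * k * s)) * (\<phi> i x * cis (2 * pi * k * x))"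
        unfolding \<phi>_def by (simp only: mult_ac)
      also have "cis (- (2 * pi * k * s)) * cis (2 * pi * k * s) = 1" by (simp only: cis_mult) simp
      finally show ?thesis by simp
    qed
    then have "(\<lambda>i. cis (- (2 * pi * k * s)) * integral ?I (\<lambda>x. ?f (s + x + ?e i)))
        sums integral ?I (\<lambda>x. (\<Sum>i. \<phi> i x) * cis (2 * pi * k * x))"
      using F(2)[of k] by (simp only: integral_mult_right)
    then have "integral ?I (\<lambda>x. (\<Sum>i. \<phi> i x) * cis (2 * pi * k * x))
        = (\<Sum>i. cis (- (2 * pi * k * s)) * integral ?I (\<lambda>x. ?f (s + x + ?e i)))"
      by (rule sums_unique)
    also have "\<dots> = cis (- (2 * pi * k * s)) * (\<Sum>i. integral ?I (\<lambda>x. ?f (s + x + ?e i)))"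
    proof (rule suminf_mult)
      show "summable (\<lambda>i. integral ?I (\<lambda>x. ?f (s + x + ?e i)))"
        using \<open>(\<lambda>i. cis (- (2 * pi * k * s)) * integral ?I (\<lambda>x. ?f (s + x + ?e i))) sums _\<close>
        by (auto dest: sums_summable)
    qed
    also have "(\<Sum>i. integral ?I (\<lambda>x. ?f (s + x + ?e i))) = (CLINT x|lborel. ?f x)"
      using gauss_fourier_transform(1)[OF assms]
      by (rule unit_interval_tiling) (intro continuous_intros)
    finally show ?thesis using gauss_fourier_transform(2)[OF assms] by simp
  qed
  have coeff_psi: "integral ?I (\<lambda>x. (\<Sum>i. \<psi> i x) * cis (2 * pi * k * x))
      = cis (- (2 * pi * k * s)) * complex_of_real (sqrt t * exp (- pi * t * (real_of_int k)\<^sup>2))" for k :: int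
  proof -
    let ?c = "\<lambda>i. complex_of_real (sqrt t * exp (- pi * t * (?e i)\<^sup>2)) * cis (2 * pi * ?e i * s)"
    have "\<psi> i x * cis (2 * pi * k * x) = ?c i * cis (2 * pi * real_of_int (int_decode i + k) * x)" for i x
      by (simp add: \<psi>_def cis_mult algebra_simps)
    then have *: "integral ?I (\<lambda>x. \<psi> i x * cis (2 * pi * k * x))
        = (if i = int_encode (- k) then ?c (int_encode (- k)) else 0)" for i
      using integral_unique[OF integral_cis_period[of "int_decode i + k"]]
      by (auto simp: integral_mult_right) (metis add_eq_0_iff2 int_decode_inverse)
    have "(\<lambda>i. if i = int_encode (- k) then ?c (int_encode (- k)) else 0) sums ?c (int_encode (- k))"
      using sums_single[of "int_encode (- k)" "\<lambda>_. ?c (int_encode (- k))"] by simp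
    then have "integral ?I (\<lambda>x. (\<Sum>i. \<psi> i x) * cis (2 * pi * k * x)) = ?c (int_encode (- k))"
      using G(2)[of k] unfolding * by (rule sums_unique2[symmetric])
    then show ?thesis by (simp add: mult_ac)
  qed
  have "(\<Sum>i. \<phi> i 0) - (\<Sum>i. \<psi> i 0) = 0"
  proof (rule fourier_coefficients_zero)
    show "continuous_on ?I (\<lambda>x. (\<Sum>i. \<phi> i x) - (\<Sum>i. \<psi> i x))" by (intro continuous_intros F G)
    fix k :: int
    have "(\<lambda>x. (\<Sum>i. \<phi> i x) * cis (2 * pi * k * x)) integrable_on ?I"
      by (intro integrable_continuous_interval continuous_intros F(1))
    moreover have "(\<lambda>x. (\<Sum>i. \<psi> i x) * cis (2 * pi * k * x)) integrable_on ?I"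
      by (intro integrable_continuous_interval continuous_intros G(1))
    ultimately show "integral ?I (\<lambda>x. ((\<Sum>i. \<phi> i x) - (\<Sum>i. \<psi> i x)) * cis (2 * pi * k * x)) = 0"
      unfolding left_diff_distrib by (simp only: integral_diff coeff_phi coeff_psi diff_self)
  qed
  then have eq: "Re (\<Sum>i. \<phi> i 0) = Re (\<Sum>i. \<psi> i 0)" by simp
  have "summable (\<lambda>i. \<phi> i 0)" by (rule summable_comparison_test'[OF summA, of 0]) (rule boundphi, simp)
  moreover have "summable (\<lambda>i. \<psi> i 0)" by (rule summable_comparison_test'[OF summB, of 0]) (rule boundpsi)
  ultimately have "(\<Sum>i. Re (\<phi> i 0)) = (\<Sum>i. Re (\<psi> i 0))" using eq by (simp add: Re_suminf)
  moreover have "(\<Sum>i. Re (\<phi> i 0)) = (\<Sum>\<^sub>\<infinity>n::int. exp (- (pi / t) * (n + s)\<^sup>2))"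
    using gauss_summable[of "pi / t" s] assms by (subst infsum_int_decode) (auto simp: \<phi>_def add.commute)
  moreover have "(\<Sum>i. Re (\<psi> i 0)) = (\<Sum>\<^sub>\<infinity>k::int. sqrt t * (exp (- pi * t * (real_of_int k)\<^sup>2) * cos (2 * pi * k * s)))"
  proof (subst infsum_int_decode)
    have "(\<lambda>k::int. norm (exp (- pi * t * (real_of_int k)\<^sup>2) * cos (2 * pi * k * s))) summable_on UNIV"
      by (rule summable_on_comparison_test[OF gauss_summable0[of "pi * t"]])
        (use assms in \<open>auto simp: abs_mult mult_left_le\<close>)
    then show "(\<lambda>k::int. sqrt t * (exp (- pi * t * (real_of_int k)\<^sup>2) * cos (2 * pi * k * s))) summable_on UNIV"
      by (rule summable_on_cmult_right[OF abs_summable_summable])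
  qed (simp add: \<psi>_def mult_ac)
  ultimately show ?thesis by (simp add: infsum_cmult_right')
qed

section \<open>The first moment, by differentiating Poisson's identity\<close>

lemma exp_x_bound: "0 \<le> u \<Longrightarrow> u * exp (- u) \<le> exp (- u / 2)" for u :: real
proof -
  assume "0 \<le> u"
  have "u \<le> 1 + u / 2 + (u / 2)\<^sup>2 / 2"
    using sum_power2_ge_zero[of "u / 2 - 1" 0] by (simp add: power2_eq_square algebra_simps)
  also have "\<dots> \<le> exp (u / 2)" using \<open>0 \<le> u\<close> by (intro exp_lower_Taylor_quadratic) auto
  finally have "u * exp (- u) \<le> exp (u / 2) * exp (- u)" by (intro mult_right_mono) auto
  then show ?thesis by (simp add: exp_add[symmetric])
qed

text \<open>For r between t/2 and 2 t the differentiated terms are dominated by (2/t) exp (-(t/4)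
  a): half of the exponent absorbs the factor \<open>a\<close>. It serves both sides of Poisson's
  identity.\<close>

lemma has_derivative_gauss_series:
  fixes s c :: real and a f :: "int \<Rightarrow> real"
  assumes "0 < t" and pos: "\<And>n. 0 \<le> a n" and f: "\<And>n. \<bar>f n\<bar> \<le> 1"
    and summ: "\<And>r. 0 < r \<Longrightarrow> (\<lambda>n. exp (- r * a n)) summable_on UNIV"
  shows "((\<lambda>r. \<Sum>i. exp (- r * a (int_decode i)) * f (int_decode i)) has_field_derivative
      (\<Sum>i. - a (int_decode i) * exp (- t * a (int_decode i)) * f (int_decode i))) (at t)"
proof (rule has_field_derivative_series'(2))
  let ?S = "{t / 2<..<2 * t}"
  show "convex ?S" by simp
  show "t \<in> ?S" "t \<in> interior ?S" using assms(1) by (auto simp: interior_open)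
  fix i r
  assume "r \<in> ?S"
  show "((\<lambda>r. exp (- r * a (int_decode i)) * f (int_decode i)) has_field_derivative
      - a (int_decode i) * exp (- r * a (int_decode i)) * f (int_decode i)) (at r within ?S)"
    by (auto intro!: derivative_eq_intros)
next
  show "summable (\<lambda>i. exp (- t * a (int_decode i)) * f (int_decode i))"
  proof (rule summable_comparison_test'[where N = 0])
    show "summable (\<lambda>i. exp (- t * a (int_decode i)))" by (rule summable_int_decode[OF summ[OF assms(1)]])
    show "norm (exp (- t * a (int_decode i)) * f (int_decode i)) \<le> exp (- t * a (int_decode i))" for i
      using f[of "int_decode i"] by (simp add: abs_mult mult_left_le)
  qed
next
  let ?S = "{t / 2<..<2 * t}"
  show "uniformly_convergent_on ?S (\<lambda>n r. \<Sum>i<n. - a (int_decode i) * exp (- r * a (int_decode i)) * f (int_decode i))"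
  proof (rule Weierstrass_m_test')
    show "summable (\<lambda>i. (2 / t) * exp (- (t / 4) * a (int_decode i)))"
      using summable_mult[OF summable_int_decode[OF summ[of "t / 4"]]] assms(1) by auto
    fix i r assume r: "r \<in> ?S"
    let ?a = "a (int_decode i)"
    have r0: "0 < r" "t / 2 \<le> r" using r assms(1) by auto
    have "norm (- ?a * exp (- r * ?a) * f (int_decode i)) \<le> ?a * exp (- r * ?a)"
      using f[of "int_decode i"] pos[of "int_decode i"] by (simp add: abs_mult mult_left_le)
    also have "\<dots> = (1 / r) * ((r * ?a) * exp (- (r * ?a)))" using r0 by simp
    also have "\<dots> \<le> (1 / r) * exp (- (r * ?a) / 2)"
      using r0 pos[of "int_decode i"] by (intro mult_left_mono exp_x_bound) auto
    also have "\<dots> \<le> (2 / t) * exp (- (t / 4) * ?a)"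
      using r0 pos[of "int_decode i"] assms(1) mult_right_mono[OF r0(2), of ?a]
      by (intro mult_mono) (auto simp: field_simps)
    finally show "norm (- ?a * exp (- r * ?a) * f (int_decode i)) \<le> (2 / t) * exp (- (t / 4) * ?a)" .
  qed
qed

text \<open>This is \<open>t\<close> times the derivative of G (1/t) = sqrt t * H t, with
  \<open>G\<close> and \<open>H\<close> the two Gaussian series; the summand 1/2 comes from
  differentiating sqrt t.\<close>

lemma poisson_gauss_moment:
  fixes t s :: real
  assumes "0 < t"
  shows "(\<Sum>\<^sub>\<infinity>n::int. (pi / t * (n + s)\<^sup>2) * exp (- (pi / t * (n + s)\<^sup>2)))
    = sqrt t * (\<Sum>\<^sub>\<infinity>k::int. (1 / 2 - pi * t * (real_of_int k)\<^sup>2) * exp (- (pi * t * (real_of_int k)\<^sup>2)) * cos (2 * pi * k * s))"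
proof -
  let ?e = "\<lambda>i. real_of_int (int_decode i)"
  define a where "a n = pi * (real_of_int n + s)\<^sup>2" for n
  define b where "b k = pi * (real_of_int k)\<^sup>2" for k
  define f where "f k = cos (2 * pi * real_of_int k * s)" for k
  have a0: "0 \<le> a n" and b0: "0 \<le> b n" and f1: "\<bar>f n\<bar> \<le> 1" for n by (auto simp: a_def b_def f_def)
  have summ_a: "(\<lambda>n. exp (- r * a n)) summable_on UNIV" if "0 < r" for r
    using gauss_summable[of "r * pi" s] that by (simp add: a_def mult.assoc)
  have summ_b: "(\<lambda>n. exp (- r * b n)) summable_on UNIV" if "0 < r" for r
    using gauss_summable0[of "r * pi"] that by (simp add: b_def mult.assoc)
  have summ_bf: "(\<lambda>n. exp (- r * b n) * f n) summable_on UNIV" if "0 < r" for r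
  proof (rule abs_summable_summable, rule summable_on_comparison_test[OF summ_b[OF that]])
    show "norm (exp (- r * b n) * f n) \<le> exp (- r * b n)" for n
      using f1[of n] by (simp add: abs_mult mult_left_le)
  qed auto
  define G where "G r = (\<Sum>i. exp (- r * a (int_decode i)) * 1)" for r
  define H where "H r = (\<Sum>i. exp (- r * b (int_decode i)) * f (int_decode i))" for r
  define G' where "G' = (\<Sum>i. - a (int_decode i) * exp (- (1 / t) * a (int_decode i)) * 1)"
  define H' where "H' = (\<Sum>i. - b (int_decode i) * exp (- t * b (int_decode i)) * f (int_decode i))"
  have GH: "G (1 / r) = sqrt r * H r" if "0 < r" for r
  proof -
    have "G (1 / r) = (\<Sum>\<^sub>\<infinity>n. exp (- (1 / r) * a n))"
      using summ_a[of "1 / r"] that by (simp add: G_def infsum_int_decode)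
    moreover have "H r = (\<Sum>\<^sub>\<infinity>n. exp (- r * b n) * f n)"
      using summ_bf[OF that] by (simp add: H_def infsum_int_decode)
    ultimately show ?thesis
      using poisson_gauss[OF that, of s] by (simp add: a_def b_def f_def mult_ac)
  qed
  have dG: "(G has_field_derivative G') (at (1 / t))"
    unfolding G_def G'_def using assms by (intro has_derivative_gauss_series summ_a a0) auto
  have dH: "(H has_field_derivative H') (at t)"
    unfolding H_def H'_def using assms by (intro has_derivative_gauss_series summ_b b0 f1) auto
  have "((\<lambda>r. 1 / r) has_field_derivative (- 1 / t\<^sup>2)) (at t)"
    using assms by (auto intro!: derivative_eq_intros simp: power2_eq_square)
  from DERIV_chain2[OF dG this]
  have 1: "((\<lambda>r. G (1 / r)) has_field_derivative G' * (- 1 / t\<^sup>2)) (at t)" .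
  have 2: "((\<lambda>r. sqrt r * H r) has_field_derivative (sqrt t * H' + H t / (2 * sqrt t))) (at t)"
    using assms by (auto intro!: derivative_eq_intros dH simp: field_simps)
  have "((\<lambda>r. G (1 / r)) has_field_derivative (sqrt t * H' + H t / (2 * sqrt t))) (at t)"
    by (rule has_field_derivative_transform_within_open[OF 2, of "{0<..}"]) (use assms GH in auto)
  then have "G' * (- 1 / t\<^sup>2) = sqrt t * H' + H t / (2 * sqrt t)" using 1 DERIV_unique by blast
  then have "t * (G' * (- 1 / t\<^sup>2)) = t * (sqrt t * H' + H t / (2 * sqrt t))" by simp
  moreover have "t * (H t / (2 * sqrt t)) = sqrt t * (H t / 2)"
    using assms by (simp add: field_simps)
  moreover have "t * (G' * (- 1 / t\<^sup>2)) = - G' / t"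
    using assms by (simp add: power2_eq_square)
  ultimately have main: "- G' / t = sqrt t * (H t / 2 + t * H')"
    by (simp only: distrib_left mult_ac)
  have bound_a: "(1 / t * a n) * exp (- (1 / t * a n)) \<le> exp (- (1 / (2 * t)) * a n)" for n
    using exp_x_bound[of "1 / t * a n"] a0[of n] assms by (simp add: mult.commute)
  have bound_b: "(t * b n) * exp (- (t * b n)) \<le> exp (- (t / 2) * b n)" for n
    using exp_x_bound[of "t * b n"] b0[of n] assms by simp
  have sa: "(\<lambda>n. (1 / t * a n) * exp (- (1 / t * a n))) summable_on UNIV"
    by (rule summable_on_comparison_test[OF summ_a[of "1 / (2 * t)"]]) (use bound_a a0 assms in auto)
  have sb: "(\<lambda>n. (t * b n) * exp (- (t * b n)) * f n) summable_on UNIV"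
  proof (rule abs_summable_summable, rule summable_on_comparison_test[OF summ_b[of "t / 2"]])
    fix n
    have "norm ((t * b n) * exp (- (t * b n)) * f n) \<le> (t * b n) * exp (- (t * b n))"
      using f1[of n] b0[of n] assms by (simp add: abs_mult mult_left_le)
    then show "norm ((t * b n) * exp (- (t * b n)) * f n) \<le> exp (- (t / 2) * b n)" using bound_b[of n] by linarith
  qed (use assms in auto)
  have "(\<Sum>\<^sub>\<infinity>n. (1 / t * a n) * exp (- (1 / t * a n))) = - G' / t"
  proof -
    have "summable (\<lambda>i. - t * ((1 / t * a (int_decode i)) * exp (- (1 / t * a (int_decode i)))))"
      by (rule summable_mult[OF summable_int_decode[OF sa]])
    then have s: "summable (\<lambda>i. - a (int_decode i) * exp (- (1 / t) * a (int_decode i)) * 1)"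
      using assms by (simp add: mult.assoc)
    have "- G' / t = (- 1 / t) * G'" by simp
    also have "\<dots> = (\<Sum>i. (- 1 / t) * (- a (int_decode i) * exp (- (1 / t) * a (int_decode i)) * 1))"
      unfolding G'_def by (rule suminf_mult[OF s, symmetric])
    finally show ?thesis by (subst infsum_int_decode[OF sa]) simp
  qed
  moreover have "(\<Sum>\<^sub>\<infinity>n. (1 / 2 - t * b n) * exp (- (t * b n)) * f n) = H t / 2 + t * H'"
  proof -
    have "summable (\<lambda>i. (- 1 / t) * ((t * b (int_decode i)) * exp (- (t * b (int_decode i))) * f (int_decode i)))"
      by (rule summable_mult[OF summable_int_decode[OF sb]])
    then have s: "summable (\<lambda>i. - b (int_decode i) * exp (- t * b (int_decode i)) * f (int_decode i))"
      using assms by (simp add: mult.assoc)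
    have s1: "(\<lambda>n. (1 / 2) * (exp (- t * b n) * f n)) summable_on UNIV"
      by (rule summable_on_cmult_right[OF summ_bf[OF assms]])
    have "(\<Sum>\<^sub>\<infinity>n. (1 / 2 - t * b n) * exp (- (t * b n)) * f n)
        = (\<Sum>\<^sub>\<infinity>n. (1 / 2) * (exp (- t * b n) * f n) + - ((t * b n) * exp (- (t * b n)) * f n))"
      by (simp add: algebra_simps)
    also have "\<dots> = (\<Sum>\<^sub>\<infinity>n. (1 / 2) * (exp (- t * b n) * f n)) + (\<Sum>\<^sub>\<infinity>n. - ((t * b n) * exp (- (t * b n)) * f n))"
      by (rule infsum_add[OF s1 summable_on_uminus[THEN iffD2, OF sb]])
    also have "(\<Sum>\<^sub>\<infinity>n. (1 / 2) * (exp (- t * b n) * f n)) = (1 / 2) * H t"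
      using infsum_int_decode[OF summ_bf[OF assms]] by (simp only: infsum_cmult_right' H_def)
    also have "(\<Sum>\<^sub>\<infinity>n. - ((t * b n) * exp (- (t * b n)) * f n)) = t * H'"
    proof -
      have "t * H' = (\<Sum>i. t * (- b (int_decode i) * exp (- t * b (int_decode i)) * f (int_decode i)))"
        unfolding H'_def by (rule suminf_mult[OF s, symmetric])
      then show ?thesis by (subst infsum_int_decode[OF summable_on_uminus[THEN iffD2, OF sb]]) (simp add: mult.assoc)
    qed
    finally show ?thesis by simp
  qed
  ultimately show ?thesis using main by (simp add: a_def b_def f_def mult_ac)
qed

text \<open>
  Here \<open>\<mu> = \<alpha>\<^sup>2\<close> and \<open>s = \<pi>y/\<alpha>\<close>; passing from \<open>\<alpha>\<close> to \<open>2\<alpha>\<close> replaces \<open>(s, \<mu>)\<close> by \<open>(s/2, 4\<mu>)\<close>. The second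
  entry of the index is the dual variable of the Poisson summation.
\<close>

definition theta_coeff :: "real \<Rightarrow> real \<Rightarrow> int \<times> int \<Rightarrow> real" where
  "theta_coeff s \<mu> v = (1 / 2 + s * (\<mu> * (real_of_int (fst v))\<^sup>2 - (real_of_int (snd v))\<^sup>2)) * exp (- (s * (\<mu> * (real_of_int (fst v))\<^sup>2 + (real_of_int (snd v))\<^sup>2)))"

definition theta_term :: "real \<Rightarrow> real \<Rightarrow> real \<Rightarrow> int \<times> int \<Rightarrow> real" where
  "theta_term s \<mu> x v = theta_coeff s \<mu> v * cos (2 * pi * real_of_int (snd v) * (real_of_int (fst v) * x))"

definition theta_sum :: "real \<Rightarrow> real \<Rightarrow> real \<Rightarrow> real" where
  "theta_sum s \<mu> x = infsum (theta_term s \<mu> x) UNIV"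

section \<open>The energy as a dual theta series\<close>

lemma lattice_exp_summable:
  fixes c d :: real
  assumes "0 < c" "0 < d"
  shows "(\<lambda>v::int \<times> int. exp (- (c * (real_of_int (fst v))\<^sup>2 + d * (real_of_int (snd v))\<^sup>2))) summable_on UNIV"
proof (rule summable_on_comparison_test)
  let ?q = "exp (- min c d)"
  show "(\<lambda>v::int \<times> int. ?q ^ nat \<bar>fst v\<bar> * ?q ^ nat \<bar>snd v\<bar>) summable_on UNIV"
    using has_sum_power_abs_int2[of ?q] assms by (auto dest: has_sum_imp_summable)
  fix v :: "int \<times> int"
  have abs_le: "\<bar>real_of_int k\<bar> \<le> (real_of_int k)\<^sup>2" for k
  proof -
    have "\<bar>k\<bar> * 1 \<le> \<bar>k\<bar> * \<bar>k\<bar>" by (cases "k = 0") (simp, intro mult_left_mono, auto)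
    then have "real_of_int \<bar>k\<bar> \<le> real_of_int (\<bar>k\<bar> * \<bar>k\<bar>)" by (simp only: of_int_le_iff mult_1_right)
    then show ?thesis by (simp add: power2_eq_square)
  qed
  have "min c d * \<bar>real_of_int (fst v)\<bar> \<le> c * (real_of_int (fst v))\<^sup>2" "min c d * \<bar>real_of_int (snd v)\<bar> \<le> d * (real_of_int (snd v))\<^sup>2"
    using assms abs_le by (auto intro!: mult_mono)
  then show "exp (- (c * (real_of_int (fst v))\<^sup>2 + d * (real_of_int (snd v))\<^sup>2)) \<le> ?q ^ nat \<bar>fst v\<bar> * ?q ^ nat \<bar>snd v\<bar>"
    unfolding exp_power_abs_int exp_add[symmetric] by simp
qed auto

lemma theta_coeff_bound:
  fixes s \<mu> :: real
  assumes "0 < s" "0 < \<mu>"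
  shows "\<bar>theta_coeff s \<mu> v\<bar> \<le> (1 / 2 + s * (\<mu> * (real_of_int (fst v))\<^sup>2 + (real_of_int (snd v))\<^sup>2)) * exp (- (s * (\<mu> * (real_of_int (fst v))\<^sup>2 + (real_of_int (snd v))\<^sup>2)))"
proof -
  let ?p = "s * (\<mu> * (real_of_int (fst v))\<^sup>2 - (real_of_int (snd v))\<^sup>2)" and ?q = "s * (\<mu> * (real_of_int (fst v))\<^sup>2 + (real_of_int (snd v))\<^sup>2)"
  have "0 \<le> s * (\<mu> * (real_of_int (fst v))\<^sup>2)" "0 \<le> s * (real_of_int (snd v))\<^sup>2" using assms by auto
  then have "\<bar>1 / 2 + ?p\<bar> \<le> 1 / 2 + ?q" unfolding distrib_left right_diff_distrib by linarith
  then show ?thesis unfolding theta_coeff_def abs_mult abs_exp_cancel by (rule mult_right_mono) simp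
qed

lemma theta_coeff_summable:
  fixes s \<mu> :: real
  assumes "0 < s" "0 < \<mu>"
  shows "(\<lambda>v. norm (theta_coeff s \<mu> v)) summable_on UNIV"
proof (rule summable_on_comparison_test)
  show "(\<lambda>v::int \<times> int. (3 / 2) * exp (- (s * \<mu> / 2 * (real_of_int (fst v))\<^sup>2 + s / 2 * (real_of_int (snd v))\<^sup>2))) summable_on UNIV"
    using assms by (intro summable_on_cmult_right lattice_exp_summable) auto
  fix v :: "int \<times> int"
  let ?u = "s * (\<mu> * (real_of_int (fst v))\<^sup>2 + (real_of_int (snd v))\<^sup>2)"
  have u: "0 \<le> ?u" using assms by simp
  have "\<bar>theta_coeff s \<mu> v\<bar> \<le> 1 / 2 * exp (- ?u) + ?u * exp (- ?u)"
    using theta_coeff_bound[OF assms, of v] by (simp add: distrib_right)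
  also have "\<dots> \<le> 1 / 2 * exp (- ?u / 2) + exp (- ?u / 2)"
    using u by (intro add_mono exp_x_bound mult_left_mono) auto
  also have "- ?u / 2 = - (s * \<mu> / 2 * (real_of_int (fst v))\<^sup>2 + s / 2 * (real_of_int (snd v))\<^sup>2)" by (simp add: field_simps)
  finally show "norm (theta_coeff s \<mu> v) \<le> (3 / 2) * exp (- (s * \<mu> / 2 * (real_of_int (fst v))\<^sup>2 + s / 2 * (real_of_int (snd v))\<^sup>2))"
    by simp
qed auto

lemma abs_theta_term_le: "\<bar>theta_term s \<mu> x v\<bar> \<le> \<bar>theta_coeff s \<mu> v\<bar>"
  by (simp add: theta_term_def abs_mult mult_left_le)

lemma theta_term_summable:
  fixes s \<mu> :: real
  assumes "0 < s" "0 < \<mu>"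
  shows "theta_term s \<mu> x summable_on UNIV"
  by (rule abs_summable_summable, rule summable_on_comparison_test[OF theta_coeff_summable[OF assms]])
    (use abs_theta_term_le in auto)

lemma qform_Complex:
  "0 < y \<Longrightarrow> qform (Complex x y) (m, n) = y * (real_of_int m)\<^sup>2 + (real_of_int n + real_of_int m * x)\<^sup>2 / y"
  by (simp add: qform_def cmod_power2 add_divide_distrib add.commute) (simp add: power2_eq_square field_simps)

text \<open>For fixed \<open>m\<close> the exponent splits as A + u with \<open>A\<close>
  independent of \<open>n\<close>, so the summand is exp (-A) (A exp (-u) + u exp (-u)): Poisson's
  identity treats the first part and its moment version the second.\<close>

lemma K_poisson:
  assumes "0 < \<alpha>" "0 < y"
  shows "(\<lambda>v. (pi * \<alpha> * qform (Complex x y) v) * exp (- (pi * \<alpha> * qform (Complex x y) v))) summable_on UNIV"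
    and "pi * \<alpha> * K \<alpha> (Complex x y) = sqrt (y / \<alpha>) * theta_sum (pi * y / \<alpha>) (\<alpha>\<^sup>2) x"
proof -
  define t where "t = y / \<alpha>"
  have t: "0 < t" using assms by (simp add: t_def)
  let ?f = "\<lambda>v. (pi * \<alpha> * qform (Complex x y) v) * exp (- (pi * \<alpha> * qform (Complex x y) v))"
  let ?g = "theta_term (pi * t) (\<alpha>\<^sup>2) x"
  have g: "?g summable_on UNIV" using t assms by (intro theta_term_summable) auto
  then have g2: "?g summable_on (UNIV \<times> UNIV)" by simp
  have inner: "((\<lambda>n. ?f (m, n)) has_sum (sqrt t * (\<Sum>\<^sub>\<infinity>k. ?g (m, k)))) UNIV" for m
  proof -
    define A where "A = pi * \<alpha> * y * (real_of_int m)\<^sup>2"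
    define u where "u n = pi / t * (real_of_int n + real_of_int m * x)\<^sup>2" for n
    have A_eq: "A = pi * t * (\<alpha>\<^sup>2 * (real_of_int m)\<^sup>2)"
      using assms by (simp add: A_def t_def power2_eq_square)
    have fu: "?f (m, n) = exp (- A) * (A * exp (- u n) + u n * exp (- u n))" for n
    proof -
      have "pi * \<alpha> * qform (Complex x y) (m, n) = A + u n"
        using assms by (simp add: qform_Complex A_def u_def t_def algebra_simps)
      then show ?thesis by (simp add: exp_add[symmetric] algebra_simps)
    qed
    have su: "(\<lambda>n. exp (- u n)) summable_on UNIV"
      using gauss_summable[of "pi / t" "m * x"] t by (simp add: u_def)
    have suu: "(\<lambda>n. u n * exp (- u n)) summable_on UNIV"
    proof (rule summable_on_comparison_test)
      show "(\<lambda>n. exp (- (pi / (2 * t)) * (real_of_int n + m * x)\<^sup>2)) summable_on UNIV"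
        using t by (intro gauss_summable) auto
      fix n
      show "u n * exp (- u n) \<le> exp (- (pi / (2 * t)) * (real_of_int n + m * x)\<^sup>2)"
        using exp_x_bound[of "u n"] t by (simp add: u_def mult.commute)
    qed (use t in \<open>auto simp: u_def\<close>)
    let ?c = "\<lambda>k. cos (2 * pi * real_of_int k * (m * x))"
    let ?b = "\<lambda>k. exp (- (pi * t * (real_of_int k)\<^sup>2))"
    have sk: "(\<lambda>k. ?b k * ?c k) summable_on UNIV"
      by (rule abs_summable_summable, rule summable_on_comparison_test[OF gauss_summable0[of "pi * t"]])
        (use t in \<open>auto simp: abs_mult mult_left_le\<close>)
    have sg: "(\<lambda>k. ?g (m, k)) summable_on UNIV"
      using summable_on_SigmaD1[of "\<lambda>m k. ?g (m, k)" UNIV "\<lambda>_. UNIV" m] g by simp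
    have g_eq: "?g (m, k) = exp (- A) * (A * (?b k * ?c k) + (1 / 2 - pi * t * (real_of_int k)\<^sup>2) * ?b k * ?c k)" for k
    proof -
      have "exp (- (pi * t * (\<alpha>\<^sup>2 * (real_of_int m)\<^sup>2 + (real_of_int k)\<^sup>2))) = exp (- A) * ?b k"
        by (simp add: A_eq exp_add[symmetric] distrib_left)
      moreover have "pi * t * (\<alpha>\<^sup>2 * (real_of_int m)\<^sup>2 - (real_of_int k)\<^sup>2) = A - pi * t * (real_of_int k)\<^sup>2"
        by (simp add: A_eq right_diff_distrib)
      ultimately have "?g (m, k) = (1 / 2 + (A - pi * t * (real_of_int k)\<^sup>2)) * (exp (- A) * ?b k) * ?c k"
        by (simp add: theta_term_def theta_coeff_def)
      then show ?thesis by (simp add: algebra_simps)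
    qed
    have cancel: "exp A * (exp (- A) * Z) = Z" for Z
      by (simp add: mult.assoc[symmetric] exp_minus_inverse)
    \<comment> \<open>Summability of the moment series is obtained from that of
      \<open>theta_term\<close> by solving \<open>g_eq\<close> for it.\<close>
    have eq2: "(1 / 2 - pi * t * (real_of_int k)\<^sup>2) * ?b k * ?c k = exp A * ?g (m, k) + - (A * (?b k * ?c k))" for k
      unfolding g_eq cancel by simp
    have sk2: "(\<lambda>k. (1 / 2 - pi * t * (real_of_int k)\<^sup>2) * ?b k * ?c k) summable_on UNIV"
      unfolding eq2 by (intro summable_on_add summable_on_uminus[THEN iffD2] summable_on_cmult_right sg sk)
    have "((\<lambda>n. ?f (m, n)) has_sum (exp (- A) * (A * (\<Sum>\<^sub>\<infinity>n. exp (- u n)) + (\<Sum>\<^sub>\<infinity>n. u n * exp (- u n))))) UNIV"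
      unfolding fu using su suu by (intro has_sum_cmult_right has_sum_add has_sum_infsum)
    moreover have "(\<Sum>\<^sub>\<infinity>n. exp (- u n)) = sqrt t * (\<Sum>\<^sub>\<infinity>k. ?b k * ?c k)"
      using poisson_gauss[OF t, of "m * x"] by (simp add: u_def)
    moreover have "(\<Sum>\<^sub>\<infinity>n. u n * exp (- u n)) = sqrt t * (\<Sum>\<^sub>\<infinity>k. (1 / 2 - pi * t * (real_of_int k)\<^sup>2) * ?b k * ?c k)"
      using poisson_gauss_moment[OF t, of "m * x"] by (simp add: u_def)
    moreover have "((\<lambda>k. ?g (m, k)) has_sum (exp (- A) * (A * (\<Sum>\<^sub>\<infinity>k. ?b k * ?c k)
        + (\<Sum>\<^sub>\<infinity>k. (1 / 2 - pi * t * (real_of_int k)\<^sup>2) * ?b k * ?c k)))) UNIV"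
      unfolding g_eq using sk sk2 by (intro has_sum_cmult_right has_sum_add has_sum_infsum)
    ultimately show ?thesis by (simp add: infsumI algebra_simps)
  qed
  have sg: "(\<lambda>m. sqrt t * (\<Sum>\<^sub>\<infinity>k. ?g (m, k))) summable_on UNIV"
    using summable_on_Sigma_banach[of "\<lambda>m k. ?g (m, k)" UNIV "\<lambda>_. UNIV"] g2
    by (intro summable_on_cmult_right) simp
  have "?f summable_on (UNIV \<times> UNIV)"
    by (rule summable_on_SigmaI[OF inner sg]) (use assms in \<open>auto simp: qform_def\<close>)
  then show f: "?f summable_on UNIV" by simp
  have "infsum ?f (UNIV \<times> UNIV) = (\<Sum>\<^sub>\<infinity>m. \<Sum>\<^sub>\<infinity>n. ?f (m, n))"
    using f by (intro infsum_Sigma_banach[symmetric]) simp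
  also have "\<dots> = (\<Sum>\<^sub>\<infinity>m. sqrt t * (\<Sum>\<^sub>\<infinity>k. ?g (m, k)))" using infsumI[OF inner] by simp
  also have "\<dots> = sqrt t * (\<Sum>\<^sub>\<infinity>m. \<Sum>\<^sub>\<infinity>k. ?g (m, k))" by (rule infsum_cmult_right')
  also have "(\<Sum>\<^sub>\<infinity>m. \<Sum>\<^sub>\<infinity>k. ?g (m, k)) = infsum ?g (UNIV \<times> UNIV)"
    using g by (intro infsum_Sigma_banach) simp
  finally have "infsum ?f UNIV = sqrt t * infsum ?g UNIV" by simp
  moreover have "pi * \<alpha> * K \<alpha> (Complex x y) = infsum ?f UNIV"
    unfolding K_qform infsum_cmult_right'[symmetric] by (simp add: mult_ac)
  ultimately show "pi * \<alpha> * K \<alpha> (Complex x y) = sqrt (y / \<alpha>) * theta_sum (pi * y / \<alpha>) (\<alpha>\<^sup>2) x"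
    by (simp add: theta_sum_def t_def)
qed

section \<open>The energy of a pair of lattice points\<close>

lemma xexp_antimono: "1 \<le> x \<Longrightarrow> x \<le> y \<Longrightarrow> y * exp (- y) \<le> x * exp (- x)" for x y :: real
proof -
  assume xy: "1 \<le> x" "x \<le> y"
  have "y = x + (y - x) * 1" by simp
  also have "\<dots> \<le> x + (y - x) * x" using xy by (intro add_left_mono mult_left_mono) auto
  also have "\<dots> = x * (1 + (y - x))" by (simp add: algebra_simps)
  also have "\<dots> \<le> x * exp (y - x)" using xy exp_ge_add_one_self[of "y - x"] by (intro mult_left_mono) auto
  finally have "y * exp (- y) \<le> x * exp (y - x) * exp (- y)" by (intro mult_right_mono) auto
  then show ?thesis by (simp add: mult.assoc exp_add[symmetric])
qed

lemma exp_minus_le_quadratic: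
  fixes x :: real assumes "0 \<le> x" shows "exp (- x) \<le> 1 - x + x\<^sup>2 / 2"
proof -
  have p: "0 < 1 + x + x\<^sup>2 / 2" using assms by (simp add: add_pos_nonneg)
  have q: "0 \<le> 1 - x + x\<^sup>2 / 2" using sum_power2_ge_zero[of "x - 1" 1] by (simp add: power2_eq_square algebra_simps)
  have "exp (- x) * (1 + x + x\<^sup>2 / 2) \<le> exp (- x) * exp x"
    using exp_lower_Taylor_quadratic[OF assms] by (intro mult_left_mono) auto
  also have "\<dots> = 1" by (simp add: exp_minus)
  also have "1 \<le> 1 + x ^ 4 / 4" by simp
  also have "\<dots> = (1 - x + x\<^sup>2 / 2) * (1 + x + x\<^sup>2 / 2)"
    by (simp add: power2_eq_square power4_eq_xxxx algebra_simps)
  finally show ?thesis using p by (simp add: mult_le_cancel_right)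
qed

lemma exp_minus_ge_cubic:
  fixes x :: real assumes "0 \<le> x" shows "1 - x + x\<^sup>2 / 2 - x ^ 3 / 6 \<le> exp (- x)"
proof -
  let ?g = "\<lambda>x::real. exp (- x) - (1 - x + x\<^sup>2 / 2 - x ^ 3 / 6)"
  have "?g 0 \<le> ?g x"
  proof (rule DERIV_nonneg_imp_nondecreasing[OF assms])
    fix u :: real assume u: "0 \<le> u" "u \<le> x"
    have "(?g has_field_derivative (1 - u + u\<^sup>2 / 2 - exp (- u))) (at u)"
      by (auto intro!: derivative_eq_intros)
    moreover have "0 \<le> 1 - u + u\<^sup>2 / 2 - exp (- u)" using exp_minus_le_quadratic[OF u(1)] by simp
    ultimately show "\<exists>d. (?g has_field_derivative d) (at u) \<and> 0 \<le> d" by blast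
  qed
  then show ?thesis by simp
qed

lemma exp_le_quadratic_exp:
  fixes x :: real assumes "0 \<le> x" shows "exp x \<le> 1 + x + x\<^sup>2 / 2 * exp x"
proof -
  let ?g = "\<lambda>x::real. 1 + x - exp x * (1 - x\<^sup>2 / 2)"
  have "?g 0 \<le> ?g x"
  proof (rule DERIV_nonneg_imp_nondecreasing[OF assms])
    fix u :: real assume u: "0 \<le> u" "u \<le> x"
    have "(?g has_field_derivative (1 - exp u * (1 - u - u\<^sup>2 / 2))) (at u)"
      by (auto intro!: derivative_eq_intros simp: algebra_simps)
    moreover have "exp u * (1 - u - u\<^sup>2 / 2) \<le> exp u * exp (- u)"
    proof (intro mult_left_mono)
      have "0 \<le> u\<^sup>2 / 2" by simp
      then show "1 - u - u\<^sup>2 / 2 \<le> exp (- u)" using exp_ge_add_one_self[of "- u"] by linarith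
    qed simp
    then have "0 \<le> 1 - exp u * (1 - u - u\<^sup>2 / 2)" by (simp add: exp_minus)
    ultimately show "\<exists>d. (?g has_field_derivative d) (at u) \<and> 0 \<le> d" by blast
  qed
  then show ?thesis by (simp add: algebra_simps)
qed

lemma exp_1_bounds: "2718 / 1000 \<le> exp (1::real)" "exp (1::real) \<le> 2719 / 1000"
proof -
  have "\<bar>exp 1 - 5837465777 / 2147483648\<bar> \<le> (1 / 4294967296 :: real)" using e_approx_32 by simp
  then show "2718 / 1000 \<le> exp (1::real)" "exp (1::real) \<le> 2719 / 1000"
    unfolding abs_le_iff by linarith+
qed

text \<open>Taking \<open>q\<close>-th powers reduces a bound at a rational point to a comparison of
  integer powers with a decimal lower bound of e.\<close>

lemma exp_ge_rat:
  assumes "0 < q" "c ^ q \<le> (2718 / 1000) ^ p"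
  shows "c \<le> exp (real p / real q)"
proof -
  have "exp (real p / real q) ^ q = exp (1::real) ^ p"
    using assms(1) by (simp add: exp_of_nat_mult[symmetric])
  moreover have "(2718 / 1000) ^ p \<le> exp (1::real) ^ p" using exp_1_bounds by (intro power_mono) auto
  ultimately have "c ^ q \<le> exp (real p / real q) ^ q" using assms(2) by linarith
  then show ?thesis using assms(1) by (metis exp_ge_zero gr0_conv_Suc power_le_imp_le_base)
qed

lemma exp_le_rat:
  assumes "0 < q" "0 \<le> c" "(2719 / 1000) ^ p \<le> c ^ q"
  shows "exp (real p / real q) \<le> c"
proof -
  have "exp (real p / real q) ^ q = exp (1::real) ^ p"
    using assms(1) by (simp add: exp_of_nat_mult[symmetric])
  moreover have "exp (1::real) ^ p \<le> (2719 / 1000) ^ p" using exp_1_bounds by (intro power_mono) auto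
  ultimately have "exp (real p / real q) ^ q \<le> c ^ q" using assms(3) by linarith
  then show ?thesis using assms(1,2) by (metis gr0_conv_Suc power_le_imp_le_base)
qed

lemma exp_numeral_bounds:
  shows "1400 \<le> exp (29 / 4 :: real)" and "exp (3::real) \<le> 202 / 10" and "738 / 100 \<le> exp (2::real)"
    and "exp (23 / 4 :: real) \<le> 315" and "448 / 100 \<le> exp (3 / 2 :: real)"
    and "20 / 11 \<le> exp (3 / 5 :: real)" and "331 / 100 \<le> exp (6 / 5 :: real)" and "exp (4::real) \<le> 547 / 10"
    and "545 / 10 \<le> exp (4::real)" and "313 \<le> exp (23 / 4 :: real)" and "exp (2::real) \<le> 74 / 10"
    and "148 \<le> exp (5::real)"
  using exp_ge_rat[of 4 1400 29] exp_le_rat[of 1 "202 / 10" 3] exp_ge_rat[of 1 "738 / 100" 2]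
    exp_le_rat[of 4 315 23] exp_ge_rat[of 2 "448 / 100" 3] exp_ge_rat[of 5 "20 / 11" 3]
    exp_ge_rat[of 5 "331 / 100" 6] exp_le_rat[of 1 "547 / 10" 4] exp_ge_rat[of 1 "545 / 10" 4]
    exp_ge_rat[of 4 313 23] exp_le_rat[of 1 "74 / 10" 2] exp_ge_rat[of 1 148 5]
  by (simp_all add: power_divide)

definition pair_energy :: "real \<Rightarrow> real \<Rightarrow> real" where
  "pair_energy b w = w * exp (- w) - b * w * exp (- 2 * w)"

lemma pair_energy_factor: "pair_energy b w = w * exp (- w) * (1 - b * exp (- w))"
proof -
  have "exp (- 2 * w) = exp (- w) * exp (- w)" by (simp add: exp_add[symmetric])
  then show ?thesis by (simp add: pair_energy_def algebra_simps)
qed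

lemma sqrt2_le: "2 * sqrt 2 \<le> 28285 / 10000"
proof -
  have "sqrt 2 \<le> 14142136 / 10000000" by (rule real_le_lsqrt) (auto simp: power2_eq_square)
  then show ?thesis by simp
qed

text \<open>Since pi/3 is the value of pi alpha / y at y = 3 alpha, this inequality limits how high
  the cut may be placed.\<close>

lemma two_sqrt2_le_exp: "2 * sqrt 2 \<le> exp (pi / 3)"
proof -
  have "exp (1 + (pi / 3 - 1)) = exp 1 * exp (pi / 3 - 1)" by (simp only: exp_add)
  moreover have "1047 / 1000 \<le> exp (pi / 3 - 1)"
    using exp_ge_add_one_self[of "pi / 3 - 1"] pi_approx by simp
  then have "(2718 / 1000) * (1047 / 1000) \<le> exp 1 * exp (pi / 3 - 1)"
    using exp_1_bounds by (intro mult_mono) auto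
  ultimately have "(2718 / 1000) * (1047 / 1000) \<le> exp (1 + (pi / 3 - 1))" by simp
  then show ?thesis using sqrt2_le by simp
qed

lemma pair_energy_nonneg:
  assumes "0 \<le> w" "b \<le> 0 \<or> b \<le> 2 * sqrt 2 \<and> pi / 3 \<le> w"
  shows "0 \<le> pair_energy b w"
proof -
  have "b * exp (- w) \<le> 1"
  proof (cases "b \<le> 0")
    case True
    then have "b * exp (- w) \<le> 0" by (simp add: mult_nonpos_nonneg)
    then show ?thesis by simp
  next
    case False
    have "b \<le> exp w" using assms False two_sqrt2_le_exp exp_le_cancel_iff[of "pi / 3" w] by linarith
    then have "b * exp (- w) \<le> exp w * exp (- w)" by (intro mult_right_mono) auto
    then show ?thesis by (simp add: exp_minus)
  qed
  then show ?thesis unfolding pair_energy_factor using assms by auto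
qed

text \<open>Meant for the long vectors, all of whose values exceed 5; from there on
  \<open>b * exp (- w)\<close> is too small to spoil convexity. The bound on the slope
  \<open>D\<close> discards its positive terms.\<close>

lemma pair_energy_tangent:
  assumes b: "0 \<le> b" "b \<le> 2 * sqrt 2" and w: "5 < w"
  obtains D where "\<And>u. 5 < u \<Longrightarrow> pair_energy b u \<ge> pair_energy b w + D * (u - w)" "D \<ge> - (w * exp (- w))"
proof -
  let ?h1 = "\<lambda>w. (1 - w) * exp (- w) - b * (1 - 2 * w) * exp (- 2 * w)"
  let ?h2 = "\<lambda>w. (w - 2) * exp (- w) - b * (4 * w - 4) * exp (- 2 * w)"
  have d1: "(pair_energy b has_field_derivative ?h1 w) (at w)" for w
    unfolding pair_energy_def[abs_def] by (auto intro!: derivative_eq_intros simp: algebra_simps)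
  have "convex_on {5<..} (pair_energy b)"
  proof (rule f''_ge0_imp_convex[OF _ d1])
    fix w :: real assume w: "w \<in> {5<..}"
    show "(?h1 has_field_derivative ?h2 w) (at w)"
      by (auto intro!: derivative_eq_intros simp: algebra_simps)
    have "exp (- w) \<le> exp (- 5)" using w by simp
    also have "\<dots> \<le> 1 / 148" using exp_numeral_bounds(12) by (simp add: exp_minus field_simps)
    finally have "b * exp (- w) \<le> 28285 / 10000 * (1 / 148)"
      using b sqrt2_le by (intro mult_mono) auto
    then have "(4 * w - 4) * (b * exp (- w)) \<le> (4 * w - 4) * (1 / 40)"
      using w by (intro mult_left_mono) auto
    moreover have "(4 * w - 4) * (1 / 40) \<le> w - 2" using w by simp
    ultimately have "0 \<le> exp (- w) * ((w - 2) - (4 * w - 4) * (b * exp (- w)))"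
      by (intro mult_nonneg_nonneg) (simp, linarith)
    also have "\<dots> = ?h2 w"
    proof -
      have "exp (- 2 * w) = exp (- w) * exp (- w)" by (simp add: exp_add[symmetric])
      then show ?thesis by (simp add: algebra_simps)
    qed
    finally show "0 \<le> ?h2 w" .
  qed simp
  then have tangent: "pair_energy b u - pair_energy b w \<ge> ?h1 w * (u - w)" if "5 < u" for u
    by (rule convex_on_imp_above_tangent[OF _ _ _ _ has_field_derivative_at_within[OF d1]])
      (use w that in \<open>auto simp: interior_open\<close>)
  have "0 \<le> b * (2 * w - 1) * exp (- 2 * w)" using b w by (intro mult_nonneg_nonneg) auto
  moreover have "?h1 w = exp (- w) - w * exp (- w) + b * (2 * w - 1) * exp (- 2 * w)" by (simp add: algebra_simps)
  ultimately have "?h1 w \<ge> - (w * exp (- w))" using exp_ge_zero[of "- w"] by linarith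
  then show ?thesis using that[of "?h1 w"] tangent by (simp add: algebra_simps)
qed

text \<open>The right-hand side is exp w times the excess of \<open>pair_energy b (w + a)\<close>
  over the tangent at \<open>w\<close>, where e = b exp (-w). For such large \<open>a\<close> the
  term with exp (-a) is dropped, the one with exp (-2 a) is offset by -w, and a^2 is replaced by its
  chord between 8/5 and 3 w / 4.\<close>

lemma near_gain_right:
  fixes w a e :: real
  assumes w: "29 / 4 \<le> w" and e: "0 \<le> e" "e * w \<le> 3 / 200" and a: "8 / 5 \<le> a" "a \<le> 3 / 4 * w"
  shows "(1 - 98 / 100 / w) * a\<^sup>2
    \<le> (w + a) * exp (- a) - w + (w - 1) * a - e * ((w + a) * exp (- 2 * a) - w + (2 * w - 1) * a)"
proof -
  define \<theta> where "\<theta> = 1 - 98 / 100 / w"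
  have \<theta>: "0 \<le> \<theta>" "\<theta> \<le> 1" "\<theta> * w = w - 98 / 100" using w by (auto simp: \<theta>_def field_simps)
  \<comment> \<open>This is the coefficient of \<open>a\<close> left by the chord. With 1 in place
    of \<open>\<theta>\<close> it would be negative at w = 29/4, hence the factor 1 - 98/100/w in
    the claim.\<close>
  have coeff: "0 \<le> w / 4 - 295 / 1000 - 8 / 5 * \<theta>"
  proof (cases "w \<le> 8")
    case True
    then have "\<theta> \<le> 1 - 98 / 100 / 8" unfolding \<theta>_def using w by (intro diff_left_mono divide_left_mono) auto
    then show ?thesis using w by linarith
  next
    case False
    then show ?thesis using \<theta> by linarith
  qed
  have "exp (- 2 * a) \<le> 1 / (1 + 2 * a)"
    using exp_ge_add_one_self[of "2 * a"] a by (simp add: exp_minus field_simps)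
  then have "(w + a) * exp (- 2 * a) \<le> (w + a) * (1 / (1 + 2 * a))" using w a by (intro mult_left_mono) auto
  also have "\<dots> \<le> w"
  proof -
    have "1 * a \<le> (2 * w) * a" using w a by (intro mult_right_mono) auto
    then show ?thesis using w a by (simp add: divide_le_eq algebra_simps)
  qed
  finally have "e * ((w + a) * exp (- 2 * a) - w + (2 * w - 1) * a) \<le> e * ((2 * w - 1) * a)"
    using e by (intro mult_left_mono) auto
  also have "\<dots> \<le> 3 / 100 * a"
  proof -
    have "e * (2 * w - 1) \<le> 3 / 100" using e by (simp add: algebra_simps)
    then show ?thesis using mult_right_mono[of "e * (2 * w - 1)" "3 / 100" a] a by (simp add: mult.assoc)
  qed
  finally have 1: "e * ((w + a) * exp (- 2 * a) - w + (2 * w - 1) * a) \<le> 3 / 100 * a" .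
  have 2: "0 \<le> (w + a) * exp (- a)" using w a by simp
  have "0 \<le> (a - 8 / 5) * (3 / 4 * w - a)" using a by simp
  then have "a\<^sup>2 \<le> (3 / 4 * w + 8 / 5) * a - 6 / 5 * w" by (simp add: power2_eq_square algebra_simps)
  then have "\<theta> * a\<^sup>2 \<le> \<theta> * ((3 / 4 * w + 8 / 5) * a - 6 / 5 * w)" using \<theta> by (intro mult_left_mono) auto
  also have "\<dots> = 3 / 4 * (\<theta> * w) * a + 8 / 5 * \<theta> * a - 6 / 5 * (\<theta> * w)" by (simp add: algebra_simps)
  also have "\<dots> = 3 / 4 * (w - 98 / 100) * a + 8 / 5 * \<theta> * a - 6 / 5 * (w - 98 / 100)" by (simp only: \<theta>(3))
  also have "\<dots> \<le> (w - 1) * a - w - 3 / 100 * a"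
    using mult_nonneg_nonneg[OF coeff, of a] a w by (simp add: algebra_simps)
  finally show ?thesis using 1 2 unfolding \<theta>_def by linarith
qed

text \<open>Taylor bounds of third order for exp (-a) and of second order for exp (-2 a): the
  constant and linear parts cancel against the tangent and a multiple of a^2 remains.\<close>

lemma near_gain_middle:
  fixes w a e :: real
  assumes w: "29 / 4 \<le> w" and e: "0 \<le> e" "e * w \<le> 3 / 200" "e \<le> 1 / 490" and a: "0 \<le> a" "a \<le> 8 / 5"
  shows "a\<^sup>2 \<le> (w + a) * exp (- a) - w + (w - 1) * a - e * ((w + a) * exp (- 2 * a) - w + (2 * w - 1) * a)"
proof -
  have "(w + a) * (1 - a + a\<^sup>2 / 2 - a ^ 3 / 6) \<le> (w + a) * exp (- a)"
    using exp_minus_ge_cubic[OF a(1)] w a by (intro mult_left_mono) auto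
  moreover have "(w + a) * (1 - a + a\<^sup>2 / 2 - a ^ 3 / 6)
    = w - (w - 1) * a + a\<^sup>2 * (w * (1 / 2 - a / 6) - 1 + a / 2 - a\<^sup>2 / 6)"
    by (simp add: power2_eq_square power3_eq_cube field_simps)
  ultimately have 1: "a\<^sup>2 * (w * (1 / 2 - a / 6) - 1 + a / 2 - a\<^sup>2 / 6) \<le> (w + a) * exp (- a) - w + (w - 1) * a"
    by linarith
  have "(w + a) * exp (- 2 * a) \<le> (w + a) * (1 - 2 * a + 2 * a\<^sup>2)"
    using exp_minus_le_quadratic[of "2 * a"] w a by (intro mult_left_mono) (auto simp: power2_eq_square)
  then have "(w + a) * exp (- 2 * a) - w + (2 * w - 1) * a \<le> a\<^sup>2 * (2 * w - 2 + 2 * a)"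
    by (simp add: power2_eq_square algebra_simps)
  then have "e * ((w + a) * exp (- 2 * a) - w + (2 * w - 1) * a) \<le> e * (a\<^sup>2 * (2 * w - 2 + 2 * a))"
    using e by (intro mult_left_mono) auto
  also have "\<dots> = a\<^sup>2 * (2 * (e * w) + e * (2 * a - 2))" by (simp add: algebra_simps)
  also have "\<dots> \<le> a\<^sup>2 * (325 / 10000)"
  proof (intro mult_left_mono)
    have "e * (2 * a - 2) \<le> e * (6 / 5)" using a e by (intro mult_left_mono) auto
    then show "2 * (e * w) + e * (2 * a - 2) \<le> 325 / 10000" using e by linarith
  qed simp
  finally have 2: "e * ((w + a) * exp (- 2 * a) - w + (2 * w - 1) * a) \<le> a\<^sup>2 * (325 / 10000)" .
  define p where "p = w * (1 / 2 - a / 6)"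
  have "29 / 4 * (1 / 2 - a / 6) \<le> p" unfolding p_def using w a by (intro mult_right_mono) auto
  moreover have "a\<^sup>2 \<le> 8 / 5 * a" using a mult_right_mono[of a "8 / 5" a] by (simp add: power2_eq_square)
  ultimately have "1 \<le> p - 1 + a / 2 - a\<^sup>2 / 6 - 325 / 10000" using a by (simp add: field_simps)
  then have "1 \<le> w * (1 / 2 - a / 6) - 1 + a / 2 - a\<^sup>2 / 6 - 325 / 10000" unfolding p_def .
  then have "a\<^sup>2 * 1 \<le> a\<^sup>2 * (w * (1 / 2 - a / 6) - 1 + a / 2 - a\<^sup>2 / 6 - 325 / 10000)"
    by (intro mult_left_mono) auto
  then show ?thesis using 1 2 by (simp add: algebra_simps)
qed

text \<open>The point is w - c, so the subtracted exponential now grows; its quadratic remainder is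
  controlled by exp (2 c) <= exp 3 <= 202/10 and by the smallness of e w.\<close>

lemma near_gain_left:
  fixes w c e :: real
  assumes w: "29 / 4 \<le> w" and e: "0 \<le> e" "e * w \<le> 3 / 200" and c: "0 \<le> c" "c \<le> 3 / 2"
  shows "c\<^sup>2 \<le> (w - c) * exp c - w - (w - 1) * c - e * ((w - c) * exp (2 * c) - w - (2 * w - 1) * c)"
proof -
  have "(w - c) * (1 + c + c\<^sup>2 / 2) \<le> (w - c) * exp c"
    using exp_lower_Taylor_quadratic[OF c(1)] w c by (intro mult_left_mono) auto
  moreover have "(w - c) * (1 + c + c\<^sup>2 / 2) = w + (w - 1) * c + c\<^sup>2 * (w / 2 - 1 - c / 2)"
    by (simp add: power2_eq_square field_simps)
  ultimately have 1: "c\<^sup>2 * (w / 2 - 1 - c / 2) \<le> (w - c) * exp c - w - (w - 1) * c" by linarith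
  have "exp (2 * c) \<le> 202 / 10" using c exp_numeral_bounds(2) exp_le_cancel_iff[of "2 * c" 3] by linarith
  then have "(2 * c)\<^sup>2 / 2 * exp (2 * c) \<le> (2 * c)\<^sup>2 / 2 * (202 / 10)" by (intro mult_left_mono) auto
  then have "exp (2 * c) \<le> 1 + 2 * c + 404 / 10 * c\<^sup>2"
    using exp_le_quadratic_exp[of "2 * c"] c by (simp add: power2_eq_square)
  then have "(w - c) * exp (2 * c) \<le> (w - c) * (1 + 2 * c + 404 / 10 * c\<^sup>2)"
    using w c by (intro mult_left_mono) auto
  moreover have "(w - c) * (1 + 2 * c + 404 / 10 * c\<^sup>2)
    = w + (2 * w - 1) * c + (404 / 10 * w * c\<^sup>2 - (2 + 404 / 10 * c) * c\<^sup>2)"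
    by (simp add: power2_eq_square field_simps)
  ultimately have "(w - c) * exp (2 * c) - w - (2 * w - 1) * c \<le> 404 / 10 * w * c\<^sup>2 - (2 + 404 / 10 * c) * c\<^sup>2"
    by linarith
  also have "\<dots> \<le> 404 / 10 * w * c\<^sup>2" using c by simp
  finally have "e * ((w - c) * exp (2 * c) - w - (2 * w - 1) * c) \<le> e * (404 / 10 * w * c\<^sup>2)"
    using e by (intro mult_left_mono) auto
  also have "\<dots> = (e * w) * (404 / 10 * c\<^sup>2)" by simp
  also have "\<dots> \<le> 3 / 200 * (404 / 10 * c\<^sup>2)" using e by (intro mult_right_mono) auto
  finally have 2: "e * ((w - c) * exp (2 * c) - w - (2 * w - 1) * c) \<le> 606 / 1000 * c\<^sup>2" by simp
  have "1 \<le> w / 2 - 1 - c / 2 - 606 / 1000" using w c by linarith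
  then have "c\<^sup>2 * 1 \<le> c\<^sup>2 * (w / 2 - 1 - c / 2 - 606 / 1000)" by (intro mult_left_mono) auto
  then show ?thesis using 1 2 by (simp add: algebra_simps)
qed

text \<open>The number 29/4 lies just below 4 pi / sqrt 3 = 7.255..., the value at alpha = 2 of the
  form at the hexagonal point, multiplied by pi alpha.\<close>

lemma exp_small_bounds:
  fixes w b :: real
  assumes "29 / 4 \<le> w" "0 \<le> b" "b \<le> 2 * sqrt 2"
  shows "b * exp (- w) * w \<le> 3 / 200" "b * exp (- w) \<le> 1 / 490" "exp (- w) \<le> 1 / 1400" "w * exp (- w) \<le> 725 / 140000"
proof -
  have "exp (- w) \<le> exp (- (29 / 4))" using assms by simp
  also have "\<dots> \<le> 1 / 1400" using exp_numeral_bounds(1) by (simp add: exp_minus field_simps)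
  finally show 1: "exp (- w) \<le> 1 / 1400" .
  have "w * exp (- w) \<le> 29 / 4 * exp (- (29 / 4))" using assms by (intro xexp_antimono) auto
  also have "\<dots> \<le> 29 / 4 * (1 / 1400)" using exp_numeral_bounds(1) by (simp add: exp_minus field_simps)
  finally show 2: "w * exp (- w) \<le> 725 / 140000" by simp
  have b: "b \<le> 28285 / 10000" using assms sqrt2_le by linarith
  have "b * exp (- w) \<le> 28285 / 10000 * (1 / 1400)" using b 1 assms by (intro mult_mono) auto
  then show "b * exp (- w) \<le> 1 / 490" by simp
  have "b * (w * exp (- w)) \<le> 28285 / 10000 * (725 / 140000)" using b 2 assms by (intro mult_mono) auto
  then show "b * exp (- w) * w \<le> 3 / 200" by (simp add: mult_ac)
qed

text \<open>The linear part is the exact derivative at \<open>w\<close>. The quadratic coefficient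
  only has to exceed (w - 1) / w by enough for the sum over a superbase, whence 98/100 in place of
  1.\<close>

lemma pair_energy_near:
  fixes w a b :: real
  assumes w: "29 / 4 \<le> w" and b: "0 \<le> b" "b \<le> 2 * sqrt 2" and a: "- 3 / 2 \<le> a" "a \<le> 3 / 4 * w"
  shows "pair_energy b (w + a) \<ge> pair_energy b w
    + exp (- w) * ((1 - 98 / 100 / w) * a\<^sup>2 - (w - 1) * a + b * exp (- w) * (2 * w - 1) * a)"
proof -
  define e where "e = b * exp (- w)"
  have e: "0 \<le> e" "e * w \<le> 3 / 200" "e \<le> 1 / 490"
    using exp_small_bounds[OF w b] b by (auto simp: e_def)
  have \<theta>: "(1 - 98 / 100 / w) * a\<^sup>2 \<le> 1 * a\<^sup>2" using w by (intro mult_right_mono) auto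
  have "(1 - 98 / 100 / w) * a\<^sup>2
    \<le> (w + a) * exp (- a) - w + (w - 1) * a - e * ((w + a) * exp (- 2 * a) - w + (2 * w - 1) * a)"
  proof (cases "a \<le> 0")
    case True
    then have "a\<^sup>2 \<le> (w + a) * exp (- a) - w + (w - 1) * a - e * ((w + a) * exp (- 2 * a) - w + (2 * w - 1) * a)"
      using near_gain_left[OF w e(1,2), of "- a"] a by simp
    then show ?thesis using \<theta> by linarith
  next
    case False
    show ?thesis
    proof (cases "a \<le> 8 / 5")
      case True
      then have "a\<^sup>2 \<le> (w + a) * exp (- a) - w + (w - 1) * a - e * ((w + a) * exp (- 2 * a) - w + (2 * w - 1) * a)"
        using near_gain_middle[OF w e, of a] False by simp
      then show ?thesis using \<theta> by linarith
    next
      case False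
      then show ?thesis using near_gain_right[OF w e(1,2), of a] a by simp
    qed
  qed
  then have "exp (- w) * ((1 - 98 / 100 / w) * a\<^sup>2)
    \<le> exp (- w) * ((w + a) * exp (- a) - w + (w - 1) * a - e * ((w + a) * exp (- 2 * a) - w + (2 * w - 1) * a))"
    by (intro mult_left_mono) auto
  also have "\<dots> = pair_energy b (w + a) - pair_energy b w + exp (- w) * ((w - 1) * a - e * (2 * w - 1) * a)"
  proof -
    have "exp (- (w + a)) = exp (- w) * exp (- a)"
      "exp (- 2 * (w + a)) = exp (- w) * exp (- w) * exp (- 2 * a)" "exp (- 2 * w) = exp (- w) * exp (- w)"
      by (simp_all add: exp_add[symmetric])
    then show ?thesis unfolding pair_energy_def e_def by (simp add: algebra_simps)
  qed
  finally show ?thesis by (simp add: e_def algebra_simps)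
qed

text \<open>The last hypothesis on \<open>s\<close> is Heron's identity for \<open>w + a1\<close>, \<open>w + a2\<close>, \<open>w + a3\<close>, where \<open>w\<close> is the hexagonal value.\<close>

lemma pair_energy_triple:
  fixes w a1 a2 a3 b :: real
  assumes w: "29 / 4 \<le> w" and b: "0 \<le> b" "b \<le> 2 * sqrt 2"
    and a: "\<And>a. a \<in> {a1, a2, a3} \<Longrightarrow> - 3 / 2 \<le> a \<and> a \<le> 3 / 4 * w"
    and s: "s = a1 + a2 + a3" "0 \<le> s" "2 * w * s + s\<^sup>2 = 2 * (a1\<^sup>2 + a2\<^sup>2 + a3\<^sup>2)"
  shows "pair_energy b (w + a1) + pair_energy b (w + a2) + pair_energy b (w + a3)
    \<ge> 3 * pair_energy b w + exp (- w) * (s / 50)"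
proof -
  define \<theta> where "\<theta> = 1 - 98 / 100 / w"
  have \<theta>: "0 \<le> \<theta>" "\<theta> * w = w - 98 / 100" using w by (auto simp: \<theta>_def field_simps)
  define q where "q = a1\<^sup>2 + a2\<^sup>2 + a3\<^sup>2"
  have "2 * (w * s) + s\<^sup>2 = 2 * q" using s(3) by (simp add: q_def mult.assoc)
  moreover have "0 \<le> s\<^sup>2" by simp
  \<comment> \<open>Heron's identity makes the quadratic gain at least (w - 98/100) s, against the
    linear loss (w - 1) s. The surplus s/50 will have to pay for the long vectors.\<close>
  ultimately have "w * s \<le> q" by linarith
  then have "\<theta> * (w * s) \<le> \<theta> * q" using \<theta> by (intro mult_left_mono)
  moreover have "\<theta> * (w * s) = (w - 98 / 100) * s" using \<theta>(2) by (metis mult.assoc)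
  ultimately have q: "(w - 98 / 100) * s \<le> \<theta> * q" by simp
  have r: "0 \<le> b * exp (- w) * (2 * w - 1) * s" using b w s by simp
  have "s / 50 \<le> \<theta> * q - (w - 1) * s + b * exp (- w) * (2 * w - 1) * s"
    using q r by (simp add: algebra_simps)
  then have 1: "exp (- w) * (s / 50) \<le> exp (- w) * (\<theta> * q - (w - 1) * s + b * exp (- w) * (2 * w - 1) * s)"
    by (intro mult_left_mono) auto
  have n: "pair_energy b (w + a) \<ge> pair_energy b w
    + exp (- w) * (\<theta> * a\<^sup>2 - (w - 1) * a + b * exp (- w) * (2 * w - 1) * a)" if "a \<in> {a1, a2, a3}" for a
    using pair_energy_near[OF w b] a[OF that] unfolding \<theta>_def by blast
  have "exp (- w) * (\<theta> * q - (w - 1) * s + b * exp (- w) * (2 * w - 1) * s)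
    = exp (- w) * (\<theta> * a1\<^sup>2 - (w - 1) * a1 + b * exp (- w) * (2 * w - 1) * a1)
    + exp (- w) * (\<theta> * a2\<^sup>2 - (w - 1) * a2 + b * exp (- w) * (2 * w - 1) * a2)
    + exp (- w) * (\<theta> * a3\<^sup>2 - (w - 1) * a3 + b * exp (- w) * (2 * w - 1) * a3)"
    unfolding q_def s(1) by (simp add: algebra_simps)
  then show ?thesis using 1 n[of a1] n[of a2] n[of a3] by simp
qed

text \<open>Twice the left-hand side exceeds (6 w + 17/100) exp (-w), an upper bound for the whole
  hexagonal energy; a single antipodal pair of vectors in this window therefore costs more than the
  hexagonal lattice.\<close>

lemma pair_energy_far:
  fixes w u b :: real
  assumes w: "29 / 4 \<le> w" and b: "0 \<le> b" "b \<le> 2 * sqrt 2" and u: "6 / 5 \<le> u" "u \<le> w - 3 / 2"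
  shows "(3 * w + 1 / 10) * exp (- w) \<le> pair_energy b u"
proof -
  have b': "b \<le> 28285 / 10000" using b sqrt2_le by linarith
  have target: "(3 * w + 1 / 10) * exp (- w) \<le> 157 / 10000"
    using exp_small_bounds(3,4)[OF w b] by (simp add: algebra_simps)
  \<comment> \<open>Between \<open>lo\<close> and \<open>hi\<close> the factor u exp (-u) is
    smallest at \<open>hi\<close>, and 1 - b exp (-u) is smallest at \<open>lo\<close>.\<close>
  have piece: "hi / E * (1 - 28285 / 10000 / F) \<le> pair_energy b u"
    if "1 \<le> lo" "lo \<le> u" "u \<le> hi" "exp hi \<le> E" "F \<le> exp lo" "28285 / 10000 \<le> F" for lo hi E F
  proof -
    have E: "0 < E" using that(4) exp_gt_zero[of hi] by linarith
    have "hi / E \<le> hi * exp (- hi)" using that E by (simp add: exp_minus field_simps)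
    also have "\<dots> \<le> u * exp (- u)" using that by (intro xexp_antimono) auto
    finally have 1: "hi / E \<le> u * exp (- u)" .
    have "exp (- u) \<le> exp (- lo)" using that by simp
    also have "\<dots> \<le> 1 / F" using that by (simp add: exp_minus field_simps)
    finally have "b * exp (- u) \<le> 28285 / 10000 * (1 / F)" using b b' by (intro mult_mono) auto
    then have 2: "1 - 28285 / 10000 / F \<le> 1 - b * exp (- u)" by simp
    show ?thesis unfolding pair_energy_factor using 1 2 that E by (intro mult_mono) auto
  qed
  consider "u \<le> 2" | "2 \<le> u" "u \<le> 4" | "4 \<le> u" "u \<le> 23 / 4" | "23 / 4 \<le> u" by linarith
  then show ?thesis
  proof cases
    case 1
    then show ?thesis using piece[of "6 / 5" 2 "74 / 10" "331 / 100"] u exp_numeral_bounds target by simp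
  next
    case 2
    then show ?thesis using piece[of 2 4 "547 / 10" "738 / 100"] u exp_numeral_bounds target by simp
  next
    case 3
    then show ?thesis using piece[of 4 "23 / 4" 315 "545 / 10"] u exp_numeral_bounds target by simp
  next
    case 4
    \<comment> \<open>What decides here is that exp (3/2) >= 4.48 leaves room above the factor 3 of
      the claim; this fixes the margin 3/2 below \<open>w\<close>.\<close>
    have "(w - 3 / 2) * (448 / 100) \<le> (w - 3 / 2) * exp (3 / 2)"
      using w exp_numeral_bounds by (intro mult_left_mono) auto
    then have "(w - 3 / 2) * (448 / 100) * exp (- w) \<le> (w - 3 / 2) * exp (3 / 2) * exp (- w)"
      by (intro mult_right_mono) auto
    also have "\<dots> = (w - 3 / 2) * exp (- (w - 3 / 2))" by (simp add: mult.assoc exp_add[symmetric])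
    also have "\<dots> \<le> u * exp (- u)" using u 4 by (intro xexp_antimono) auto
    finally have 1: "(w - 3 / 2) * (448 / 100) * exp (- w) \<le> u * exp (- u)" .
    have "exp (- u) \<le> exp (- (23 / 4))" using 4 by simp
    also have "\<dots> \<le> 1 / 313" using exp_numeral_bounds by (simp add: exp_minus field_simps)
    finally have "b * exp (- u) \<le> 28285 / 10000 * (1 / 313)" using b b' by (intro mult_mono) auto
    then have 2: "99 / 100 \<le> 1 - b * exp (- u)" by simp
    have "(3 * w + 1 / 10) * exp (- w) \<le> (w - 3 / 2) * (448 / 100) * (99 / 100) * exp (- w)"
      using w by (intro mult_right_mono) auto
    also have "\<dots> = (w - 3 / 2) * (448 / 100) * exp (- w) * (99 / 100)" by simp
    also have "\<dots> \<le> pair_energy b u"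
      unfolding pair_energy_factor by (rule mult_mono[OF 1 2]) (use u in auto)
    finally show ?thesis .
  qed
qed

section \<open>The hexagonal point below the cut\<close>

text \<open>The norm form of the Eisenstein integers, of which the form at the hexagonal point is a
  multiple. It takes the value 1 at six vectors and omits the value 2.\<close>

definition hex_norm :: "int \<times> int \<Rightarrow> real" where
  "hex_norm v = (real_of_int (fst v))\<^sup>2 + real_of_int (fst v) * real_of_int (snd v) + (real_of_int (snd v))\<^sup>2"

lemma hex_norm_ge: "((real_of_int (fst v))\<^sup>2 + (real_of_int (snd v))\<^sup>2) / 2 \<le> hex_norm v"
  using sum_power2_ge_zero[of "real_of_int (fst v) + real_of_int (snd v)" 0]
  by (simp add: hex_norm_def power2_eq_square algebra_simps)

definition short_vectors :: "(int \<times> int) set" where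
  "short_vectors = {(0, 1), (0, -1), (1, 0), (-1, 0), (1, -1), (-1, 1)}"

lemma hex_norm_short: "v \<in> short_vectors \<Longrightarrow> hex_norm v = 1"
  by (auto simp: short_vectors_def hex_norm_def)

lemma hex_norm_long:
  assumes "v \<noteq> 0" "v \<notin> short_vectors"
  shows "3 \<le> hex_norm v"
proof -
  obtain m n where v: "v = (m, n)" by (cases v)
  have eq: "4 * (m\<^sup>2 + m * n + n\<^sup>2) = (2 * m + n)\<^sup>2 + 3 * n\<^sup>2"
    "4 * (m\<^sup>2 + m * n + n\<^sup>2) = (2 * n + m)\<^sup>2 + 3 * m\<^sup>2" by (simp_all add: power2_eq_square algebra_simps)
  have "3 \<le> m\<^sup>2 + m * n + n\<^sup>2"
  proof (rule ccontr)
    assume "\<not> 3 \<le> m\<^sup>2 + m * n + n\<^sup>2"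
    then have lt: "m\<^sup>2 + m * n + n\<^sup>2 \<le> 2" by simp
    have lt': "4 * (m\<^sup>2 + m * n + n\<^sup>2) \<le> 8" using mult_left_mono[OF lt, of 4] by simp
    have "3 * n\<^sup>2 \<le> 4 * (m\<^sup>2 + m * n + n\<^sup>2)" unfolding eq(1) by simp
    moreover have "3 * m\<^sup>2 \<le> 4 * (m\<^sup>2 + m * n + n\<^sup>2)" unfolding eq(2) by simp
    ultimately have "3 * n\<^sup>2 \<le> 8" "3 * m\<^sup>2 \<le> 8" using lt' by (blast intro: order_trans)+
    then have "n\<^sup>2 < 4" "m\<^sup>2 < 4" by linarith+
    then have "\<bar>n\<bar> < 2" "\<bar>m\<bar> < 2"
      using power2_less_imp_less[of "\<bar>n\<bar>" 2] power2_less_imp_less[of "\<bar>m\<bar>" 2] by simp_all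
    then have "m \<in> {-1, 0, 1}" "n \<in> {-1, 0, 1}" by auto
    then show False using lt assms by (auto simp: v short_vectors_def zero_prod_def)
  qed
  then have "real_of_int 3 \<le> real_of_int (m\<^sup>2 + m * n + n\<^sup>2)" by (simp only: of_int_le_iff)
  then show ?thesis by (simp add: v hex_norm_def)
qed

lemma square_exp_bound:
  fixes u :: real assumes "0 \<le> u" shows "u\<^sup>2 * exp (- u / 6) \<le> 196 / 10"
proof -
  have "u / 12 \<le> exp (u / 12 - 1)" using exp_ge_add_one_self[of "u / 12 - 1"] by simp
  then have "u / 12 * exp (- u / 12) \<le> exp (u / 12 - 1) * exp (- u / 12)" by (intro mult_right_mono) auto
  also have "\<dots> = exp (- 1)" by (simp add: exp_add[symmetric])
  finally have "(u / 12 * exp (- u / 12))\<^sup>2 \<le> (exp (- 1))\<^sup>2" using assms by (intro power_mono) auto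
  moreover have "(exp (- u / 12))\<^sup>2 = exp (- u / 6)" "(exp (- 1 :: real))\<^sup>2 = exp (- 2)"
    by (simp_all add: exp_of_nat_mult[symmetric])
  ultimately have "u\<^sup>2 * exp (- u / 6) \<le> 144 * exp (- 2)" by (simp add: power_mult_distrib power_divide)
  also have "exp (- 2 :: real) \<le> 100 / 738" using exp_numeral_bounds(3) by (simp add: exp_minus field_simps)
  finally show ?thesis by simp
qed

text \<open>The exponent u = w N, with N the hexagonal norm, is split: u/6 absorbs the factor u^2,
  another u/6 dominates 3/5 (|m| + |n|) and gives geometric decay, and the remaining 2u/3 is at
  least 2 w.\<close>

lemma hex_tail_term:
  fixes w :: real
  assumes w: "29 / 4 \<le> w" and v: "3 \<le> hex_norm v"
  shows "(w * hex_norm v)\<^sup>2 * exp (- (w * hex_norm v))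
    \<le> exp (- 2 * w) * (196 / 10) * ((11 / 20) ^ nat \<bar>fst v\<bar> * (11 / 20) ^ nat \<bar>snd v\<bar>)"
proof -
  let ?u = "w * hex_norm v"
  have "(6 / 5) * (((real_of_int (fst v))\<^sup>2 + (real_of_int (snd v))\<^sup>2) / 2) \<le> (w / 6) * hex_norm v"
    using w v hex_norm_ge[of v] by (intro mult_mono) auto
  then have "3 / 5 * \<bar>real_of_int (fst v)\<bar> + 3 / 5 * \<bar>real_of_int (snd v)\<bar> \<le> ?u / 6"
    using abs_le_power2_int[of "fst v"] abs_le_power2_int[of "snd v"] by simp
  moreover have "w * 3 \<le> ?u" using v w by (intro mult_left_mono) auto
  ultimately have "- ?u \<le> - 2 * w + - ?u / 6 + (- (3 / 5) * \<bar>real_of_int (fst v)\<bar> + - (3 / 5) * \<bar>real_of_int (snd v)\<bar>)"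
    by linarith
  then have "exp (- ?u) \<le> exp (- 2 * w + - ?u / 6 + (- (3 / 5) * \<bar>real_of_int (fst v)\<bar> + - (3 / 5) * \<bar>real_of_int (snd v)\<bar>))"
    by (simp only: exp_le_cancel_iff)
  also have "\<dots> = exp (- 2 * w) * exp (- ?u / 6) * (exp (- (3 / 5)) ^ nat \<bar>fst v\<bar> * exp (- (3 / 5)) ^ nat \<bar>snd v\<bar>)"
    unfolding exp_power_abs_int exp_add ..
  also have "\<dots> \<le> exp (- 2 * w) * exp (- ?u / 6) * ((11 / 20) ^ nat \<bar>fst v\<bar> * (11 / 20) ^ nat \<bar>snd v\<bar>)"
  proof -
    have "exp (- (3 / 5 :: real)) \<le> 11 / 20" using exp_numeral_bounds(6) by (simp add: exp_minus field_simps)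
    then show ?thesis by (intro mult_left_mono mult_mono power_mono) auto
  qed
  finally have "?u\<^sup>2 * exp (- ?u) \<le> ?u\<^sup>2 * (exp (- 2 * w) * exp (- ?u / 6) * ((11 / 20) ^ nat \<bar>fst v\<bar> * (11 / 20) ^ nat \<bar>snd v\<bar>))"
    by (intro mult_left_mono) auto
  also have "\<dots> = (?u\<^sup>2 * exp (- ?u / 6)) * (exp (- 2 * w) * ((11 / 20) ^ nat \<bar>fst v\<bar> * (11 / 20) ^ nat \<bar>snd v\<bar>))"
    by simp
  also have "\<dots> \<le> 196 / 10 * (exp (- 2 * w) * ((11 / 20) ^ nat \<bar>fst v\<bar> * (11 / 20) ^ nat \<bar>snd v\<bar>))"
    using w v by (intro mult_right_mono square_exp_bound) auto
  finally show ?thesis by (simp add: mult_ac)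
qed

abbreviation long_vectors :: "(int \<times> int) set" where
  "long_vectors \<equiv> UNIV - insert 0 short_vectors"

text \<open>The square in the summand is what the tangent estimate produces: a slope of size w N exp
  (-w N) times a displacement proportional to N. Of the two factors exp (-w) in the termwise bound,
  one is spent as 1/1400.\<close>

lemma hex_tail:
  fixes w :: real
  assumes w: "29 / 4 \<le> w"
  shows "(\<lambda>v. (w * hex_norm v)\<^sup>2 * exp (- (w * hex_norm v))) summable_on long_vectors"
    and "(\<Sum>\<^sub>\<infinity>v\<in>long_vectors. (w * hex_norm v)\<^sup>2 * exp (- (w * hex_norm v))) \<le> 17 / 100 * exp (- w)"
proof -
  let ?f = "\<lambda>v. (w * hex_norm v)\<^sup>2 * exp (- (w * hex_norm v))"
  let ?g = "\<lambda>v :: int \<times> int. exp (- 2 * w) * (196 / 10) * ((11 / 20) ^ nat \<bar>fst v\<bar> * (11 / 20) ^ nat \<bar>snd v\<bar>)"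
  have g: "(?g has_sum (exp (- 2 * w) * (196 / 10) * ((1 + 11 / 20) / (1 - 11 / 20))\<^sup>2)) UNIV"
    by (intro has_sum_cmult_right has_sum_power_abs_int2) auto
  have le: "?f v \<le> ?g v" if "v \<in> long_vectors" for v
    using hex_tail_term[OF w hex_norm_long[of v]] that by auto
  have gs: "?g summable_on long_vectors"
    using summable_on_subset_banach[OF has_sum_imp_summable[OF g]] by blast
  show s: "?f summable_on long_vectors"
    by (rule summable_on_comparison_test[OF gs le]) auto
  have "infsum ?f long_vectors \<le> infsum ?g long_vectors" by (rule infsum_mono[OF s gs le])
  also have "\<dots> \<le> infsum ?g UNIV"
    by (rule infsum_mono2[OF gs has_sum_imp_summable[OF g]]) auto
  also have "\<dots> = exp (- 2 * w) * (196 / 10) * ((1 + 11 / 20) / (1 - 11 / 20))\<^sup>2" by (rule infsumI[OF g])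
  also have "\<dots> = (exp (- w) * exp (- w)) * ((196 / 10) * ((1 + 11 / 20) / (1 - 11 / 20))\<^sup>2)"
    by (simp add: exp_add[symmetric])
  also have "\<dots> \<le> (exp (- w) * (1 / 1400)) * ((196 / 10) * ((1 + 11 / 20) / (1 - 11 / 20))\<^sup>2)"
    using exp_small_bounds(3)[OF w, of 0] by (intro mult_right_mono mult_left_mono) auto
  also have "\<dots> \<le> 17 / 100 * exp (- w)" by (simp add: power2_eq_square)
  finally show "infsum ?f long_vectors \<le> 17 / 100 * exp (- w)" .
qed

lemma pair_energy_sum:
  assumes "0 < \<alpha>" "0 < Im z"
  shows "(\<lambda>v. pair_energy b (pi * \<alpha> * qform z v)) summable_on UNIV"
    and "(\<Sum>\<^sub>\<infinity>v. pair_energy b (pi * \<alpha> * qform z v)) = pi * \<alpha> * (K \<alpha> z - b * K (2 * \<alpha>) z)"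
proof -
  have z: "Complex (Re z) (Im z) = z" by simp
  let ?f = "\<lambda>\<alpha> v. pi * \<alpha> * qform z v * exp (- (pi * \<alpha> * qform z v))"
  have s: "?f \<alpha> summable_on UNIV" "?f (2 * \<alpha>) summable_on UNIV"
    using K_poisson(1)[of \<alpha> "Im z" "Re z"] K_poisson(1)[of "2 * \<alpha>" "Im z" "Re z"] assms unfolding z by auto
  have i: "infsum (?f \<beta>) UNIV = pi * \<beta> * K \<beta> z" for \<beta>
    unfolding K_qform infsum_cmult_right'[symmetric] by (simp add: mult_ac)
  have eq: "pair_energy b (pi * \<alpha> * qform z v) = ?f \<alpha> v + - (b / 2) * ?f (2 * \<alpha>) v" for v
    by (simp add: pair_energy_def mult_ac)
  have s2: "(\<lambda>v. - (b / 2) * ?f (2 * \<alpha>) v) summable_on UNIV" by (rule summable_on_cmult_right[OF s(2)])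
  show "(\<lambda>v. pair_energy b (pi * \<alpha> * qform z v)) summable_on UNIV"
    unfolding eq by (rule summable_on_add[OF s(1) s2])
  have "(\<Sum>\<^sub>\<infinity>v. pair_energy b (pi * \<alpha> * qform z v)) = infsum (?f \<alpha>) UNIV + (\<Sum>\<^sub>\<infinity>v. - (b / 2) * ?f (2 * \<alpha>) v)"
    unfolding eq by (rule infsum_add[OF s(1) s2])
  also have "(\<Sum>\<^sub>\<infinity>v. - (b / 2) * ?f (2 * \<alpha>) v) = - (b / 2) * infsum (?f (2 * \<alpha>)) UNIV"
    by (rule infsum_cmult_right')
  finally show "(\<Sum>\<^sub>\<infinity>v. pair_energy b (pi * \<alpha> * qform z v)) = pi * \<alpha> * (K \<alpha> z - b * K (2 * \<alpha>) z)"
    unfolding i by (simp add: algebra_simps)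
qed

lemma long_vectors_eq: "long_vectors = {v. 3 \<le> hex_norm v}"
proof -
  have "v \<noteq> 0 \<and> v \<notin> short_vectors" if "3 \<le> hex_norm v" for v
    using that hex_norm_short[of v] by (auto simp: hex_norm_def)
  then show ?thesis using hex_norm_long by blast
qed

lemma infsum_short_long:
  fixes f :: "int \<times> int \<Rightarrow> real"
  assumes "f summable_on UNIV" "f 0 = 0"
  shows "infsum f UNIV = f (0, 1) + f (0, -1) + f (1, 0) + f (-1, 0) + f (1, -1) + f (-1, 1) + infsum f long_vectors"
proof -
  have "f summable_on long_vectors" using summable_on_subset_banach[OF assms(1)] by blast
  then have "infsum f (insert 0 short_vectors \<union> long_vectors) = infsum f (insert 0 short_vectors) + infsum f long_vectors"
    by (intro infsum_Un_disjoint) (auto simp: short_vectors_def)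
  moreover have "insert 0 short_vectors \<union> long_vectors = UNIV" by blast
  moreover have "infsum f (insert 0 short_vectors) = sum f (insert 0 short_vectors)"
    by (rule infsum_finite) (simp add: short_vectors_def)
  moreover have "sum f (insert 0 short_vectors) = sum f short_vectors"
    using assms(2) by (subst sum.insert) (auto simp: short_vectors_def zero_prod_def)
  ultimately show ?thesis by (simp add: short_vectors_def)
qed

definition hexagonal_point :: complex where
  "hexagonal_point = Complex (1 / 2) (sqrt 3 / 2)"

lemma cis_hexagonal: "cis (pi / 3) = hexagonal_point"
  by (simp add: hexagonal_point_def complex_eq_iff cos_60 sin_60)

lemma sqrt3_bounds: "17320 / 10000 \<le> sqrt 3" "sqrt 3 \<le> 17321 / 10000"
  by (rule real_le_rsqrt, simp add: power2_eq_square) (rule real_le_lsqrt, simp_all add: power2_eq_square)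

lemma qform_hexagonal: "qform hexagonal_point v = 2 / sqrt 3 * hex_norm v"
proof -
  obtain m n where v: "v = (m, n)" by (cases v)
  have A: "sqrt 3 / 2 * M = 2 / sqrt 3 * (3 / 4 * M)" and B: "X / (sqrt 3 / 2) = 2 / sqrt 3 * X" for M X
    by (simp_all add: field_simps)
  have "qform hexagonal_point v
    = 2 / sqrt 3 * (3 / 4 * (real_of_int m)\<^sup>2 + (real_of_int n + real_of_int m * (1 / 2))\<^sup>2)"
    unfolding hexagonal_point_def v by (subst qform_Complex) (simp, simp only: A B distrib_left)
  then show ?thesis by (simp add: v hex_norm_def power2_eq_square algebra_simps)
qed

lemma fundamental_domain_iff:
  "Complex x y \<in> fundamental_domain \<longleftrightarrow> 0 < y \<and> 0 \<le> x \<and> x \<le> 1 / 2 \<and> 1 \<le> x\<^sup>2 + y\<^sup>2"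
proof -
  have "1 \<le> cmod (Complex x y) \<longleftrightarrow> 1 \<le> x\<^sup>2 + y\<^sup>2" by (simp add: complex_norm)
  then show ?thesis by (simp add: fundamental_domain_def)
qed

text \<open>The quotients are the values of the form at (1, 0), (0, 1) and (1, -1), up to signs a
  superbase of the lattice; they determine the form.\<close>

lemma qform_basis:
  assumes "0 < y"
  shows "qform (Complex x y) (m, n) = (real_of_int m)\<^sup>2 * ((x\<^sup>2 + y\<^sup>2) / y) + (real_of_int n)\<^sup>2 * (1 / y)
    + real_of_int m * real_of_int n * (1 / y + (x\<^sup>2 + y\<^sup>2) / y - ((1 - x)\<^sup>2 + y\<^sup>2) / y)"
  using assms by (simp add: qform_Complex power2_eq_square field_simps)

text \<open>The form is reduced: 2 x <= 1 and |z| >= 1 make \<open>y\<close> times its value at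
  least m^2 + n^2 - |m n|, a positive integer.\<close>

lemma qform_lower:
  assumes z: "Complex x y \<in> fundamental_domain" and v: "v \<noteq> 0"
  shows "1 / y \<le> qform (Complex x y) v"
proof -
  obtain m n where mn: "v = (m, n)" by (cases v)
  have xy: "0 < y" "0 \<le> x" "x \<le> 1 / 2" "1 \<le> x\<^sup>2 + y\<^sup>2" using z by (auto simp: fundamental_domain_iff)
  have "1 \<le> m\<^sup>2 + n\<^sup>2 - \<bar>m * n\<bar>"
  proof -
    have "(\<bar>m\<bar> - \<bar>n\<bar>)\<^sup>2 + \<bar>m * n\<bar> = m\<^sup>2 + n\<^sup>2 - \<bar>m * n\<bar>"
      by (simp add: power2_eq_square abs_mult algebra_simps)
    moreover have "0 < (\<bar>m\<bar> - \<bar>n\<bar>)\<^sup>2 + \<bar>m * n\<bar>"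
    proof (cases "m * n = 0")
      case True
      then show ?thesis using v mn by (auto simp: zero_prod_def)
    next
      case False
      then have "0 < \<bar>m * n\<bar>" by simp
      then show ?thesis by (rule add_nonneg_pos[rotated]) simp
    qed
    ultimately show ?thesis by linarith
  qed
  then have "real_of_int 1 \<le> real_of_int (m\<^sup>2 + n\<^sup>2 - \<bar>m * n\<bar>)" by (simp only: of_int_le_iff)
  then have 1: "1 \<le> (real_of_int m)\<^sup>2 + (real_of_int n)\<^sup>2 - \<bar>real_of_int m * real_of_int n\<bar>" by (simp add: abs_mult)
  have "(real_of_int m)\<^sup>2 * 1 \<le> (real_of_int m)\<^sup>2 * (x\<^sup>2 + y\<^sup>2)" using xy by (intro mult_left_mono) auto
  moreover have "- \<bar>real_of_int m * real_of_int n\<bar> \<le> real_of_int m * real_of_int n * (2 * x)"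
  proof -
    have "\<bar>real_of_int m * real_of_int n * (2 * x)\<bar> = \<bar>real_of_int m * real_of_int n\<bar> * (2 * x)"
      using xy by (simp add: abs_mult)
    also have "\<dots> \<le> \<bar>real_of_int m * real_of_int n\<bar> * 1" using xy by (intro mult_left_mono) auto
    finally show ?thesis by linarith
  qed
  ultimately have "1 \<le> (real_of_int m)\<^sup>2 * (x\<^sup>2 + y\<^sup>2) + real_of_int m * real_of_int n * (2 * x) + (real_of_int n)\<^sup>2"
    using 1 by linarith
  also have "\<dots> = y * qform (Complex x y) v"
    using xy by (simp add: mn qform_Complex power2_eq_square field_simps)
  finally show ?thesis using xy by (simp add: divide_le_eq mult.commute)
qed

text \<open>Averaging over this symmetry of order 3 of the hexagonal form makes the sum of \<open>qform\<close> over long vectors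
  a function of \<open>Q\<^sub>1 + Q\<^sub>2 + Q\<^sub>3\<close> alone.\<close>

definition hex_rotation :: "int \<times> int \<Rightarrow> int \<times> int" where
  "hex_rotation v = (- fst v - snd v, fst v)"

lemma hex_norm_rotation: "hex_norm (hex_rotation v) = hex_norm v"
  by (simp add: hex_norm_def hex_rotation_def power2_eq_square algebra_simps)

lemma bij_hex_rotation: "bij_betw hex_rotation long_vectors long_vectors"
  unfolding long_vectors_eq
proof (rule bij_betwI[where g = "hex_rotation \<circ> hex_rotation"])
  show "(hex_rotation \<circ> hex_rotation) (hex_rotation v) = v" "hex_rotation ((hex_rotation \<circ> hex_rotation) v) = v" for v
    by (simp_all add: hex_rotation_def)
qed (auto simp: hex_norm_rotation)

lemma qform_rotation_sum:
  assumes "0 < y"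
  shows "qform (Complex x y) v + qform (Complex x y) (hex_rotation v) + qform (Complex x y) (hex_rotation (hex_rotation v))
    = hex_norm v * (1 / y + (x\<^sup>2 + y\<^sup>2) / y + ((1 - x)\<^sup>2 + y\<^sup>2) / y)"
proof -
  obtain m n where v: "v = (m, n)" by (cases v)
  define a b c where "a = (x\<^sup>2 + y\<^sup>2) / y" and "b = 1 / y" and "c = ((1 - x)\<^sup>2 + y\<^sup>2) / y"
  have q: "qform (Complex x y) (m, n) = (real_of_int m)\<^sup>2 * a + (real_of_int n)\<^sup>2 * b
    + real_of_int m * real_of_int n * (b + a - c)" for m n
    using qform_basis[OF assms] by (simp add: a_def b_def c_def)
  show ?thesis
    unfolding a_def[symmetric] b_def[symmetric] c_def[symmetric] v hex_rotation_def fst_conv snd_conv q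
    by (simp add: hex_norm_def power2_eq_square algebra_simps)
qed

section \<open>Energies compared with that of the hexagonal point\<close>

lemma energy_hexagonal_le:
  assumes \<alpha>: "2 \<le> \<alpha>" and b: "0 \<le> b"
  defines "w \<equiv> pi * \<alpha> * (2 / sqrt 3)"
  shows "29 / 4 \<le> w"
    and "pi * \<alpha> * (K \<alpha> hexagonal_point - b * K (2 * \<alpha>) hexagonal_point) \<le> (6 * w + 17 / 100) * exp (- w)"
proof -
  have "29 / 4 \<le> 3141 / 1000 * 2 * (2 / (17321 / 10000) :: real)" by simp
  also have "\<dots> \<le> pi * \<alpha> * (2 / sqrt 3)"
    using \<alpha> pi_approx sqrt3_bounds by (intro mult_mono divide_left_mono) auto
  finally show w: "29 / 4 \<le> w" by (simp add: w_def)
  let ?f = "\<lambda>v. pair_energy b (w * hex_norm v)"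
  have z: "0 < Im hexagonal_point" by (simp add: hexagonal_point_def)
  have q: "pi * \<alpha> * qform hexagonal_point v = w * hex_norm v" for v
    by (simp add: w_def qform_hexagonal)
  have f: "?f summable_on UNIV" "infsum ?f UNIV = pi * \<alpha> * (K \<alpha> hexagonal_point - b * K (2 * \<alpha>) hexagonal_point)"
    using pair_energy_sum[of \<alpha> hexagonal_point b] \<alpha> z unfolding q by auto
  have le: "pair_energy b u \<le> u * exp (- u)" if "0 \<le> u" for u
    using b that by (simp add: pair_energy_def)
  have long: "infsum ?f long_vectors \<le> 17 / 100 * exp (- w)"
  proof -
    have "infsum ?f long_vectors \<le> (\<Sum>\<^sub>\<infinity>v\<in>long_vectors. (w * hex_norm v)\<^sup>2 * exp (- (w * hex_norm v)))"
    proof (rule infsum_mono)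
      show "?f summable_on long_vectors" using summable_on_subset_banach[OF f(1)] by blast
      fix v assume "v \<in> long_vectors"
      then have "3 \<le> hex_norm v" by (simp add: long_vectors_eq)
      then have u: "1 * 1 \<le> w * hex_norm v" using w by (intro mult_mono) auto
      then have "w * hex_norm v * 1 \<le> w * hex_norm v * (w * hex_norm v)" by (intro mult_left_mono) auto
      then have *: "w * hex_norm v * exp (- (w * hex_norm v)) \<le> (w * hex_norm v)\<^sup>2 * exp (- (w * hex_norm v))"
        by (intro mult_right_mono) (auto simp: power2_eq_square)
      show "?f v \<le> (w * hex_norm v)\<^sup>2 * exp (- (w * hex_norm v))"
        by (rule order_trans[OF le *]) (use u in linarith)
    qed (rule hex_tail(1)[OF w])
    also have "\<dots> \<le> 17 / 100 * exp (- w)" by (rule hex_tail(2)[OF w])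
    finally show ?thesis .
  qed
  have "?f 0 = 0" by (simp add: hex_norm_def pair_energy_def)
  then have "infsum ?f UNIV = 6 * pair_energy b w + infsum ?f long_vectors"
    using infsum_short_long[OF f(1)] by (simp add: hex_norm_def)
  then show "pi * \<alpha> * (K \<alpha> hexagonal_point - b * K (2 * \<alpha>) hexagonal_point) \<le> (6 * w + 17 / 100) * exp (- w)"
    using long le[of w] w f(2) by (simp add: algebra_simps)
qed

text \<open>Some multiple of the shortest vector has its value in the window of
  \<open>pair_energy_far\<close>, and no other term is negative: below the cut because all values
  are at least pi/3, and everywhere if b = 0.\<close>

lemma energy_far:
  assumes \<alpha>: "2 \<le> \<alpha>" and b: "0 \<le> b" "b \<le> 2 * sqrt 2" and z: "Complex x y \<in> fundamental_domain"
    and hyp: "b = 0 \<or> y \<le> 3 * \<alpha>" and far: "pi * \<alpha> / y \<le> pi * \<alpha> * (2 / sqrt 3) - 3 / 2"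
  shows "K \<alpha> hexagonal_point - b * K (2 * \<alpha>) hexagonal_point < K \<alpha> (Complex x y) - b * K (2 * \<alpha>) (Complex x y)"
proof -
  have y: "0 < y" using z by (simp add: fundamental_domain_iff)
  have pa: "0 < pi * \<alpha>" using \<alpha> by simp
  define w where "w = pi * \<alpha> * (2 / sqrt 3)"
  define u where "u = pi * \<alpha> / y"
  have w: "29 / 4 \<le> w" and hex: "pi * \<alpha> * (K \<alpha> hexagonal_point - b * K (2 * \<alpha>) hexagonal_point) \<le> (6 * w + 17 / 100) * exp (- w)"
    using energy_hexagonal_le[OF \<alpha> b(1)] by (simp_all add: w_def)
  have u: "0 < u" "u \<le> w - 3 / 2" using far y pa by (auto simp: u_def w_def)
  let ?f = "\<lambda>v. pair_energy b (pi * \<alpha> * qform (Complex x y) v)"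
  have f: "?f summable_on UNIV" "infsum ?f UNIV = pi * \<alpha> * (K \<alpha> (Complex x y) - b * K (2 * \<alpha>) (Complex x y))"
    using pair_energy_sum[of \<alpha> "Complex x y" b] \<alpha> y by auto
  have nonneg: "0 \<le> ?f v" for v
  proof (cases "v = 0")
    case True
    then show ?thesis by (simp add: qform_def pair_energy_def)
  next
    case False
    have "u \<le> pi * \<alpha> * qform (Complex x y) v"
      using mult_left_mono[OF qform_lower[OF z False], of "pi * \<alpha>"] pa by (simp add: u_def)
    moreover have "pi / 3 \<le> u" if "y \<le> 3 * \<alpha>" unfolding u_def using that y \<alpha> by (simp add: field_simps)
    ultimately have "0 \<le> pi * \<alpha> * qform (Complex x y) v"
      "b \<le> 0 \<or> b \<le> 2 * sqrt 2 \<and> pi / 3 \<le> pi * \<alpha> * qform (Complex x y) v" using hyp b u by linarith+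
    then show ?thesis by (rule pair_energy_nonneg)
  qed
  \<comment> \<open>If u < 6/5, the least admissible \<open>n\<close> is at least 2, so n <= 2 (n -
    1) and n^2 u < 4 (6/5) = 24/5, which is below 29/4 - 3/2.\<close>
  obtain n :: nat where n: "0 < n" "6 / 5 \<le> real n ^ 2 * u" "real n ^ 2 * u \<le> w - 3 / 2"
  proof (cases "6 / 5 \<le> u")
    case True
    then show ?thesis using that[of 1] u by simp
  next
    case False
    define P where "P k \<longleftrightarrow> 6 / 5 \<le> real k ^ 2 * u" for k
    obtain k where "6 / 5 / u < real k" using reals_Archimedean2 by blast
    then have k: "6 / 5 < real k * u" using u by (simp add: divide_less_eq)
    have "real k \<le> real k ^ 2" by (cases k) (auto simp: power2_eq_square)
    then have "real k * u \<le> real k ^ 2 * u" using u by (intro mult_right_mono) auto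
    then have "P k" unfolding P_def using k by linarith
    then have L: "P (LEAST k. P k)" by (rule LeastI)
    define n where "n = (LEAST k. P k)"
    have "\<not> P 0" "\<not> P 1" using False by (auto simp: P_def)
    then have "n \<noteq> 0" "n \<noteq> 1" using L unfolding n_def by metis+
    then have n2: "2 \<le> n" by linarith
    have "\<not> P (n - 1)" using n2 unfolding n_def by (intro not_less_Least) auto
    then have "real (n - 1) ^ 2 * u < 6 / 5" by (simp add: P_def)
    moreover have "real n ^ 2 \<le> (2 * real (n - 1)) ^ 2" using n2 by (intro power_mono) auto
    then have "real n ^ 2 * u \<le> 4 * (real (n - 1) ^ 2 * u)" using u by (simp add: power_mult_distrib mult_right_mono)
    ultimately have "real n ^ 2 * u \<le> w - 3 / 2" using w by linarith
    then show ?thesis using that[of n] n2 L by (simp add: n_def P_def)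
  qed
  have val: "?f (0, int n) = pair_energy b (real n ^ 2 * u)" "?f (0, - int n) = pair_energy b (real n ^ 2 * u)"
    using y by (simp_all add: qform_Complex u_def mult.commute)
  have "sum ?f {(0, int n), (0, - int n)} \<le> infsum ?f UNIV"
    by (rule finite_sum_le_infsum[OF f(1)]) (use nonneg in auto)
  then have "2 * pair_energy b (real n ^ 2 * u) \<le> infsum ?f UNIV" using n(1) val by simp
  moreover have "(3 * w + 1 / 10) * exp (- w) \<le> pair_energy b (real n ^ 2 * u)"
    by (rule pair_energy_far[OF w b n(2,3)])
  moreover have "(6 * w + 17 / 100) * exp (- w) < 2 * ((3 * w + 1 / 10) * exp (- w))"
    by (simp add: algebra_simps)
  ultimately have "pi * \<alpha> * (K \<alpha> hexagonal_point - b * K (2 * \<alpha>) hexagonal_point)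
      < pi * \<alpha> * (K \<alpha> (Complex x y) - b * K (2 * \<alpha>) (Complex x y))"
    using hex f(2) by linarith
  then show ?thesis using pa by (simp add: mult_less_cancel_left)
qed

text \<open>The six short vectors gain at least 2 exp (-w) s/50 over the hexagonal point, while the
  long ones lose at most s/(3 w) times 17/100 exp (-w). Both estimates are linear in
  \<open>s\<close>, so the comparison remains valid arbitrarily close to the hexagonal
  point.\<close>

lemma energy_near:
  assumes \<alpha>: "2 \<le> \<alpha>" and b: "0 \<le> b" "b \<le> 2 * sqrt 2" and z: "Complex x y \<in> fundamental_domain"
    and ne: "Complex x y \<noteq> hexagonal_point" and near: "pi * \<alpha> * (2 / sqrt 3) - 3 / 2 < pi * \<alpha> / y"
  shows "K \<alpha> hexagonal_point - b * K (2 * \<alpha>) hexagonal_point < K \<alpha> (Complex x y) - b * K (2 * \<alpha>) (Complex x y)"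
proof -
  have xy: "0 < y" "0 \<le> x" "x \<le> 1 / 2" "1 \<le> x\<^sup>2 + y\<^sup>2" using z by (auto simp: fundamental_domain_iff)
  have pa: "0 < pi * \<alpha>" using \<alpha> by simp
  define w where "w = pi * \<alpha> * (2 / sqrt 3)"
  have w: "29 / 4 \<le> w" using energy_hexagonal_le(1)[OF \<alpha> b(1)] by (simp add: w_def)
  define Q1 Q2 Q3 where "Q1 = 1 / y" and "Q2 = (x\<^sup>2 + y\<^sup>2) / y" and "Q3 = ((1 - x)\<^sup>2 + y\<^sup>2) / y"
  have order: "Q1 \<le> Q2" "Q2 \<le> Q3"
    unfolding Q1_def Q2_def Q3_def using xy by (auto intro!: divide_right_mono simp: power2_eq_square algebra_simps)
  \<comment> \<open>This keeps \<open>a3\<close> below 3 w / 4, for which Q3 <= (7/4) (2 / sqrt 3) =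
    2.02... is required; the point i has Q3 = 2, so there is little room.\<close>
  have Q3_le: "Q3 \<le> 201 / 100"
  proof (cases "y \<le> 1")
    case True
    have "(1 - y)\<^sup>2 \<le> 1 - y\<^sup>2" using True xy by (simp add: power2_eq_square algebra_simps)
    then have "(1 - y)\<^sup>2 \<le> x\<^sup>2" using xy by linarith
    then have "1 - y \<le> x" by (rule power2_le_imp_le) (rule xy)
    then have "(1 - x)\<^sup>2 \<le> y\<^sup>2" using xy by (intro power_mono) auto
    then have "Q3 \<le> (y\<^sup>2 + y\<^sup>2) / y" unfolding Q3_def using xy by (intro divide_right_mono) auto
    also have "\<dots> = 2 * y" using xy by (simp add: power2_eq_square)
    finally show ?thesis using True by simp
  next
    case False
    \<comment> \<open>As 3/2 is at most 207/1000 of \<open>w\<close>, the hypothesis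
      \<open>near\<close> confines \<open>y\<close> below 11/10.\<close>
    have "3 / 2 * 1 \<le> 207 / 1000 * w" using w by simp
    then have "pi * \<alpha> * (2 / sqrt 3 * (793 / 1000)) < pi * \<alpha> * (1 / y)" using near by (simp add: w_def)
    then have "2 / sqrt 3 * (793 / 1000) < 1 / y" using pa by (simp only: mult_less_cancel_left_pos)
    moreover have "2 / (17321 / 10000) * (793 / 1000) \<le> 2 / sqrt 3 * (793 / 1000)"
      using sqrt3_bounds by (intro mult_right_mono divide_left_mono) auto
    ultimately have "1586 / 1733 < 1 / y" by simp
    then have y1: "y < 11 / 10" using xy by (simp add: field_simps)
    have "(y - 1) * (y - 1) \<le> (1 / 10) * (1 / 10)" using y1 False by (intro mult_mono) auto
    then have "(1 + y\<^sup>2) / y \<le> 201 / 100" using xy False by (simp add: divide_le_eq power2_eq_square algebra_simps)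
    moreover have "Q3 \<le> (1 + y\<^sup>2) / y"
      unfolding Q3_def using xy by (intro divide_right_mono add_right_mono) (auto simp: power_le_one)
    ultimately show ?thesis by linarith
  qed
  define a1 a2 a3 where "a1 = pi * \<alpha> * Q1 - w" and "a2 = pi * \<alpha> * Q2 - w" and "a3 = pi * \<alpha> * Q3 - w"
  define s where "s = a1 + a2 + a3"
  have range: "- 3 / 2 \<le> a \<and> a \<le> 3 / 4 * w" if "a \<in> {a1, a2, a3}" for a
  proof -
    have "a1 \<le> a2" "a2 \<le> a3" using order \<alpha> by (auto simp: a1_def a2_def a3_def intro!: mult_left_mono)
    moreover have "- 3 / 2 \<le> a1" using near by (simp add: a1_def Q1_def w_def)
    moreover have "a3 \<le> 3 / 4 * w"
    proof -
      have "201 / 100 \<le> 7 / 4 * (2 / (17321 / 10000) :: real)" by simp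
      also have "\<dots> \<le> 7 / 4 * (2 / sqrt 3)" using sqrt3_bounds by (intro mult_left_mono divide_left_mono) auto
      finally have "pi * \<alpha> * Q3 \<le> pi * \<alpha> * (7 / 4 * (2 / sqrt 3))" using Q3_le pa by (intro mult_left_mono) auto
      then show ?thesis by (simp add: a3_def w_def)
    qed
    ultimately show ?thesis using that by auto
  qed
  define T where "T = Q1 + Q2 + Q3"
  \<comment> \<open>For a triangle with squared sides \<open>Q1\<close>, \<open>Q2\<close>,
    \<open>Q3\<close> the left side is 16 times the squared area; a lattice of covolume 1 gives area
    1/2.\<close>
  have heron: "T\<^sup>2 - 2 * (Q1\<^sup>2 + Q2\<^sup>2 + Q3\<^sup>2) = 4"
  proof -
    have T: "T = (2 * (x\<^sup>2 + y\<^sup>2) + 2 - 2 * x) / y"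
      using xy by (simp add: T_def Q1_def Q2_def Q3_def power2_eq_square field_simps)
    have T2: "T\<^sup>2 = (2 * (x\<^sup>2 + y\<^sup>2) + 2 - 2 * x)\<^sup>2 / y\<^sup>2"
      unfolding T by (rule power_divide)
    have "2 * (Q1\<^sup>2 + Q2\<^sup>2 + Q3\<^sup>2) = 2 * (1 + (x\<^sup>2 + y\<^sup>2)\<^sup>2 + ((1 - x)\<^sup>2 + y\<^sup>2)\<^sup>2) / y\<^sup>2"
      unfolding Q1_def Q2_def Q3_def power_divide by (simp add: add_divide_distrib[symmetric])
    then have "T\<^sup>2 - 2 * (Q1\<^sup>2 + Q2\<^sup>2 + Q3\<^sup>2)
      = ((2 * (x\<^sup>2 + y\<^sup>2) + 2 - 2 * x)\<^sup>2 - 2 * (1 + (x\<^sup>2 + y\<^sup>2)\<^sup>2 + ((1 - x)\<^sup>2 + y\<^sup>2)\<^sup>2)) / y\<^sup>2"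
      by (simp only: T2 diff_divide_distrib)
    also have "(2 * (x\<^sup>2 + y\<^sup>2) + 2 - 2 * x)\<^sup>2 - 2 * (1 + (x\<^sup>2 + y\<^sup>2)\<^sup>2 + ((1 - x)\<^sup>2 + y\<^sup>2)\<^sup>2) = 4 * y\<^sup>2"
      by (simp add: power2_eq_square algebra_simps)
    finally show ?thesis using xy by simp
  qed
  have w2: "3 * w\<^sup>2 = 4 * (pi * \<alpha>)\<^sup>2" by (simp add: w_def power_mult_distrib power_divide)
  have s_T: "s = pi * \<alpha> * T - 3 * w" by (simp add: s_def a1_def a2_def a3_def T_def algebra_simps)
  have ident: "2 * w * s + s\<^sup>2 = 2 * (a1\<^sup>2 + a2\<^sup>2 + a3\<^sup>2)"
  proof -
    have "2 * w * s + s\<^sup>2 - 2 * (a1\<^sup>2 + a2\<^sup>2 + a3\<^sup>2)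
      = (pi * \<alpha>)\<^sup>2 * (T\<^sup>2 - 2 * (Q1\<^sup>2 + Q2\<^sup>2 + Q3\<^sup>2)) - 3 * w\<^sup>2"
      by (simp add: s_T a1_def a2_def a3_def T_def power2_eq_square algebra_simps)
    then show ?thesis unfolding heron using w2 by simp
  qed
  \<comment> \<open>The equality case: a nonpositive \<open>s\<close> forces the displacements to
    vanish, which happens only at the hexagonal point. The alternative s < -2 w is incompatible with
    displacements of at least -3/2.\<close>
  have s0: "0 < s"
  proof (rule ccontr)
    assume neg: "\<not> 0 < s"
    have "0 \<le> T" using xy by (simp add: T_def Q1_def Q2_def Q3_def)
    then have "0 \<le> pi * \<alpha> * T" using pa by simp
    then have "- 3 * w \<le> s" using s_T by simp
    then have "s * (2 * w + s) \<le> 0 \<or> s < - 2 * w" using neg by (auto simp: mult_nonpos_nonneg)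
    then show False
    proof
      assume "s * (2 * w + s) \<le> 0"
      then have "a1\<^sup>2 + a2\<^sup>2 + a3\<^sup>2 \<le> 0" using ident by (simp add: power2_eq_square algebra_simps)
      then have "a1 = 0" "a2 = 0" by (smt (verit) zero_le_power2 power_eq_0_iff zero_eq_power2)+
      then have "pi * \<alpha> * Q1 = w" "pi * \<alpha> * Q2 = pi * \<alpha> * Q1" by (simp_all add: a1_def a2_def)
      then have "pi * \<alpha> = 0 \<or> Q1 = 2 / sqrt 3" "pi * \<alpha> = 0 \<or> Q2 = Q1"
        unfolding w_def by (simp_all only: mult_cancel_left)
      then have "Q1 = 2 / sqrt 3" "Q2 = Q1" using pa by auto
      then have y: "y = sqrt 3 / 2" and p: "x\<^sup>2 + y\<^sup>2 = 1" using xy by (auto simp: Q1_def Q2_def field_simps)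
      have "y\<^sup>2 = 3 / 4" unfolding y by (simp add: power_divide)
      then have "x\<^sup>2 = (1 / 2)\<^sup>2" using p by (simp add: power_divide)
      then have "x = 1 / 2" using xy by (simp add: power2_eq_iff)
      then show False using ne y by (simp add: hexagonal_point_def)
    next
      assume "s < - 2 * w"
      then show False using range[of a1] range[of a2] range[of a3] w by (simp add: s_def)
    qed
  qed
  let ?q = "\<lambda>v. pi * \<alpha> * qform (Complex x y) v"
  let ?f = "\<lambda>v. pair_energy b (?q v)"
  let ?h = "\<lambda>v. pair_energy b (w * hex_norm v)"
  have f: "?f summable_on UNIV" "infsum ?f UNIV = pi * \<alpha> * (K \<alpha> (Complex x y) - b * K (2 * \<alpha>) (Complex x y))"
    using pair_energy_sum[of \<alpha> "Complex x y" b] \<alpha> xy by auto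
  have q: "pi * \<alpha> * qform hexagonal_point v = w * hex_norm v" for v
    by (simp add: w_def qform_hexagonal)
  have h: "?h summable_on UNIV" "infsum ?h UNIV = pi * \<alpha> * (K \<alpha> hexagonal_point - b * K (2 * \<alpha>) hexagonal_point)"
    using pair_energy_sum[of \<alpha> hexagonal_point b] \<alpha> unfolding q by (auto simp: hexagonal_point_def)
  have fL: "?f summable_on long_vectors" and hL: "?h summable_on long_vectors"
    using summable_on_subset_banach[OF f(1)] summable_on_subset_banach[OF h(1)] by blast+
  have f_split: "infsum ?f UNIV = 2 * (pair_energy b (w + a1) + pair_energy b (w + a2) + pair_energy b (w + a3)) + infsum ?f long_vectors"
  proof -
    have "qform (Complex x y) 0 = 0" by (simp add: qform_def)
    then have "?f 0 = 0" by (simp add: pair_energy_def)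
    moreover have "?q (0, 1) = w + a1" "?q (0, -1) = w + a1" "?q (1, 0) = w + a2" "?q (-1, 0) = w + a2"
      "?q (1, -1) = w + a3" "?q (-1, 1) = w + a3"
      using xy by (simp_all add: qform_basis a1_def a2_def a3_def Q1_def Q2_def Q3_def)
    ultimately show ?thesis using infsum_short_long[OF f(1)] by simp
  qed
  have h_split: "infsum ?h UNIV = 6 * pair_energy b w + infsum ?h long_vectors"
    using infsum_short_long[OF h(1)] by (simp add: hex_norm_def pair_energy_def[of b 0])
  have six: "pair_energy b (w + a1) + pair_energy b (w + a2) + pair_energy b (w + a3) \<ge> 3 * pair_energy b w + exp (- w) * (s / 50)"
    using s0 by (intro pair_energy_triple w b range ident) (auto simp: s_def)
  let ?r = hex_rotation
  let ?t = "\<lambda>v. (w * hex_norm v)\<^sup>2 * exp (- (w * hex_norm v))"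
  \<comment> \<open>The three rotated values are compared with one tangent, taken at
    \<open>w * hex_norm v\<close>; their displacements from that point sum to
    \<open>hex_norm v * s\<close>.\<close>
  have cycle: "3 * ?h v - s / w * ?t v \<le> ?f v + ?f (?r v) + ?f (?r (?r v))" if v: "v \<in> long_vectors" for v
  proof -
    have N: "3 \<le> hex_norm v" using v by (simp add: long_vectors_eq)
    have big: "5 < ?q u" if "3 \<le> hex_norm u" for u
    proof -
      have "u \<noteq> 0" using that by (auto simp: hex_norm_def)
      then have "pi * \<alpha> * Q1 \<le> ?q u" unfolding Q1_def using qform_lower[OF z] pa by (intro mult_left_mono) auto
      moreover have "5 < pi * \<alpha> * Q1" using near w by (simp add: Q1_def w_def)
      ultimately show ?thesis by linarith
    qed
    have "w * 3 \<le> w * hex_norm v" using N w by (intro mult_left_mono) auto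
    then have "5 < w * hex_norm v" using w by linarith
    then obtain D where D: "\<And>u. 5 < u \<Longrightarrow> pair_energy b u \<ge> ?h v + D * (u - w * hex_norm v)"
      "D \<ge> - (w * hex_norm v * exp (- (w * hex_norm v)))"
      using pair_energy_tangent[OF b] by blast
    have "?q v + ?q (?r v) + ?q (?r (?r v)) = pi * \<alpha> * (hex_norm v * T)"
      unfolding distrib_left[symmetric] qform_rotation_sum[OF xy(1)] by (simp add: T_def Q1_def Q2_def Q3_def)
    then have sum: "?q v + ?q (?r v) + ?q (?r (?r v)) = 3 * (w * hex_norm v) + hex_norm v * s"
      by (simp add: s_T algebra_simps)
    have "?f v + ?f (?r v) + ?f (?r (?r v)) \<ge> 3 * ?h v + D * (?q v + ?q (?r v) + ?q (?r (?r v)) - 3 * (w * hex_norm v))"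
      using D(1)[OF big[of v]] D(1)[OF big[of "?r v"]] D(1)[OF big[of "?r (?r v)"]] N
      by (simp add: hex_norm_rotation algebra_simps)
    then have "?f v + ?f (?r v) + ?f (?r (?r v)) \<ge> 3 * ?h v + D * (hex_norm v * s)" unfolding sum by simp
    moreover have "D * (hex_norm v * s) \<ge> - (w * hex_norm v * exp (- (w * hex_norm v))) * (hex_norm v * s)"
      using D(2) N s0 by (intro mult_right_mono) auto
    moreover have "- (w * hex_norm v * exp (- (w * hex_norm v))) * (hex_norm v * s) = - (s / w * ?t v)"
      using w by (simp add: power2_eq_square field_simps)
    ultimately show ?thesis by linarith
  qed
  have bij2: "bij_betw (?r \<circ> ?r) long_vectors long_vectors"
    by (rule bij_betw_trans[OF bij_hex_rotation bij_hex_rotation])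
  have r1: "(\<lambda>v. ?f (?r v)) summable_on long_vectors" "infsum (\<lambda>v. ?f (?r v)) long_vectors = infsum ?f long_vectors"
    using summable_on_reindex_bij_betw[OF bij_hex_rotation, of ?f] infsum_reindex_bij_betw[OF bij_hex_rotation, of ?f] fL by auto
  have r2: "(\<lambda>v. ?f (?r (?r v))) summable_on long_vectors" "infsum (\<lambda>v. ?f (?r (?r v))) long_vectors = infsum ?f long_vectors"
    using summable_on_reindex_bij_betw[OF bij2, of ?f] infsum_reindex_bij_betw[OF bij2, of ?f] fL by auto
  have tL: "?t summable_on long_vectors" "infsum ?t long_vectors \<le> 17 / 100 * exp (- w)" by (rule hex_tail[OF w])+
  have "((\<lambda>v. 3 * ?h v - s / w * ?t v) has_sum (3 * infsum ?h long_vectors - s / w * infsum ?t long_vectors)) long_vectors"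
    by (intro has_sum_diff_real has_sum_cmult_right has_sum_infsum hL tL(1))
  moreover have "((\<lambda>v. ?f v + ?f (?r v) + ?f (?r (?r v))) has_sum (infsum ?f long_vectors + infsum ?f long_vectors + infsum ?f long_vectors)) long_vectors"
    using has_sum_infsum[OF fL] has_sum_infsum[OF r1(1)] has_sum_infsum[OF r2(1)] unfolding r1(2) r2(2)
    by (intro has_sum_add)
  ultimately have "3 * infsum ?h long_vectors - s / w * infsum ?t long_vectors
      \<le> infsum ?f long_vectors + infsum ?f long_vectors + infsum ?f long_vectors"
    by (rule has_sum_mono) (rule cycle)
  moreover have "s / w * infsum ?t long_vectors \<le> s / w * (17 / 100 * exp (- w))"
    using tL(2) s0 w by (intro mult_left_mono) auto
  moreover have "s / w * (17 / 100 * exp (- w)) \<le> s / (29 / 4) * (17 / 100 * exp (- w))"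
    using s0 w by (intro mult_right_mono divide_left_mono) auto
  moreover have "0 < s * exp (- w)" using s0 by simp
  ultimately have "infsum ?h UNIV < infsum ?f UNIV"
    using six unfolding f_split h_split by (simp add: algebra_simps)
  then have "pi * \<alpha> * (K \<alpha> hexagonal_point - b * K (2 * \<alpha>) hexagonal_point)
      < pi * \<alpha> * (K \<alpha> (Complex x y) - b * K (2 * \<alpha>) (Complex x y))"
    using f(2) h(2) by simp
  then show ?thesis using pa by (simp add: mult_less_cancel_left)
qed

lemma energy_gt_hexagonal:
  assumes "2 \<le> \<alpha>" "0 \<le> b" "b \<le> 2 * sqrt 2" "z \<in> fundamental_domain" "z \<noteq> hexagonal_point"
    and "b = 0 \<or> Im z \<le> 3 * \<alpha>"
  shows "K \<alpha> hexagonal_point - b * K (2 * \<alpha>) hexagonal_point < K \<alpha> z - b * K (2 * \<alpha>) z"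
proof -
  have z: "Complex (Re z) (Im z) = z" by simp
  show ?thesis
    using energy_far[OF assms(1-3), of "Re z" "Im z"] energy_near[OF assms(1-3), of "Re z" "Im z"] assms(4-6)
    unfolding z by linarith
qed

section \<open>The cusp\<close>

text \<open>A summable majorant with a closed-form sum; 61/100 lies just above exp (-1/2).\<close>

definition lattice_weight :: "int \<times> int \<Rightarrow> real" where
  "lattice_weight v = (61 / 100) ^ nat \<bar>fst v\<bar> * (61 / 100) ^ nat \<bar>snd v\<bar>"

lemma lattice_weight_nonneg: "0 \<le> lattice_weight v"
  by (simp add: lattice_weight_def)

lemma has_sum_lattice_weight: "(lattice_weight has_sum ((161 / 39)\<^sup>2)) UNIV"
proof -
  have "((\<lambda>v. (61 / 100 :: real) ^ nat \<bar>fst v\<bar> * (61 / 100) ^ nat \<bar>snd v\<bar>) has_sum ((1 + 61 / 100) / (1 - 61 / 100))\<^sup>2) (UNIV :: (int \<times> int) set)"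
    by (rule has_sum_power_abs_int2) auto
  then show ?thesis unfolding lattice_weight_def[abs_def] by simp
qed

lemma lattice_weight_summable: "lattice_weight summable_on A"
  using summable_on_subset_banach[OF has_sum_imp_summable[OF has_sum_lattice_weight]] by blast

lemma infsum_lattice_weight_le: "infsum lattice_weight A \<le> 1705 / 100"
proof -
  have "infsum lattice_weight A \<le> infsum lattice_weight UNIV"
    by (rule infsum_mono2) (auto intro: lattice_weight_summable lattice_weight_nonneg)
  also have "\<dots> \<le> 1705 / 100" by (simp add: infsumI[OF has_sum_lattice_weight] power2_eq_square)
  finally show ?thesis .
qed

lemma exp_le_lattice_weight:
  assumes "(\<bar>real_of_int (fst v)\<bar> + \<bar>real_of_int (snd v)\<bar>) / 2 \<le> n"
  shows "exp (- n) \<le> lattice_weight v"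
proof -
  have "exp (- n) \<le> exp (- (1 / 2) * \<bar>real_of_int (fst v)\<bar> + - (1 / 2) * \<bar>real_of_int (snd v)\<bar>)"
    using assms by simp
  also have "\<dots> = exp (- (1 / 2)) ^ nat \<bar>fst v\<bar> * exp (- (1 / 2)) ^ nat \<bar>snd v\<bar>"
    unfolding exp_power_abs_int exp_add ..
  also have "\<dots> \<le> lattice_weight v"
  proof -
    have "100 / 61 \<le> exp (1 / 2 :: real)" using exp_ge_rat[of 2 "100 / 61" 1] by (simp add: power2_eq_square)
    then have "exp (- (1 / 2 :: real)) \<le> 61 / 100" by (simp add: exp_minus field_simps)
    then show ?thesis unfolding lattice_weight_def by (intro mult_mono power_mono) auto
  qed
  finally show ?thesis .
qed

text \<open>The second index is dual, so what is taken out is the constant term and the first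
  harmonic of the row m = 0.\<close>

definition rest_vectors :: "(int \<times> int) set" where
  "rest_vectors = UNIV - {0, (0, 1), (0, -1)}"

lemma infsum_rest:
  fixes f :: "int \<times> int \<Rightarrow> real"
  assumes "f summable_on UNIV"
  shows "infsum f UNIV = f 0 + f (0, 1) + f (0, -1) + infsum f rest_vectors"
proof -
  have "f summable_on rest_vectors" using summable_on_subset_banach[OF assms] by blast
  then have "infsum f ({0, (0, 1), (0, -1)} \<union> rest_vectors) = infsum f {0, (0, 1), (0, -1)} + infsum f rest_vectors"
    by (intro infsum_Un_disjoint) (auto simp: rest_vectors_def)
  moreover have "{0, (0, 1), (0, -1)} \<union> rest_vectors = UNIV" by (auto simp: rest_vectors_def)
  ultimately show ?thesis by (simp add: zero_prod_def)
qed

text \<open>These are the exponents of the two theta sums, both as multiples of the same s; the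
  coefficients 2 mu and 1/2 belong to 2 alpha. For that sum the lower bound 2 is attained at (0,
  2).\<close>

lemma rest_vectors_norm:
  fixes \<mu> :: real
  assumes v: "v \<in> rest_vectors" and \<mu>: "4 \<le> \<mu>"
  defines "m \<equiv> real_of_int (fst v)" and "k \<equiv> real_of_int (snd v)"
  shows "2 \<le> \<mu> * m\<^sup>2 + k\<^sup>2" "(\<bar>m\<bar> + \<bar>k\<bar>) / 2 \<le> \<mu> * m\<^sup>2 + k\<^sup>2"
    "2 \<le> 2 * \<mu> * m\<^sup>2 + k\<^sup>2 / 2" "(\<bar>m\<bar> + \<bar>k\<bar>) / 2 \<le> 2 * \<mu> * m\<^sup>2 + k\<^sup>2 / 2"
proof -
  have abs: "\<bar>m\<bar> \<le> m\<^sup>2" "\<bar>k\<bar> \<le> k\<^sup>2" unfolding m_def k_def by (rule abs_le_power2_int)+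
  have m4: "4 * m\<^sup>2 \<le> \<mu> * m\<^sup>2" using \<mu> by (intro mult_right_mono) auto
  define P where "P = \<mu> * m\<^sup>2"
  have P: "4 * m\<^sup>2 \<le> P" "2 * \<mu> * m\<^sup>2 = 2 * P" using m4 by (simp_all add: P_def)
  have nonneg: "0 \<le> m\<^sup>2" "0 \<le> k\<^sup>2" by auto
  have "(C + D) / 2 \<le> P + B \<and> (C + D) / 2 \<le> 2 * P + B / 2"
    if "C \<le> A" "D \<le> B" "4 * A \<le> P" "0 \<le> A" "0 \<le> B" for A B C D :: real
    using that by (simp add: add_divide_distrib)
  note aux = this[OF abs P(1) nonneg]
  show "(\<bar>m\<bar> + \<bar>k\<bar>) / 2 \<le> \<mu> * m\<^sup>2 + k\<^sup>2" unfolding P_def[symmetric] using aux ..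
  show "(\<bar>m\<bar> + \<bar>k\<bar>) / 2 \<le> 2 * \<mu> * m\<^sup>2 + k\<^sup>2 / 2" unfolding P(2) using aux ..
  have four: "4 \<le> 4 * m\<^sup>2 \<or> 4 \<le> k\<^sup>2"
  proof (cases "fst v = 0")
    case True
    then have "snd v \<noteq> 0" "snd v \<noteq> 1" "snd v \<noteq> -1"
      using v by (cases v, auto simp: rest_vectors_def zero_prod_def)+
    then have "2 \<le> \<bar>snd v\<bar>" by linarith
    then have "2 \<le> \<bar>k\<bar>" unfolding k_def by linarith
    then have "2\<^sup>2 \<le> \<bar>k\<bar>\<^sup>2" by (intro power_mono) auto
    then show ?thesis by simp
  next
    case False
    then have "1 \<le> \<bar>m\<bar>" unfolding m_def by linarith
    then have "1 \<le> m\<^sup>2" using abs(1) by (rule order_trans)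
    then show ?thesis by simp
  qed
  have "2 \<le> P + B \<and> 2 \<le> 2 * P + B / 2"
    if "4 \<le> 4 * A \<or> 4 \<le> B" "4 * A \<le> P" "0 \<le> A" "0 \<le> B" for A B :: real
    using that by auto
  note aux = this[OF four P(1) nonneg]
  show "2 \<le> \<mu> * m\<^sup>2 + k\<^sup>2" unfolding P_def[symmetric] using aux ..
  show "2 \<le> 2 * \<mu> * m\<^sup>2 + k\<^sup>2 / 2" unfolding P(2) using aux ..
qed

text \<open>Half of the exponent u = s n absorbs the polynomial factor. The other half is at least
  5/2 + s/2 + n, because u >= 2 s and u >= 9 n.\<close>

lemma rest_decay:
  fixes s n :: real
  assumes s: "9 \<le> s" and n: "2 \<le> n" "(\<bar>real_of_int (fst v)\<bar> + \<bar>real_of_int (snd v)\<bar>) / 2 \<le> n"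
  shows "(1 / 2 + s * n) * exp (- (s * n)) \<le> 1 / 8 * exp (- s / 2) * lattice_weight v"
proof -
  let ?u = "s * n"
  have u: "0 \<le> ?u" using s n by simp
  have "- ?u \<le> - ?u / 2" using u by linarith
  then have "exp (- ?u) \<le> exp (- ?u / 2)" by (simp only: exp_le_cancel_iff)
  then have "(1 / 2 + ?u) * exp (- ?u) \<le> 3 / 2 * exp (- ?u / 2)"
    using exp_x_bound[OF u] unfolding distrib_right by linarith
  also have "exp (- ?u / 2) \<le> exp (- (5 / 2) + (- s / 2 + - n))"
  proof -
    have "s * 2 \<le> ?u" "9 * n \<le> ?u" using s n by (auto intro: mult_left_mono mult_right_mono)
    then have "- ?u / 2 \<le> - (5 / 2) + (- s / 2 + - n)" using n by linarith
    then show ?thesis by simp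
  qed
  also have "\<dots> = exp (- (5 / 2)) * (exp (- s / 2) * exp (- n))" by (simp only: exp_add)
  also have "\<dots> \<le> 1 / 12 * (exp (- s / 2) * lattice_weight v)"
  proof -
    have "12 \<le> exp (5 / 2 :: real)" using exp_ge_rat[of 2 12 5] by (simp add: power_divide)
    then have "exp (- (5 / 2 :: real)) \<le> 1 / 12" by (simp add: exp_minus field_simps)
    then show ?thesis
      using exp_le_lattice_weight[OF n(2)] lattice_weight_nonneg[of v] by (intro mult_mono) auto
  qed
  finally show ?thesis by (simp add: mult_ac)
qed

lemma theta_coeff_rest:
  assumes "9 \<le> s" "4 \<le> \<mu>" "v \<in> rest_vectors"
  shows "\<bar>theta_coeff s \<mu> v\<bar> \<le> 1 / 8 * exp (- s / 2) * lattice_weight v"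
    and "\<bar>theta_coeff (s / 2) (4 * \<mu>) v\<bar> \<le> 1 / 8 * exp (- s / 2) * lattice_weight v"
proof -
  note N = rest_vectors_norm[OF assms(3,2)]
  show "\<bar>theta_coeff s \<mu> v\<bar> \<le> 1 / 8 * exp (- s / 2) * lattice_weight v"
    using theta_coeff_bound[of s \<mu> v] rest_decay[OF assms(1) N(1,2)] assms by linarith
  have "s / 2 * (4 * \<mu> * (real_of_int (fst v))\<^sup>2 + (real_of_int (snd v))\<^sup>2)
    = s * (2 * \<mu> * (real_of_int (fst v))\<^sup>2 + (real_of_int (snd v))\<^sup>2 / 2)" by (simp add: field_simps)
  moreover have "\<bar>theta_coeff (s / 2) (4 * \<mu>) v\<bar> \<le> (1 / 2 + s / 2 * (4 * \<mu> * (real_of_int (fst v))\<^sup>2 + (real_of_int (snd v))\<^sup>2))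
    * exp (- (s / 2 * (4 * \<mu> * (real_of_int (fst v))\<^sup>2 + (real_of_int (snd v))\<^sup>2)))"
    by (rule theta_coeff_bound) (use assms in auto)
  ultimately have "\<bar>theta_coeff (s / 2) (4 * \<mu>) v\<bar> \<le> (1 / 2 + s * (2 * \<mu> * (real_of_int (fst v))\<^sup>2 + (real_of_int (snd v))\<^sup>2 / 2))
    * exp (- (s * (2 * \<mu> * (real_of_int (fst v))\<^sup>2 + (real_of_int (snd v))\<^sup>2 / 2)))"
    by (simp only:)
  also have "\<dots> \<le> 1 / 8 * exp (- s / 2) * lattice_weight v" by (rule rest_decay[OF assms(1) N(3,4)])
  finally show "\<bar>theta_coeff (s / 2) (4 * \<mu>) v\<bar> \<le> 1 / 8 * exp (- s / 2) * lattice_weight v" .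
qed

lemma theta_rest_sum:
  assumes s: "0 < s" and \<mu>: "0 < \<mu>"
    and le: "\<And>v. v \<in> rest_vectors \<Longrightarrow> \<bar>theta_coeff s \<mu> v\<bar> \<le> 1 / 8 * e * lattice_weight v" and e: "0 \<le> e"
  shows "\<bar>theta_sum s \<mu> x - (1 / 2 + (1 - 2 * s) * exp (- s))\<bar> \<le> 22 / 10 * e"
proof -
  have "theta_sum s \<mu> x = 1 / 2 + (1 - 2 * s) * exp (- s) + infsum (theta_term s \<mu> x) rest_vectors"
    unfolding theta_sum_def using infsum_rest[OF theta_term_summable[OF s \<mu>, of x]]
    by (simp add: theta_term_def theta_coeff_def algebra_simps)
  moreover have "\<bar>infsum (theta_term s \<mu> x) rest_vectors\<bar> \<le> 22 / 10 * e"
  proof -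
    have sum: "(\<lambda>v. 1 / 8 * e * lattice_weight v) summable_on rest_vectors"
      by (intro summable_on_cmult_right lattice_weight_summable)
    have "norm (infsum (theta_term s \<mu> x) rest_vectors) \<le> infsum (\<lambda>v. 1 / 8 * e * lattice_weight v) rest_vectors"
    proof (rule norm_infsum_le)
      show "(theta_term s \<mu> x has_sum infsum (theta_term s \<mu> x) rest_vectors) rest_vectors"
        using summable_on_subset_banach[OF theta_term_summable[OF s \<mu>, of x]] by (intro has_sum_infsum) blast
      show "((\<lambda>v. 1 / 8 * e * lattice_weight v) has_sum infsum (\<lambda>v. 1 / 8 * e * lattice_weight v) rest_vectors) rest_vectors"
        by (rule has_sum_infsum[OF sum])
      fix v assume "v \<in> rest_vectors"
      then show "norm (theta_term s \<mu> x v) \<le> 1 / 8 * e * lattice_weight v"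
        using abs_theta_term_le[of s \<mu> x v] le[of v] by simp
    qed
    also have "\<dots> = 1 / 8 * e * infsum lattice_weight rest_vectors" by (rule infsum_cmult_right')
    also have "\<dots> \<le> 1 / 8 * e * (1705 / 100)"
      using infsum_lattice_weight_le e by (intro mult_left_mono) auto
    also have "\<dots> \<le> 22 / 10 * e" using e by simp
    finally show ?thesis by simp
  qed
  ultimately show ?thesis by simp
qed

text \<open>In the difference, which governs the energy at beta = 1, the constants 1/2 cancel and s
  exp (-s/2) remains up to a bounded multiple of exp (-s/2); s >= 9 outweighs that multiple.\<close>

lemma theta_sum_bounds:
  assumes s: "9 \<le> s" and \<mu>: "4 \<le> \<mu>"
  shows "1 / 4 \<le> theta_sum (s / 2) (4 * \<mu>) x"
    and "exp (- s / 2) \<le> theta_sum s \<mu> x - theta_sum (s / 2) (4 * \<mu>) x"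
    and "theta_sum s \<mu> x - theta_sum (s / 2) (4 * \<mu>) x \<le> (s + 4) * exp (- s / 2)"
proof -
  define e where "e = exp (- s / 2)"
  define f where "f = s * e"
  have "s / 2 * exp (- (s / 2)) \<le> 9 / 2 * exp (- (9 / 2))" using s by (intro xexp_antimono) auto
  moreover have "86 \<le> exp (9 / 2 :: real)" using exp_ge_rat[of 2 86 9] by (simp add: power_divide)
  then have "exp (- (9 / 2 :: real)) \<le> 1 / 86" by (simp add: exp_minus field_simps)
  ultimately have f: "f \<le> 2 / 19" by (simp add: f_def e_def)
  have e: "0 < e" "9 * e \<le> f" using s by (auto simp: f_def e_def)
  define X where "X = (1 - 2 * s) * exp (- s)"
  have "exp (- s) = e * e" by (simp add: e_def exp_add[symmetric])
  then have X_eq: "X = e * e - 2 * (f * e)" by (simp add: X_def f_def algebra_simps)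
  have "f * e \<le> 2 / 19 * e" using f e by (intro mult_right_mono) auto
  moreover have "0 \<le> e * e" by simp
  ultimately have X: "- (4 / 19) * e \<le> X" unfolding X_eq by linarith
  have X0: "X \<le> 0" unfolding X_def using s by (intro mult_nonpos_nonneg) auto
  have A: "\<bar>theta_sum s \<mu> x - (1 / 2 + X)\<bar> \<le> 22 / 10 * e"
    unfolding X_def e_def using s \<mu> by (intro theta_rest_sum theta_coeff_rest) auto
  have "\<bar>theta_sum (s / 2) (4 * \<mu>) x - (1 / 2 + (1 - s) * e)\<bar> \<le> 22 / 10 * e"
    using theta_rest_sum[of "s / 2" "4 * \<mu>" e x] theta_coeff_rest(2)[OF s \<mu>] s \<mu> by (simp add: e_def)
  moreover have "(1 - s) * e = e - f" by (simp add: f_def algebra_simps)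
  ultimately have B: "\<bar>theta_sum (s / 2) (4 * \<mu>) x - (1 / 2 + (e - f))\<bar> \<le> 22 / 10 * e" by simp
  show "1 / 4 \<le> theta_sum (s / 2) (4 * \<mu>) x" using B e f by linarith
  show "exp (- s / 2) \<le> theta_sum s \<mu> x - theta_sum (s / 2) (4 * \<mu>) x"
    unfolding e_def[symmetric] using A B e f X by linarith
  have "(s + 4) * exp (- s / 2) = f + 4 * e" by (simp add: f_def e_def algebra_simps)
  then show "theta_sum s \<mu> x - theta_sum (s / 2) (4 * \<mu>) x \<le> (s + 4) * exp (- s / 2)"
    using A B e X0 by linarith
qed

section \<open>Dependence on the real part\<close>

lemma abs_sin_mult_le: "\<bar>sin (real n * x)\<bar> \<le> real n * \<bar>sin x\<bar>"
proof (induction n)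
  case (Suc n)
  have "sin (real (Suc n) * x) = sin (real n * x) * cos x + cos (real n * x) * sin x"
    by (simp add: distrib_right sin_add add.commute[of 1])
  then have "\<bar>sin (real (Suc n) * x)\<bar> \<le> \<bar>sin (real n * x)\<bar> * \<bar>cos x\<bar> + \<bar>cos (real n * x)\<bar> * \<bar>sin x\<bar>"
    by (metis abs_mult abs_triangle_ineq)
  also have "\<dots> \<le> \<bar>sin (real n * x)\<bar> * 1 + 1 * \<bar>sin x\<bar>"
    by (intro add_mono mult_left_mono mult_right_mono) auto
  finally show ?case using Suc by (simp add: distrib_right)
qed simp

text \<open>With y = pi x - pi/2 the difference is 2 sin^2 (n y) up to sign, and |sin (n y)| <= |n|
  |sin y|. Every harmonic is thus controlled by the first one, uniformly as \<open>x\<close>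
  approaches 1/2.\<close>

lemma cos_multiple_diff:
  "\<bar>cos (2 * pi * real_of_int n * x) - cos (pi * real_of_int n)\<bar> \<le> (real_of_int n)\<^sup>2 * (1 + cos (2 * pi * x))"
proof -
  define y where "y = pi * x - pi / 2"
  have "\<bar>sin (real_of_int n * y)\<bar> = \<bar>sin (real (nat \<bar>n\<bar>) * y)\<bar>"
    by (cases "0 \<le> n") auto
  then have s: "\<bar>sin (real_of_int n * y)\<bar> \<le> \<bar>real_of_int n\<bar> * \<bar>sin y\<bar>"
    using abs_sin_mult_le[of "nat \<bar>n\<bar>" y] by simp
  have "cos (2 * pi * real_of_int n * x) - cos (pi * real_of_int n)
    = 2 * sin ((2 * pi * real_of_int n * x + pi * real_of_int n) / 2) * sin ((pi * real_of_int n - 2 * pi * real_of_int n * x) / 2)"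
    by (rule cos_diff_cos)
  also have "(2 * pi * real_of_int n * x + pi * real_of_int n) / 2 = real_of_int n * y + pi * real_of_int n"
    by (simp add: y_def field_simps)
  also have "(pi * real_of_int n - 2 * pi * real_of_int n * x) / 2 = - (real_of_int n * y)"
    by (simp add: y_def field_simps)
  also have "sin (real_of_int n * y + pi * real_of_int n) = sin (real_of_int n * y) * cos (pi * real_of_int n)"
    using sin_npi_int[of n] by (simp add: sin_add mult.commute)
  finally have "\<bar>cos (2 * pi * real_of_int n * x) - cos (pi * real_of_int n)\<bar>
    = 2 * \<bar>sin (real_of_int n * y)\<bar>\<^sup>2 * \<bar>cos (pi * real_of_int n)\<bar>"
    by (simp add: abs_mult power2_eq_square)
  also have "\<dots> \<le> 2 * (\<bar>real_of_int n\<bar> * \<bar>sin y\<bar>)\<^sup>2 * 1"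
    using s by (intro mult_mono power_mono) auto
  also have "\<dots> = (real_of_int n)\<^sup>2 * (2 * (sin y)\<^sup>2)" by (simp add: power_mult_distrib)
  also have "sin y = - cos (pi * x)" by (simp add: y_def sin_diff)
  also have "2 * (- cos (pi * x))\<^sup>2 = 1 + cos (2 * pi * x)"
    using cos_double_cos[of "pi * x"] by (simp add: mult.assoc)
  finally show ?thesis .
qed

lemma fourth_power_le_exp: "0 \<le> d \<Longrightarrow> d ^ 4 \<le> 256 * exp d" for d :: real
proof -
  assume d: "0 \<le> d"
  have "d / 4 \<le> exp (d / 4)" using exp_ge_add_one_self[of "d / 4"] by linarith
  then have "(d / 4) ^ 4 \<le> exp (d / 4) ^ 4" using d by (intro power_mono) auto
  also have "\<dots> = exp d" by (simp add: exp_of_nat_mult[symmetric])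
  finally show ?thesis by (simp add: power_divide)
qed

text \<open>The exponent is s (mu + 1 + d), so \<open>d\<close> is the excess over a corner vector.
  One factor \<open>p\<close> is the loss from \<open>cos_multiple_diff\<close>, a second one bounds
  the polynomial. Since s d >= 2 d + 15, one exp (-d) absorbs p^2 <= d^4 <= 256 exp d, another
  yields the weight, and exp (-15) the small constant.\<close>

lemma off_corner_decay:
  fixes s \<mu> d p :: real and v :: "int \<times> int"
  assumes s: "9 \<le> s" and \<mu>: "4 \<le> \<mu>" and d: "3 \<le> d" "((real_of_int (fst v))\<^sup>2 + (real_of_int (snd v))\<^sup>2) / 2 \<le> d"
    and p: "p = (real_of_int (fst v * snd v))\<^sup>2"
    and n: "\<mu> + 1 + d \<le> p * (2 * \<mu> + 1 / 2)"
  shows "(1 / 2 + s * (\<mu> + 1 + d)) * exp (- (s * (\<mu> + 1 + d))) * p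
    \<le> 1 / 1000 * (s * (\<mu> - 1) * exp (- (s * (\<mu> + 1)))) * lattice_weight v"
proof -
  let ?n = "\<mu> + 1 + d"
  have p0: "0 \<le> p" by (simp add: p)
  have "9 * 8 \<le> s * ?n" using s \<mu> d by (intro mult_mono) auto
  then have "1 / 2 + s * ?n \<le> 11 / 10 * (s * ?n)" by simp
  also have "\<dots> \<le> 11 / 10 * (s * (p * (2 * \<mu> + 1 / 2)))" using n s by (intro mult_left_mono) auto
  also have "\<dots> \<le> 11 / 10 * (s * (p * (17 / 6 * (\<mu> - 1))))"
    using s \<mu> p0 by (intro mult_left_mono) auto
  finally have 1: "1 / 2 + s * ?n \<le> 187 / 60 * (s * (\<mu> - 1)) * p" by (simp add: algebra_simps)
  have "p \<le> d\<^sup>2"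
  proof -
    let ?a = "(real_of_int (fst v))\<^sup>2" and ?b = "(real_of_int (snd v))\<^sup>2"
    have "p = ?a * ?b" by (simp add: p power_mult_distrib)
    also have "\<dots> \<le> ((?a + ?b) / 2)\<^sup>2"
      using sum_power2_ge_zero[of "?a - ?b" 0] by (simp add: power2_eq_square field_simps)
    also have "\<dots> \<le> d\<^sup>2" using d by (intro power_mono) auto
    finally show ?thesis .
  qed
  then have "p\<^sup>2 \<le> (d\<^sup>2)\<^sup>2" using p0 by (intro power_mono) auto
  then have p2: "p\<^sup>2 \<le> 256 * exp d" using fourth_power_le_exp[of d] d by simp
  have e: "exp (- (s * d)) \<le> exp (- d) * exp (- d) * exp (- 15)"
  proof -
    have "9 * d \<le> s * d" using s d by (intro mult_right_mono) auto
    then have "- (s * d) \<le> - d + - d + - 15" using d by linarith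
    then show ?thesis by (simp only: exp_add[symmetric] exp_le_cancel_iff)
  qed
  have "exp (- 15 :: real) \<le> (1 / 148) ^ 3"
  proof -
    have "exp (- 15 :: real) = exp (- 5) ^ 3" by (simp add: exp_of_nat_mult[symmetric])
    also have "\<dots> \<le> (1 / 148) ^ 3"
      using exp_numeral_bounds(12) by (intro power_mono) (auto simp: exp_minus field_simps)
    finally show ?thesis .
  qed
  moreover have "(1 / 148) ^ 3 \<le> (1 / 3000000 :: real)" by (simp add: power3_eq_cube)
  ultimately have e15: "exp (- 15 :: real) \<le> 1 / 3000000" by linarith
  have w: "exp (- d) \<le> lattice_weight v"
    using exp_le_lattice_weight[of v d] abs_le_power2_int[of "fst v"] abs_le_power2_int[of "snd v"] d(2)
    by (simp add: add_divide_distrib)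
  have "p\<^sup>2 * exp (- (s * d)) \<le> (256 * exp d) * (exp (- d) * exp (- d) * exp (- 15))"
    using p2 e by (intro mult_mono) auto
  also have "\<dots> = 256 * exp (- 15) * exp (- d)" by (simp add: exp_minus field_simps)
  also have "\<dots> \<le> 256 * (1 / 3000000) * lattice_weight v"
    using e15 w by (intro mult_mono) auto
  finally have 2: "p\<^sup>2 * exp (- (s * d)) \<le> 256 / 3000000 * lattice_weight v" by simp
  have 3: "0 \<le> s * (\<mu> - 1) * exp (- (s * (\<mu> + 1)))" using s \<mu> by simp
  have "exp (- (s * ?n)) = exp (- (s * (\<mu> + 1))) * exp (- (s * d))"
    by (simp add: exp_add[symmetric] algebra_simps)
  then have "(1 / 2 + s * ?n) * exp (- (s * ?n)) * p = (1 / 2 + s * ?n) * (exp (- (s * (\<mu> + 1))) * exp (- (s * d)) * p)"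
    by simp
  also have "\<dots> \<le> (187 / 60 * (s * (\<mu> - 1)) * p) * (exp (- (s * (\<mu> + 1))) * exp (- (s * d)) * p)"
    using 1 p0 by (intro mult_right_mono) auto
  also have "\<dots> = (187 / 60 * (s * (\<mu> - 1) * exp (- (s * (\<mu> + 1))))) * (p\<^sup>2 * exp (- (s * d)))"
    by (simp add: power2_eq_square)
  also have "\<dots> \<le> (187 / 60 * (s * (\<mu> - 1) * exp (- (s * (\<mu> + 1))))) * (256 / 3000000 * lattice_weight v)"
    using 2 3 by (intro mult_left_mono) auto
  also have "\<dots> \<le> 1 / 1000 * (s * (\<mu> - 1) * exp (- (s * (\<mu> + 1)))) * lattice_weight v"
    using mult_nonneg_nonneg[OF 3 lattice_weight_nonneg[of v]] by (simp add: mult_ac)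
  finally show ?thesis .
qed

text \<open>These carry the leading \<open>x\<close>-dependent terms.\<close>

definition corner_vectors :: "(int \<times> int) set" where
  "corner_vectors = {(1, 1), (1, -1), (-1, 1), (-1, -1)}"

text \<open>The corner terms of the sum for alpha outweigh every other off-axis coefficient, even
  after multiplication by the squared frequency. In the sum for 2 alpha the corners themselves are
  negligible: 2 mu + 1/2 exceeds mu + 1 by more than 3.\<close>

lemma theta_coeff_off_axis:
  fixes s \<mu> :: real
  assumes s: "9 \<le> s" and \<mu>: "4 \<le> \<mu>" and v: "fst v \<noteq> 0" "snd v \<noteq> 0"
  defines "E \<equiv> s * (\<mu> - 1) * exp (- (s * (\<mu> + 1)))"
  shows "\<bar>theta_coeff (s / 2) (4 * \<mu>) v\<bar> * (real_of_int (fst v * snd v))\<^sup>2 \<le> 1 / 1000 * E * lattice_weight v"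
    and "v \<notin> corner_vectors \<Longrightarrow> \<bar>theta_coeff s \<mu> v\<bar> * (real_of_int (fst v * snd v))\<^sup>2 \<le> 1 / 1000 * E * lattice_weight v"
    and "v \<in> corner_vectors \<Longrightarrow> E \<le> theta_coeff s \<mu> v"
proof -
  define a b where "a = (real_of_int (fst v))\<^sup>2" and "b = (real_of_int (snd v))\<^sup>2"
  have one: "1 \<le> (real_of_int k)\<^sup>2" if "k \<noteq> 0" for k
    using abs_le_power2_int[of k] that by linarith
  have ab: "1 \<le> a" "1 \<le> b" using v one by (auto simp: a_def b_def)
  have p: "(real_of_int (fst v * snd v))\<^sup>2 = a * b" by (simp add: a_def b_def power_mult_distrib)
  have a_ab: "a * 1 \<le> a * b" "1 * b \<le> a * b" using ab by (intro mult_left_mono mult_right_mono; simp)+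
  have \<mu>a: "4 * (a - 1) \<le> \<mu> * (a - 1)" "4 * (2 * a - 1) \<le> \<mu> * (2 * a - 1)" using ab \<mu> by (intro mult_right_mono; simp)+
  have \<mu>ab: "\<mu> * a \<le> \<mu> * (a * b)" using a_ab \<mu> by (intro mult_left_mono) auto
  show "\<bar>theta_coeff (s / 2) (4 * \<mu>) v\<bar> * (real_of_int (fst v * snd v))\<^sup>2 \<le> 1 / 1000 * E * lattice_weight v"
  proof -
    define d where "d = \<mu> * (2 * a - 1) + b / 2 - 1"
    have n: "s / 2 * (4 * \<mu> * (real_of_int (fst v))\<^sup>2 + (real_of_int (snd v))\<^sup>2) = s * (\<mu> + 1 + d)"
      by (simp add: d_def a_def[symmetric] b_def[symmetric] field_simps)
    have "\<bar>theta_coeff (s / 2) (4 * \<mu>) v\<bar> \<le> (1 / 2 + s * (\<mu> + 1 + d)) * exp (- (s * (\<mu> + 1 + d)))"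
      using theta_coeff_bound[of "s / 2" "4 * \<mu>" v] s \<mu> unfolding n by simp
    then have "\<bar>theta_coeff (s / 2) (4 * \<mu>) v\<bar> * (real_of_int (fst v * snd v))\<^sup>2
      \<le> (1 / 2 + s * (\<mu> + 1 + d)) * exp (- (s * (\<mu> + 1 + d))) * (real_of_int (fst v * snd v))\<^sup>2"
      by (rule mult_right_mono) simp
    also have "\<dots> \<le> 1 / 1000 * E * lattice_weight v"
      unfolding E_def
    proof (rule off_corner_decay[OF s \<mu> _ _ refl])
      show "3 \<le> d" using \<mu>a ab by (simp add: d_def)
      show "((real_of_int (fst v))\<^sup>2 + (real_of_int (snd v))\<^sup>2) / 2 \<le> d"
        unfolding a_def[symmetric] b_def[symmetric] using \<mu>a ab by (simp add: d_def field_simps)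
      show "\<mu> + 1 + d \<le> (real_of_int (fst v * snd v))\<^sup>2 * (2 * \<mu> + 1 / 2)"
        unfolding p using \<mu>ab a_ab by (simp add: d_def field_simps)
    qed
    finally show ?thesis .
  qed
  show "\<bar>theta_coeff s \<mu> v\<bar> * (real_of_int (fst v * snd v))\<^sup>2 \<le> 1 / 1000 * E * lattice_weight v"
    if corner: "v \<notin> corner_vectors"
  proof -
    have "4 \<le> a \<or> 4 \<le> b"
    proof (rule ccontr)
      assume "\<not> (4 \<le> a \<or> 4 \<le> b)"
      then have "\<bar>real_of_int (fst v)\<bar> < 2" "\<bar>real_of_int (snd v)\<bar> < 2"
        using power_mono[of 2 "\<bar>real_of_int (fst v)\<bar>" 2] power_mono[of 2 "\<bar>real_of_int (snd v)\<bar>" 2]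
        by (auto simp: a_def b_def not_le[symmetric])
      then have "fst v = 1 \<or> fst v = -1" "snd v = 1 \<or> snd v = -1" using v by linarith+
      then show False using corner by (cases v) (auto simp: corner_vectors_def)
    qed
    then have ab4: "7 \<le> 4 * a + b" "10 \<le> 7 * a + b" using ab by auto
    define d where "d = \<mu> * (a - 1) + b - 1"
    have n: "s * (\<mu> * (real_of_int (fst v))\<^sup>2 + (real_of_int (snd v))\<^sup>2) = s * (\<mu> + 1 + d)"
      by (simp add: d_def a_def[symmetric] b_def[symmetric] field_simps)
    have "\<bar>theta_coeff s \<mu> v\<bar> \<le> (1 / 2 + s * (\<mu> + 1 + d)) * exp (- (s * (\<mu> + 1 + d)))"
      using theta_coeff_bound[of s \<mu> v] s \<mu> unfolding n by simp
    then have "\<bar>theta_coeff s \<mu> v\<bar> * (real_of_int (fst v * snd v))\<^sup>2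
      \<le> (1 / 2 + s * (\<mu> + 1 + d)) * exp (- (s * (\<mu> + 1 + d))) * (real_of_int (fst v * snd v))\<^sup>2"
      by (rule mult_right_mono) simp
    also have "\<dots> \<le> 1 / 1000 * E * lattice_weight v"
      unfolding E_def
    proof (rule off_corner_decay[OF s \<mu> _ _ refl])
      show "3 \<le> d" using \<mu>a ab4 \<open>4 \<le> a \<or> 4 \<le> b\<close> ab by (auto simp: d_def)
      show "((real_of_int (fst v))\<^sup>2 + (real_of_int (snd v))\<^sup>2) / 2 \<le> d"
        unfolding a_def[symmetric] b_def[symmetric] using \<mu>a ab4 by (simp add: d_def field_simps)
      have "\<mu> * (a * b) \<ge> 0" using \<mu> ab by simp
      moreover have "1 \<le> a * b" using a_ab ab by linarith
      then have "4 * (a * b) \<le> \<mu> * (a * b)" using \<mu> by (intro mult_right_mono) auto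
      ultimately show "\<mu> + 1 + d \<le> (real_of_int (fst v * snd v))\<^sup>2 * (2 * \<mu> + 1 / 2)"
        unfolding p using \<mu>ab a_ab \<open>1 \<le> a * b\<close> by (simp add: d_def algebra_simps)
    qed
    finally show ?thesis .
  qed
  show "E \<le> theta_coeff s \<mu> v" if "v \<in> corner_vectors"
  proof -
    have "theta_coeff s \<mu> v = (1 / 2 + s * (\<mu> - 1)) * exp (- (s * (\<mu> + 1)))"
      using that by (auto simp: corner_vectors_def theta_coeff_def)
    then show ?thesis by (simp add: E_def)
  qed
qed

text \<open>Terms on the axes do not depend on \<open>x\<close>. Each of the four corner terms of
  the sum for alpha grows by at least E D away from x = 1/2, and everything else together changes by
  at most (1/500) (161/39)^2 E D, less than E D / 25.\<close>

lemma theta_difference_half: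
  assumes s: "9 \<le> s" and \<mu>: "4 \<le> \<mu>" and \<beta>: "0 \<le> \<beta>" "\<beta> \<le> 1" and x: "0 \<le> x" "x < 1 / 2"
  shows "theta_sum s \<mu> (1 / 2) - \<beta> * theta_sum (s / 2) (4 * \<mu>) (1 / 2)
    < theta_sum s \<mu> x - \<beta> * theta_sum (s / 2) (4 * \<mu>) x"
proof -
  define E where "E = s * (\<mu> - 1) * exp (- (s * (\<mu> + 1)))"
  have E: "0 < E" using s \<mu> by (simp add: E_def)
  define D where "D = 1 + cos (2 * pi * x)"
  have "cos (2 * pi * (1 / 2)) < cos (2 * pi * x)"
    using x by (intro cos_monotone_0_pi mult_strict_left_mono) auto
  then have D: "0 < D" by (simp add: D_def)
  let ?f = "\<lambda>x v. theta_term s \<mu> x v - \<beta> * theta_term (s / 2) (4 * \<mu>) x v"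
  have hs: "(?f x has_sum (theta_sum s \<mu> x - \<beta> * theta_sum (s / 2) (4 * \<mu>) x)) UNIV" for x
  proof -
    have A: "(theta_term s \<mu> x has_sum theta_sum s \<mu> x) UNIV"
      unfolding theta_sum_def using s \<mu> by (intro has_sum_infsum theta_term_summable) auto
    have B: "(theta_term (s / 2) (4 * \<mu>) x has_sum theta_sum (s / 2) (4 * \<mu>) x) UNIV"
      unfolding theta_sum_def using s \<mu> by (intro has_sum_infsum theta_term_summable) auto
    show ?thesis by (rule has_sum_diff_real[OF A has_sum_cmult_right[OF B]])
  qed
  let ?c = "\<lambda>v. if v \<in> corner_vectors then E * D else 0"
  have low: "?f (1 / 2) v + (?c v - 1 / 500 * E * D * lattice_weight v) \<le> ?f x v" for v
  proof (cases "fst v = 0 \<or> snd v = 0")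
    case True
    then have "v \<notin> corner_vectors" "?f x v = ?f (1 / 2) v" by (auto simp: corner_vectors_def theta_term_def)
    then show ?thesis using E D lattice_weight_nonneg[of v] by simp
  next
    case False
    let ?k = "fst v * snd v"
    let ?A = "theta_coeff s \<mu> v" and ?B = "theta_coeff (s / 2) (4 * \<mu>) v"
    define d where "d = cos (2 * pi * real_of_int ?k * x) - cos (pi * real_of_int ?k)"
    have diff: "?f x v - ?f (1 / 2) v = ?A * d - \<beta> * (?B * d)"
    proof -
      have "2 * pi * real_of_int (snd v) * (real_of_int (fst v) * x) = 2 * pi * real_of_int ?k * x"
        "2 * pi * real_of_int (snd v) * (real_of_int (fst v) * (1 / 2)) = pi * real_of_int ?k" by simp_all
      then show ?thesis unfolding theta_term_def d_def by (simp only: right_diff_distrib mult.assoc)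
    qed
    have d: "\<bar>d\<bar> \<le> (real_of_int ?k)\<^sup>2 * D" unfolding d_def D_def by (rule cos_multiple_diff)
    note c = theta_coeff_off_axis[OF s \<mu>, of v]
    have scale: "\<bar>C * d\<bar> \<le> 1 / 1000 * E * lattice_weight v * D"
      if "\<bar>C\<bar> * (real_of_int ?k)\<^sup>2 \<le> 1 / 1000 * E * lattice_weight v" for C
    proof -
      have "\<bar>C * d\<bar> \<le> \<bar>C\<bar> * ((real_of_int ?k)\<^sup>2 * D)" unfolding abs_mult using d by (intro mult_left_mono) auto
      also have "\<dots> = \<bar>C\<bar> * (real_of_int ?k)\<^sup>2 * D" by simp
      also have "\<dots> \<le> 1 / 1000 * E * lattice_weight v * D" using that D by (intro mult_right_mono) auto
      finally show ?thesis .
    qed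
    have "\<bar>?B * d\<bar> \<le> 1 / 1000 * E * lattice_weight v * D" using False c(1) by (intro scale) (simp add: E_def)
    then have B: "\<beta> * (?B * d) \<le> 1 / 1000 * E * lattice_weight v * D"
    proof -
      assume B: "\<bar>?B * d\<bar> \<le> 1 / 1000 * E * lattice_weight v * D"
      have "\<beta> * (?B * d) \<le> \<beta> * \<bar>?B * d\<bar>" using \<beta> by (intro mult_left_mono) auto
      also have "\<dots> \<le> 1 * \<bar>?B * d\<bar>" using \<beta> by (intro mult_right_mono) auto
      finally show ?thesis using B by linarith
    qed
    have W: "1 / 500 * E * D * lattice_weight v = 2 * (1 / 1000 * E * lattice_weight v * D)" by simp
    show ?thesis
    proof (cases "v \<in> corner_vectors")
      case True
      then have "d = D" by (auto simp: d_def D_def corner_vectors_def)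
      then have "E * D \<le> ?A * d" using c(3) False True D by (auto simp: E_def intro!: mult_right_mono)
      moreover have "0 \<le> 1 / 1000 * E * lattice_weight v * D" using E D lattice_weight_nonneg[of v] by simp
      ultimately show ?thesis using diff B unfolding if_P[OF True] W by linarith
    next
      case corner: False
      then have "\<bar>?A * d\<bar> \<le> 1 / 1000 * E * lattice_weight v * D" using False c(2) by (intro scale) (simp add: E_def)
      then show ?thesis using diff B unfolding if_not_P[OF corner] W by linarith
    qed
  qed
  have "(?c has_sum (\<Sum>v\<in>corner_vectors. E * D)) UNIV"
    by (rule has_sum_finite_neutralI[where B = corner_vectors]) (auto simp: corner_vectors_def)
  then have c: "(?c has_sum (4 * (E * D))) UNIV" by (simp add: corner_vectors_def)
  have "((\<lambda>v. ?f (1 / 2) v + (?c v - 1 / 500 * E * D * lattice_weight v)) has_sum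
    (theta_sum s \<mu> (1 / 2) - \<beta> * theta_sum (s / 2) (4 * \<mu>) (1 / 2) + (4 * (E * D) - 1 / 500 * E * D * (161 / 39)\<^sup>2))) UNIV"
    by (intro has_sum_add[OF hs] has_sum_diff_real[OF c] has_sum_cmult_right has_sum_lattice_weight)
  from has_sum_mono[OF this hs low]
  have "theta_sum s \<mu> (1 / 2) - \<beta> * theta_sum (s / 2) (4 * \<mu>) (1 / 2) + (4 * (E * D) - 1 / 500 * E * D * (161 / 39)\<^sup>2)
    \<le> theta_sum s \<mu> x - \<beta> * theta_sum (s / 2) (4 * \<mu>) x" .
  moreover have "0 < 4 * (E * D) - 1 / 500 * E * D * (161 / 39)\<^sup>2"
    using E D by (simp add: power2_eq_square)
  ultimately show ?thesis by linarith
qed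

section \<open>Convexity on the line Re z = 1/2\<close>

lemma strict_midpoint:
  fixes f f' f'' :: "real \<Rightarrow> real"
  assumes "a < b"
    and f: "\<And>x. a \<le> x \<Longrightarrow> x \<le> b \<Longrightarrow> (f has_real_derivative f' x) (at x)"
    and f': "\<And>x. a \<le> x \<Longrightarrow> x \<le> b \<Longrightarrow> (f' has_real_derivative f'' x) (at x)"
    and pos: "\<And>x. a \<le> x \<Longrightarrow> x \<le> b \<Longrightarrow> 0 < f'' x"
  shows "f ((a + b) / 2) < (f a + f b) / 2"
proof -
  define m where "m = (a + b) / 2"
  have m: "a < m" "m < b" "b - m = m - a" using assms(1) by (auto simp: m_def field_simps)
  obtain x where x: "a < x" "x < m" "f m - f a = (m - a) * f' x"
    using MVT2[OF m(1), of f f'] f m by force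
  obtain y where y: "m < y" "y < b" "f b - f m = (b - m) * f' y"
    using MVT2[OF m(2), of f f'] f m by force
  have "f' x < f' y"
  proof (rule DERIV_pos_imp_increasing[where f = f'])
    fix z assume "x \<le> z" "z \<le> y"
    then have "a \<le> z" "z \<le> b" using x y by auto
    then show "\<exists>d. (f' has_real_derivative d) (at z) \<and> 0 < d" using f' pos by blast
  qed (use x y in simp)
  then have "(m - a) * f' x < (m - a) * f' y" using m by simp
  then have "f m - f a < f b - f m" using x y m by simp
  then show ?thesis unfolding m_def[symmetric] by simp
qed

text \<open>One coefficient of a dual series as a function of tau = sqrt (y / alpha), where s = pi
  tau^2; the leading factor \<open>\<tau>\<close> is the prefactor sqrt t of the expansion.\<close>

definition wave :: "real \<Rightarrow> real \<Rightarrow> real \<Rightarrow> real" where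
  "wave n e \<tau> = \<tau> * (1 / 2 + e * (pi * \<tau>\<^sup>2)) * exp (- (n * (pi * \<tau>\<^sup>2)))"

definition wave' :: "real \<Rightarrow> real \<Rightarrow> real \<Rightarrow> real" where
  "wave' n e \<tau> = (1 / 2 + (3 * e - n) * (pi * \<tau>\<^sup>2) - 2 * e * n * (pi * \<tau>\<^sup>2)\<^sup>2) * exp (- (n * (pi * \<tau>\<^sup>2)))"

definition wave'' :: "real \<Rightarrow> real \<Rightarrow> real \<Rightarrow> real" where
  "wave'' n e \<tau> = 2 * pi * \<tau> * exp (- (n * (pi * \<tau>\<^sup>2)))
    * (3 * e - 3 / 2 * n - (7 * e - n) * (n * (pi * \<tau>\<^sup>2)) + 2 * e * (n * (pi * \<tau>\<^sup>2))\<^sup>2)"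

lemma DERIV_wave: "(wave n e has_real_derivative wave' n e \<tau>) (at \<tau>)"
  unfolding wave_def[abs_def] wave'_def
  by (rule derivative_eq_intros refl | simp add: algebra_simps power2_eq_square)+

lemma DERIV_wave': "(wave' n e has_real_derivative wave'' n e \<tau>) (at \<tau>)"
  unfolding wave'_def[abs_def] wave''_def
  by (rule derivative_eq_intros refl | simp add: algebra_simps power2_eq_square)+

text \<open>Equal to tau (s - 1) exp (-s/2): minus the two terms (0, 1) and (0, -1) of the sum for 2
  alpha. It enters the energy with the factor beta.\<close>

definition main_wave :: "real \<Rightarrow> real" where
  "main_wave \<tau> = - 2 * wave (1 / 2) (- (1 / 2)) \<tau>"

definition main_wave'' :: "real \<Rightarrow> real" where
  "main_wave'' \<tau> = - 2 * wave'' (1 / 2) (- (1 / 2)) \<tau>"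

lemma main_wave''_eq:
  "main_wave'' \<tau> = 2 * pi * \<tau> * exp (- (pi * \<tau>\<^sup>2) / 2) * ((pi * \<tau>\<^sup>2)\<^sup>2 / 2 - 4 * (pi * \<tau>\<^sup>2) + 9 / 2)"
  unfolding main_wave''_def wave''_def by (simp add: power2_eq_square algebra_simps)

text \<open>The quadratic is the bracket in \<open>main_wave''_eq\<close>, positive beyond 4 + sqrt
  7. The bound 91/10 stays below 3 pi, so an open domain can reach past the cut.\<close>

lemma quadratic_dominates:
  fixes s :: real assumes "91 / 10 \<le> s"
  shows "s\<^sup>2 \<le> 88 / 10 * (s\<^sup>2 / 2 - 4 * s + 9 / 2)"
proof -
  have "0 \<le> (s - 91 / 10)\<^sup>2" by simp
  then have "91 / 5 * s - (91 / 10)\<^sup>2 \<le> s\<^sup>2" by (simp add: power2_eq_square algebra_simps)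
  then show ?thesis using assms by (simp add: power2_eq_square)
qed

lemma main_wave''_pos:
  assumes "0 < \<tau>" "91 / 10 \<le> pi * \<tau>\<^sup>2"
  shows "0 < main_wave'' \<tau>"
proof -
  have "0 < (pi * \<tau>\<^sup>2)\<^sup>2" using assms by simp
  then have "0 < 88 / 10 * ((pi * \<tau>\<^sup>2)\<^sup>2 / 2 - 4 * (pi * \<tau>\<^sup>2) + 9 / 2)"
    using quadratic_dominates[OF assms(2)] by (rule less_le_trans)
  then have "0 < (pi * \<tau>\<^sup>2)\<^sup>2 / 2 - 4 * (pi * \<tau>\<^sup>2) + 9 / 2"
    by (rule zero_less_mult_pos) simp
  then show ?thesis unfolding main_wave''_eq using assms by simp
qed

lemma cube_le_exp: "0 \<le> n \<Longrightarrow> n ^ 3 \<le> 27 / 20 * exp n" for n :: real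
proof -
  assume n: "0 \<le> n"
  have "n / 3 \<le> exp (n / 3 - 1)" using exp_ge_add_one_self[of "n / 3 - 1"] by simp
  then have "(n / 3) ^ 3 \<le> exp (n / 3 - 1) ^ 3" using n by (intro power_mono) auto
  also have "\<dots> = exp n * exp (- 3)" by (simp add: exp_of_nat_mult[symmetric] exp_add[symmetric])
  also have "\<dots> \<le> exp n * (1 / 20)"
  proof -
    have "20 \<le> exp (3 :: real)" using exp_ge_rat[of 1 20 3] by (simp add: power3_eq_cube)
    then show ?thesis by (intro mult_left_mono) (auto simp: exp_minus field_simps)
  qed
  finally show ?thesis by (simp add: power_divide)
qed

text \<open>With u = n s, the inequality s (n - 1/2) >= 91/10 (n - 1/2) gives exp (-u) <= exp (-19/2
  - s/2 - 2 n) for n >= 2. One exp (-n) absorbs n^3, the other remains for the lattice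
  weight.\<close>

lemma wave''_small:
  assumes \<tau>: "0 < \<tau>" "91 / 10 \<le> pi * \<tau>\<^sup>2" and n: "2 \<le> n" and e: "\<bar>e\<bar> \<le> n"
  shows "\<bar>wave'' n e \<tau>\<bar> \<le> 1 / 400 * exp (- n) * main_wave'' \<tau>"
proof -
  define s where "s = pi * \<tau>\<^sup>2"
  define g where "g = s\<^sup>2 / 2 - 4 * s + 9 / 2"
  have s: "91 / 10 \<le> s" using \<tau> by (simp add: s_def)
  have g: "s\<^sup>2 \<le> 88 / 10 * g" unfolding g_def by (rule quadratic_dominates[OF s])
  define u where "u = n * s"
  have "2 * (91 / 10) \<le> u" unfolding u_def using n s by (intro mult_mono) auto
  then have u: "18 \<le> u" by simp
  have bracket: "\<bar>3 * e - 3 / 2 * n - (7 * e - n) * u + 2 * e * u\<^sup>2\<bar> \<le> 5 / 2 * n * u\<^sup>2"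
  proof -
    define A B C where "A = n * u" and "B = (7 * e - n) * u" and "C = 2 * e * u\<^sup>2"
    define F where "F = n * u\<^sup>2"
    have "\<bar>B\<bar> \<le> 8 * n * u" unfolding B_def abs_mult using e u by (intro mult_mono) auto
    then have "\<bar>B\<bar> \<le> 8 * A" by (simp add: A_def)
    moreover have "\<bar>C\<bar> \<le> 2 * n * u\<^sup>2" unfolding C_def abs_mult using e by (intro mult_mono) auto
    then have "\<bar>C\<bar> \<le> 2 * F" by (simp add: F_def)
    moreover have "9 / 2 * n + 8 * A \<le> 1 / 2 * F"
    proof -
      have "18 * u \<le> u * u" using u by (intro mult_right_mono) auto
      then have "9 / 2 + 8 * u \<le> 1 / 2 * u\<^sup>2" unfolding power2_eq_square using u by linarith
      then have "n * (9 / 2 + 8 * u) \<le> n * (1 / 2 * u\<^sup>2)" using n by (intro mult_left_mono) auto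
      then show ?thesis by (simp add: A_def F_def algebra_simps)
    qed
    ultimately have "\<bar>3 * e - 3 / 2 * n - B + C\<bar> \<le> 5 / 2 * F" using e by linarith
    then show ?thesis by (simp add: B_def C_def F_def)
  qed
  have "\<bar>wave'' n e \<tau>\<bar> = 2 * pi * \<tau> * exp (- u) * \<bar>3 * e - 3 / 2 * n - (7 * e - n) * u + 2 * e * u\<^sup>2\<bar>"
    unfolding wave''_def s_def[symmetric] u_def[symmetric] abs_mult using \<tau> by simp
  also have "\<dots> \<le> 2 * pi * \<tau> * exp (- u) * (5 / 2 * n * u\<^sup>2)" using bracket \<tau> by (intro mult_left_mono) auto
  also have "\<dots> = 2 * pi * \<tau> * (5 / 2 * n ^ 3 * exp (- u) * s\<^sup>2)"
    by (simp add: u_def power2_eq_square power3_eq_cube)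
  also have "\<dots> \<le> 2 * pi * \<tau> * (1 / 400 * exp (- n) * exp (- s / 2) * g)"
  proof (intro mult_left_mono)
    have "5 / 2 * n ^ 3 * exp (- u) \<le> 5 / 2 * (27 / 20 * exp n) * exp (- u)"
      using cube_le_exp[of n] n by (intro mult_right_mono mult_left_mono) auto
    also have "exp (- u) \<le> exp (- (19 / 2)) * exp (- s / 2) * exp (- n) * exp (- n)"
    proof -
      have "91 / 10 * (n - 1 / 2) \<le> s * (n - 1 / 2)" using s n by (intro mult_right_mono) auto
      moreover have "s * (n - 1 / 2) = u - s / 2" by (simp add: u_def algebra_simps)
      moreover have "91 / 10 * (n - 1 / 2) = 91 / 10 * n - 91 / 20" by simp
      ultimately have "- u \<le> - (19 / 2) + - s / 2 + - n + - n" using n by linarith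
      then show ?thesis by (simp only: exp_add[symmetric] exp_le_cancel_iff)
    qed
    then have "5 / 2 * (27 / 20 * exp n) * exp (- u)
      \<le> 5 / 2 * (27 / 20 * exp n) * (exp (- (19 / 2)) * exp (- s / 2) * exp (- n) * exp (- n))"
      by (intro mult_left_mono) auto
    also have "\<dots> = 27 / 8 * exp (- (19 / 2)) * (exp (- n) * exp (- s / 2))" by (simp add: exp_minus field_simps)
    also have "\<dots> \<le> 27 / 8 * (1 / 13000) * (exp (- n) * exp (- s / 2))"
    proof -
      have "13000 \<le> exp (19 / 2 :: real)" using exp_ge_rat[of 2 13000 19] by (simp add: power_divide)
      then have "exp (- (19 / 2 :: real)) \<le> 1 / 13000" by (simp add: exp_minus field_simps)
      then show ?thesis by (intro mult_right_mono mult_left_mono) auto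
    qed
    finally have "5 / 2 * n ^ 3 * exp (- u) \<le> 27 / 104000 * (exp (- n) * exp (- s / 2))" by simp
    then have "5 / 2 * n ^ 3 * exp (- u) * s\<^sup>2 \<le> 27 / 104000 * (exp (- n) * exp (- s / 2)) * (88 / 10 * g)"
      by (rule mult_mono[OF _ g]) auto
    also have "\<dots> = (27 / 104000 * (88 / 10)) * (exp (- n) * exp (- s / 2) * g)" by simp
    also have "\<dots> \<le> 1 / 400 * (exp (- n) * exp (- s / 2) * g)"
    proof (intro mult_right_mono)
      have "0 \<le> g" using g zero_le_power2[of s] by linarith
      then show "0 \<le> exp (- n) * exp (- s / 2) * g" by simp
    qed simp
    finally show "5 / 2 * n ^ 3 * exp (- u) * s\<^sup>2 \<le> 1 / 400 * exp (- n) * exp (- s / 2) * g" by simp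
  qed (use \<tau> in auto)
  also have "\<dots> = 1 / 400 * exp (- n) * main_wave'' \<tau>"
    unfolding main_wave''_eq s_def[symmetric] g_def by simp
  finally show ?thesis .
qed

text \<open>The first harmonic of the sum for alpha is singled out for a sharper estimate than the
  rest; its extra factor exp (-s/2) <= 1/89 brings it down to two fifths of the main wave.\<close>

lemma second_wave''_small:
  assumes \<tau>: "0 < \<tau>" "91 / 10 \<le> pi * \<tau>\<^sup>2"
  shows "\<bar>2 * wave'' 1 (- 1) \<tau>\<bar> \<le> 4 / 10 * main_wave'' \<tau>"
proof -
  define s where "s = pi * \<tau>\<^sup>2"
  define g where "g = s\<^sup>2 / 2 - 4 * s + 9 / 2"
  have s: "91 / 10 \<le> s" using \<tau> by (simp add: s_def)
  have g: "s\<^sup>2 \<le> 88 / 10 * g" unfolding g_def by (rule quadratic_dominates[OF s])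
  have s2: "0 \<le> s\<^sup>2" by simp
  have "\<bar>3 * (- 1) - 3 / 2 * 1 - (7 * (- 1) - 1) * (1 * s) + 2 * (- 1) * (1 * s)\<^sup>2\<bar> \<le> 2 * s\<^sup>2"
    unfolding abs_le_iff using g s s2 by (simp add: g_def)
  also have "\<dots> \<le> 176 / 10 * g" using g by simp
  finally have b: "\<bar>3 * (- 1) - 3 / 2 * 1 - (7 * (- 1) - 1) * (1 * s) + 2 * (- 1) * (1 * s)\<^sup>2\<bar> \<le> 176 / 10 * g" .
  have e: "exp (- s) \<le> exp (- s / 2) * (1 / 89)"
  proof -
    have "89 \<le> exp (9 / 2 :: real)" using exp_ge_rat[of 2 89 9] by (simp add: power_divide)
    then have "exp (- (9 / 2 :: real)) \<le> 1 / 89" by (simp add: exp_minus field_simps)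
    moreover have "exp (- s) \<le> exp (- s / 2) * exp (- (9 / 2))"
      unfolding exp_add[symmetric] exp_le_cancel_iff using s by simp
    ultimately show ?thesis by (meson exp_ge_zero mult_left_mono order_trans)
  qed
  have g0: "0 \<le> g" using g s2 by linarith
  have "\<bar>2 * wave'' 1 (- 1) \<tau>\<bar> = 2 * (2 * pi * \<tau>) * exp (- s) * \<bar>3 * (- 1) - 3 / 2 * 1 - (7 * (- 1) - 1) * (1 * s) + 2 * (- 1) * (1 * s)\<^sup>2\<bar>"
    unfolding wave''_def s_def[symmetric] abs_mult using \<tau> by simp
  also have "\<dots> \<le> 2 * (2 * pi * \<tau>) * (exp (- s / 2) * (1 / 89)) * (176 / 10 * g)"
    using \<tau> b e g0 by (intro mult_mono) auto
  also have "\<dots> = (352 / 890) * (2 * pi * \<tau> * exp (- s / 2) * g)" by simp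
  also have "\<dots> \<le> 4 / 10 * (2 * pi * \<tau> * exp (- s / 2) * g)" using \<tau> g0 by (intro mult_right_mono) auto
  also have "\<dots> = 4 / 10 * main_wave'' \<tau>" unfolding main_wave''_eq s_def[symmetric] g_def by simp
  finally show ?thesis .
qed

lemma theta_coeff_wave:
  "\<tau> * theta_coeff (pi * \<tau>\<^sup>2) \<mu> v
    = wave (\<mu> * (real_of_int (fst v))\<^sup>2 + (real_of_int (snd v))\<^sup>2) (\<mu> * (real_of_int (fst v))\<^sup>2 - (real_of_int (snd v))\<^sup>2) \<tau>"
  "\<tau> * theta_coeff (pi * \<tau>\<^sup>2 / 2) (4 * \<mu>) v
    = wave (2 * \<mu> * (real_of_int (fst v))\<^sup>2 + (real_of_int (snd v))\<^sup>2 / 2) (2 * \<mu> * (real_of_int (fst v))\<^sup>2 - (real_of_int (snd v))\<^sup>2 / 2) \<tau>"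
proof -
  show "\<tau> * theta_coeff (pi * \<tau>\<^sup>2) \<mu> v
    = wave (\<mu> * (real_of_int (fst v))\<^sup>2 + (real_of_int (snd v))\<^sup>2) (\<mu> * (real_of_int (fst v))\<^sup>2 - (real_of_int (snd v))\<^sup>2) \<tau>"
    unfolding theta_coeff_def wave_def by (simp add: mult_ac)
  define a b where "a = (real_of_int (fst v))\<^sup>2" and "b = (real_of_int (snd v))\<^sup>2"
  have "pi * \<tau>\<^sup>2 / 2 * (4 * \<mu> * a - b) = (2 * \<mu> * a - b / 2) * (pi * \<tau>\<^sup>2)"
    "pi * \<tau>\<^sup>2 / 2 * (4 * \<mu> * a + b) = (2 * \<mu> * a + b / 2) * (pi * \<tau>\<^sup>2)" by (simp_all add: field_simps)
  then show "\<tau> * theta_coeff (pi * \<tau>\<^sup>2 / 2) (4 * \<mu>) v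
    = wave (2 * \<mu> * (real_of_int (fst v))\<^sup>2 + (real_of_int (snd v))\<^sup>2 / 2) (2 * \<mu> * (real_of_int (fst v))\<^sup>2 - (real_of_int (snd v))\<^sup>2 / 2) \<tau>"
    unfolding theta_coeff_def wave_def a_def[symmetric] b_def[symmetric]
    by (simp only: mult.assoc)
qed

definition line_energy :: "real \<Rightarrow> real \<Rightarrow> real \<Rightarrow> real" where
  "line_energy \<mu> \<beta> \<tau> = \<tau> * (theta_sum (pi * \<tau>\<^sup>2) \<mu> (1 / 2) - \<beta> * theta_sum (pi * \<tau>\<^sup>2 / 2) (4 * \<mu>) (1 / 2))"

text \<open>Open, so that convexity implies continuity, and containing sqrt 3, the value of tau at
  the cut.\<close>

definition wave_domain :: "real set" where
  "wave_domain = {sqrt (91 / (10 * pi))<..}"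

lemma wave_domainD: "\<tau> \<in> wave_domain \<Longrightarrow> 0 < \<tau> \<and> 91 / 10 \<le> pi * \<tau>\<^sup>2"
proof -
  assume "\<tau> \<in> wave_domain"
  then have lt: "sqrt (91 / (10 * pi)) < \<tau>" by (simp add: wave_domain_def)
  have "0 \<le> sqrt (91 / (10 * pi))" by simp
  then have \<tau>: "0 < \<tau>" using lt by linarith
  have "(sqrt (91 / (10 * pi)))\<^sup>2 \<le> \<tau>\<^sup>2" using lt by (intro power_mono) auto
  then have "91 / (10 * pi) \<le> \<tau>\<^sup>2" by simp
  then show ?thesis using \<tau> by (simp add: field_simps)
qed

text \<open>The terms of the remainder need not be convex; adding a small multiple of the dominant
  wave \<open>\<tau> (s - 1) exp (- s / 2)\<close> to each of them makes them so, at a cost paid for by the main part.\<close>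

lemma rest_wave_convex:
  assumes \<mu>: "4 \<le> \<mu>" and \<beta>: "0 \<le> \<beta>" "\<beta> \<le> 1" and v: "v \<in> rest_vectors"
  shows "convex_on wave_domain (\<lambda>\<tau>. \<tau> * (theta_term (pi * \<tau>\<^sup>2) \<mu> (1 / 2) v - \<beta> * theta_term (pi * \<tau>\<^sup>2 / 2) (4 * \<mu>) (1 / 2) v)
    + 1 / 200 * lattice_weight v * main_wave \<tau>)"
proof -
  define n1 e1 n2 e2 where "n1 = \<mu> * (real_of_int (fst v))\<^sup>2 + (real_of_int (snd v))\<^sup>2"
    and "e1 = \<mu> * (real_of_int (fst v))\<^sup>2 - (real_of_int (snd v))\<^sup>2"
    and "n2 = 2 * \<mu> * (real_of_int (fst v))\<^sup>2 + (real_of_int (snd v))\<^sup>2 / 2"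
    and "e2 = 2 * \<mu> * (real_of_int (fst v))\<^sup>2 - (real_of_int (snd v))\<^sup>2 / 2"
  define c where "c = cos (2 * pi * real_of_int (snd v) * (real_of_int (fst v) * (1 / 2)))"
  define p where "p = 1 / 200 * lattice_weight v"
  have c: "\<bar>c\<bar> \<le> 1" by (simp add: c_def)
  have nn: "0 \<le> \<mu> * (real_of_int (fst v))\<^sup>2" "0 \<le> 2 * \<mu> * (real_of_int (fst v))\<^sup>2" using \<mu> by auto
  have e: "\<bar>e1\<bar> \<le> n1" "\<bar>e2\<bar> \<le> n2" unfolding abs_le_iff n1_def e1_def n2_def e2_def using nn by simp_all
  note N = rest_vectors_norm[OF v \<mu>, folded n1_def n2_def]
  let ?f = "\<lambda>\<tau>. c * wave n1 e1 \<tau> - \<beta> * (c * wave n2 e2 \<tau>) + p * (- 2 * wave (1 / 2) (- (1 / 2)) \<tau>)"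
  let ?f' = "\<lambda>\<tau>. c * wave' n1 e1 \<tau> - \<beta> * (c * wave' n2 e2 \<tau>) + p * (- 2 * wave' (1 / 2) (- (1 / 2)) \<tau>)"
  let ?f'' = "\<lambda>\<tau>. c * wave'' n1 e1 \<tau> - \<beta> * (c * wave'' n2 e2 \<tau>) + p * (- 2 * wave'' (1 / 2) (- (1 / 2)) \<tau>)"
  have f: "\<tau> * (theta_term (pi * \<tau>\<^sup>2) \<mu> (1 / 2) v - \<beta> * theta_term (pi * \<tau>\<^sup>2 / 2) (4 * \<mu>) (1 / 2) v)
    + 1 / 200 * lattice_weight v * main_wave \<tau> = ?f \<tau>" for \<tau>
    unfolding theta_term_def c_def[symmetric] p_def[symmetric] n1_def e1_def n2_def e2_def
      theta_coeff_wave[symmetric] main_wave_def by (simp add: algebra_simps)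
  show ?thesis unfolding f
  proof (rule f''_ge0_imp_convex)
    show "convex wave_domain" by (simp add: wave_domain_def)
    show "(?f has_real_derivative ?f' \<tau>) (at \<tau>)" for \<tau>
      by (intro DERIV_add DERIV_diff DERIV_cmult DERIV_wave)
    show "(?f' has_real_derivative ?f'' \<tau>) (at \<tau>)" for \<tau>
      by (intro DERIV_add DERIV_diff DERIV_cmult DERIV_wave')
    fix \<tau> assume "\<tau> \<in> wave_domain"
    then have \<tau>: "0 < \<tau>" "91 / 10 \<le> pi * \<tau>\<^sup>2" using wave_domainD by auto
    have M: "0 < main_wave'' \<tau>" by (rule main_wave''_pos[OF \<tau>])
    have small: "\<bar>c * wave'' n e \<tau>\<bar> \<le> 1 / 400 * lattice_weight v * main_wave'' \<tau>"
      if "2 \<le> n" "\<bar>e\<bar> \<le> n" "(\<bar>real_of_int (fst v)\<bar> + \<bar>real_of_int (snd v)\<bar>) / 2 \<le> n" for n e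
    proof -
      have "\<bar>c * wave'' n e \<tau>\<bar> \<le> 1 * \<bar>wave'' n e \<tau>\<bar>" unfolding abs_mult using c by (intro mult_right_mono) auto
      also have "\<dots> \<le> 1 / 400 * exp (- n) * main_wave'' \<tau>" using wave''_small[OF \<tau> that(1,2)] by simp
      also have "\<dots> \<le> 1 / 400 * lattice_weight v * main_wave'' \<tau>"
        using exp_le_lattice_weight[OF that(3)] M by (intro mult_right_mono) auto
      finally show ?thesis .
    qed
    have 1: "\<bar>c * wave'' n1 e1 \<tau>\<bar> \<le> 1 / 400 * lattice_weight v * main_wave'' \<tau>" by (intro small N e)
    have 2: "\<bar>c * wave'' n2 e2 \<tau>\<bar> \<le> 1 / 400 * lattice_weight v * main_wave'' \<tau>" by (intro small N e)
    have "\<beta> * (c * wave'' n2 e2 \<tau>) \<le> \<beta> * \<bar>c * wave'' n2 e2 \<tau>\<bar>" using \<beta> by (intro mult_left_mono) auto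
    also have "\<dots> \<le> 1 * \<bar>c * wave'' n2 e2 \<tau>\<bar>" using \<beta> by (intro mult_right_mono) auto
    finally have "\<beta> * (c * wave'' n2 e2 \<tau>) \<le> 1 / 400 * lattice_weight v * main_wave'' \<tau>" using 2 by linarith
    moreover have "p * (- 2 * wave'' (1 / 2) (- (1 / 2)) \<tau>) = 2 * (1 / 400 * lattice_weight v * main_wave'' \<tau>)"
      by (simp add: p_def main_wave''_def)
    ultimately show "0 \<le> ?f'' \<tau>" using 1 by linarith
  qed
qed

text \<open>The budget: \<open>R\<close> borrows a share P <= 9/100 of the main wave, which leaves
  beta - P >= 6/10 against 4/10 for the first harmonic of the sum for alpha. Convexity of
  \<open>R\<close> is inherited term by term, so the remainder series is never
  differentiated.\<close>

lemma line_energy_decomposition: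
  assumes \<mu>: "4 \<le> \<mu>" and \<beta>: "7 / 10 \<le> \<beta>" "\<beta> \<le> 1"
  obtains S R S' S'' where "\<And>\<tau>. \<tau> \<in> wave_domain \<Longrightarrow> line_energy \<mu> \<beta> \<tau> = (1 - \<beta>) / 2 * \<tau> + S \<tau> + R \<tau>"
    and "convex_on wave_domain R"
    and "\<And>\<tau>. (S has_real_derivative S' \<tau>) (at \<tau>)" "\<And>\<tau>. (S' has_real_derivative S'' \<tau>) (at \<tau>)"
    and "\<And>\<tau>. \<tau> \<in> wave_domain \<Longrightarrow> 0 < S'' \<tau>"
proof -
  define P where "P = infsum (\<lambda>v. 1 / 200 * lattice_weight v) rest_vectors"
  have "P = 1 / 200 * infsum lattice_weight rest_vectors" unfolding P_def by (rule infsum_cmult_right')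
  then have P: "P \<le> 9 / 100" using infsum_lattice_weight_le[of rest_vectors] by simp
  let ?r = "\<lambda>\<tau> v. \<tau> * (theta_term (pi * \<tau>\<^sup>2) \<mu> (1 / 2) v - \<beta> * theta_term (pi * \<tau>\<^sup>2 / 2) (4 * \<mu>) (1 / 2) v)"
  let ?R = "\<lambda>\<tau> v. ?r \<tau> v + 1 / 200 * lattice_weight v * main_wave \<tau>"
  define R where "R \<tau> = infsum (?R \<tau>) rest_vectors" for \<tau>
  define S where "S \<tau> = (\<beta> - P) * (- 2 * wave (1 / 2) (- (1 / 2)) \<tau>) + 2 * wave 1 (- 1) \<tau>" for \<tau>
  define S' where "S' \<tau> = (\<beta> - P) * (- 2 * wave' (1 / 2) (- (1 / 2)) \<tau>) + 2 * wave' 1 (- 1) \<tau>" for \<tau>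
  define S'' where "S'' \<tau> = (\<beta> - P) * (- 2 * wave'' (1 / 2) (- (1 / 2)) \<tau>) + 2 * wave'' 1 (- 1) \<tau>" for \<tau>
  have r_sum: "?r \<tau> summable_on UNIV" if "\<tau> \<in> wave_domain" for \<tau>
  proof -
    have "0 < pi * \<tau>\<^sup>2" using wave_domainD[OF that] by simp
    then have "((\<lambda>v. \<tau> * (theta_term (pi * \<tau>\<^sup>2) \<mu> (1 / 2) v - \<beta> * theta_term (pi * \<tau>\<^sup>2 / 2) (4 * \<mu>) (1 / 2) v))
      has_sum line_energy \<mu> \<beta> \<tau>) UNIV"
      unfolding line_energy_def theta_sum_def using \<mu>
      by (intro has_sum_cmult_right has_sum_diff_real has_sum_infsum theta_term_summable) auto
    then show ?thesis by (rule has_sum_imp_summable)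
  qed
  have r_inf: "infsum (?r \<tau>) UNIV = line_energy \<mu> \<beta> \<tau>" if "\<tau> \<in> wave_domain" for \<tau>
  proof -
    have "0 < pi * \<tau>\<^sup>2" using wave_domainD[OF that] by simp
    then show ?thesis
      unfolding line_energy_def theta_sum_def using \<mu>
      by (intro infsumI has_sum_cmult_right has_sum_diff_real has_sum_infsum theta_term_summable) auto
  qed
  have R_has: "(?R \<tau> has_sum (infsum (?r \<tau>) rest_vectors + P * main_wave \<tau>)) rest_vectors" if "\<tau> \<in> wave_domain" for \<tau>
  proof -
    have "?r \<tau> summable_on rest_vectors" using summable_on_subset_banach[OF r_sum[OF that]] by blast
    moreover have "((\<lambda>v. 1 / 200 * lattice_weight v) has_sum P) rest_vectors"
      unfolding P_def by (intro has_sum_infsum summable_on_cmult_right lattice_weight_summable)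
    ultimately show ?thesis by (intro has_sum_add has_sum_cmult_left has_sum_infsum)
  qed
  show thesis
  proof (rule that[of S R S' S''])
    show "(S has_real_derivative S' \<tau>) (at \<tau>)" for \<tau>
      unfolding S_def[abs_def] S'_def by (intro DERIV_add DERIV_cmult DERIV_wave)
    show "(S' has_real_derivative S'' \<tau>) (at \<tau>)" for \<tau>
      unfolding S'_def[abs_def] S''_def by (intro DERIV_add DERIV_cmult DERIV_wave')
    show "0 < S'' \<tau>" if "\<tau> \<in> wave_domain" for \<tau>
    proof -
      have \<tau>: "0 < \<tau>" "91 / 10 \<le> pi * \<tau>\<^sup>2" using wave_domainD[OF that] by auto
      have M: "0 < main_wave'' \<tau>" by (rule main_wave''_pos[OF \<tau>])
      have "6 / 10 * main_wave'' \<tau> \<le> (\<beta> - P) * main_wave'' \<tau>" using M \<beta> P by (intro mult_right_mono) auto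
      moreover have "\<bar>2 * wave'' 1 (- 1) \<tau>\<bar> \<le> 4 / 10 * main_wave'' \<tau>" by (rule second_wave''_small[OF \<tau>])
      moreover have "S'' \<tau> = (\<beta> - P) * main_wave'' \<tau> + 2 * wave'' 1 (- 1) \<tau>"
        by (simp add: S''_def main_wave''_def)
      ultimately show ?thesis using M by linarith
    qed
    show "line_energy \<mu> \<beta> \<tau> = (1 - \<beta>) / 2 * \<tau> + S \<tau> + R \<tau>" if "\<tau> \<in> wave_domain" for \<tau>
    proof -
      have "line_energy \<mu> \<beta> \<tau> = ?r \<tau> 0 + ?r \<tau> (0, 1) + ?r \<tau> (0, -1) + infsum (?r \<tau>) rest_vectors"
        using infsum_rest[OF r_sum[OF that]] r_inf[OF that] by simp
      moreover have "?r \<tau> 0 = (1 - \<beta>) / 2 * \<tau>" by (simp add: theta_term_def theta_coeff_def field_simps)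
      moreover have "?r \<tau> (0, 1) + ?r \<tau> (0, -1) = 2 * wave 1 (- 1) \<tau> + \<beta> * main_wave \<tau>"
      proof -
        have *: "?r \<tau> (0, k) = wave 1 (- 1) \<tau> - \<beta> * wave (1 / 2) (- (1 / 2)) \<tau>" if "k\<^sup>2 = 1" for k
        proof -
          have k: "(real_of_int k)\<^sup>2 = 1" using that by (metis of_int_1 of_int_power)
          have "?r \<tau> (0, k) = \<tau> * theta_coeff (pi * \<tau>\<^sup>2) \<mu> (0, k) - \<beta> * (\<tau> * theta_coeff (pi * \<tau>\<^sup>2 / 2) (4 * \<mu>) (0, k))"
            by (simp add: theta_term_def algebra_simps)
          then show ?thesis unfolding theta_coeff_wave by (simp add: k)
        qed
        show ?thesis using *[of 1] *[of "-1"] by (simp add: main_wave_def)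
      qed
      moreover have "R \<tau> = infsum (?r \<tau>) rest_vectors + P * main_wave \<tau>"
        unfolding R_def by (rule infsumI[OF R_has[OF that]])
      moreover have "S \<tau> = \<beta> * main_wave \<tau> - P * main_wave \<tau> + 2 * wave 1 (- 1) \<tau>"
        by (simp add: S_def main_wave_def left_diff_distrib)
      ultimately show ?thesis by linarith
    qed
    show "convex_on wave_domain R"
    proof (rule convex_onI)
      show "convex wave_domain" by (simp add: wave_domain_def)
      fix t x y :: real
      assume t: "0 < t" "t < 1" and xy: "x \<in> wave_domain" "y \<in> wave_domain"
      then have z: "(1 - t) *\<^sub>R x + t *\<^sub>R y \<in> wave_domain"
        using convexD[of wave_domain x y "1 - t" t] by (simp add: wave_domain_def)
      have has: "(?R \<tau> has_sum R \<tau>) rest_vectors" if "\<tau> \<in> wave_domain" for \<tau>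
        unfolding R_def by (rule has_sum_infsum[OF has_sum_imp_summable[OF R_has[OF that]]])
      have "((\<lambda>v. (1 - t) * ?R x v + t * ?R y v) has_sum ((1 - t) * R x + t * R y)) rest_vectors"
        by (intro has_sum_add has_sum_cmult_right has xy)
      then show "R ((1 - t) *\<^sub>R x + t *\<^sub>R y) \<le> (1 - t) * R x + t * R y"
      proof (rule has_sum_mono[OF has[OF z]])
        fix v assume v: "v \<in> rest_vectors"
        show "?R ((1 - t) *\<^sub>R x + t *\<^sub>R y) v \<le> (1 - t) * ?R x v + t * ?R y v"
          using convex_onD[OF rest_wave_convex[OF \<mu> _ \<beta>(2) v], of t x y] \<beta> t xy by auto
      qed
    qed
  qed
qed

lemma line_energy_continuous:
  assumes "4 \<le> \<mu>" "7 / 10 \<le> \<beta>" "\<beta> \<le> 1"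
  shows "continuous_on wave_domain (line_energy \<mu> \<beta>)"
proof -
  obtain S R S' S'' where d: "\<And>\<tau>. \<tau> \<in> wave_domain \<Longrightarrow> line_energy \<mu> \<beta> \<tau> = (1 - \<beta>) / 2 * \<tau> + S \<tau> + R \<tau>"
    "convex_on wave_domain R" "\<And>\<tau>. (S has_real_derivative S' \<tau>) (at \<tau>)"
    using line_energy_decomposition[OF assms] by metis
  have "continuous_on wave_domain R"
    by (rule convex_on_continuous[OF _ d(2)]) (simp add: wave_domain_def)
  moreover have "continuous_on wave_domain S"
    using d(3) DERIV_isCont continuous_at_imp_continuous_on by blast
  ultimately have "continuous_on wave_domain (\<lambda>\<tau>. (1 - \<beta>) / 2 * \<tau> + S \<tau> + R \<tau>)"
    by (intro continuous_intros)
  then show ?thesis using d(1) by (simp cong: continuous_on_cong)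
qed

text \<open>Strict midpoint convexity is all that the uniqueness of a minimizer will
  require.\<close>

lemma line_energy_midpoint:
  assumes "4 \<le> \<mu>" "7 / 10 \<le> \<beta>" "\<beta> \<le> 1" and ab: "a \<in> wave_domain" "b \<in> wave_domain" "a < b"
  shows "line_energy \<mu> \<beta> ((a + b) / 2) < (line_energy \<mu> \<beta> a + line_energy \<mu> \<beta> b) / 2"
proof -
  obtain S R S' S'' where d: "\<And>\<tau>. \<tau> \<in> wave_domain \<Longrightarrow> line_energy \<mu> \<beta> \<tau> = (1 - \<beta>) / 2 * \<tau> + S \<tau> + R \<tau>"
    "convex_on wave_domain R" "\<And>\<tau>. (S has_real_derivative S' \<tau>) (at \<tau>)"
    "\<And>\<tau>. (S' has_real_derivative S'' \<tau>) (at \<tau>)" "\<And>\<tau>. \<tau> \<in> wave_domain \<Longrightarrow> 0 < S'' \<tau>"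
    using line_energy_decomposition[OF assms(1-3)] by metis
  have m: "(a + b) / 2 \<in> wave_domain" using ab by (auto simp: wave_domain_def)
  have "S ((a + b) / 2) < (S a + S b) / 2"
    by (rule strict_midpoint[OF ab(3) d(3,4)]) (use ab d(5) in \<open>auto simp: wave_domain_def\<close>)
  moreover have "R ((a + b) / 2) \<le> (R a + R b) / 2"
    using convex_onD[OF d(2), of "1 / 2" a b] ab by (simp add: field_simps)
  moreover have "(1 - \<beta>) / 2 * ((a + b) / 2) = ((1 - \<beta>) / 2 * a + (1 - \<beta>) / 2 * b) / 2"
    by (simp add: field_simps)
  ultimately show ?thesis unfolding d(1)[OF m] d(1)[OF ab(1)] d(1)[OF ab(2)] by (simp add: field_simps)
qed

section \<open>The threshold\<close>

text \<open>At 2 alpha the prefactors are 2 pi alpha and sqrt (y / (2 alpha)), so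
  \<open>K (2 * \<alpha>)\<close> carries 1 / (2 sqrt 2) relative to \<open>K \<alpha>\<close>.
  Hence the critical value and the parameter beta.\<close>

lemma energy_theta:
  assumes "0 < \<alpha>" "0 < y"
  shows "pi * \<alpha> * K (2 * \<alpha>) (Complex x y)
      = sqrt (y / \<alpha>) / (2 * sqrt 2) * theta_sum (pi * (y / \<alpha>) / 2) (4 * \<alpha>\<^sup>2) x"
    and "pi * \<alpha> * (K \<alpha> (Complex x y) - b * K (2 * \<alpha>) (Complex x y))
      = sqrt (y / \<alpha>) * (theta_sum (pi * (y / \<alpha>)) (\<alpha>\<^sup>2) x
        - b / (2 * sqrt 2) * theta_sum (pi * (y / \<alpha>) / 2) (4 * \<alpha>\<^sup>2) x)"
proof -
  have 1: "pi * \<alpha> * K \<alpha> (Complex x y) = sqrt (y / \<alpha>) * theta_sum (pi * (y / \<alpha>)) (\<alpha>\<^sup>2) x"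
    using K_poisson(2)[OF assms, of x] by simp
  have "pi * (2 * \<alpha>) * K (2 * \<alpha>) (Complex x y) = sqrt (y / (2 * \<alpha>)) * theta_sum (pi * y / (2 * \<alpha>)) ((2 * \<alpha>)\<^sup>2) x"
    using K_poisson(2)[of "2 * \<alpha>" y x] assms by simp
  moreover have "sqrt (y / (2 * \<alpha>)) = sqrt (y / \<alpha>) / sqrt 2"
    by (simp add: real_sqrt_divide real_sqrt_mult)
  moreover have "pi * y / (2 * \<alpha>) = pi * (y / \<alpha>) / 2" by simp
  moreover have "(2 * \<alpha>)\<^sup>2 = 4 * \<alpha>\<^sup>2" by (simp add: power_mult_distrib)
  ultimately have "2 * (pi * \<alpha> * K (2 * \<alpha>) (Complex x y))
      = sqrt (y / \<alpha>) / sqrt 2 * theta_sum (pi * (y / \<alpha>) / 2) (4 * \<alpha>\<^sup>2) x"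
    by (simp only: mult_ac)
  then show 2: "pi * \<alpha> * K (2 * \<alpha>) (Complex x y)
      = sqrt (y / \<alpha>) / (2 * sqrt 2) * theta_sum (pi * (y / \<alpha>) / 2) (4 * \<alpha>\<^sup>2) x" by simp
  have "pi * \<alpha> * (K \<alpha> (Complex x y) - b * K (2 * \<alpha>) (Complex x y))
      = pi * \<alpha> * K \<alpha> (Complex x y) - b * (pi * \<alpha> * K (2 * \<alpha>) (Complex x y))" by (simp add: algebra_simps)
  then show "pi * \<alpha> * (K \<alpha> (Complex x y) - b * K (2 * \<alpha>) (Complex x y))
      = sqrt (y / \<alpha>) * (theta_sum (pi * (y / \<alpha>)) (\<alpha>\<^sup>2) x
        - b / (2 * sqrt 2) * theta_sum (pi * (y / \<alpha>) / 2) (4 * \<alpha>\<^sup>2) x)"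
    unfolding 1 2 by (simp add: algebra_simps)
qed

lemma energy_line:
  assumes "0 < \<alpha>" "0 < \<tau>"
  shows "pi * \<alpha> * (K \<alpha> (Complex (1 / 2) (\<alpha> * \<tau>\<^sup>2)) - b * K (2 * \<alpha>) (Complex (1 / 2) (\<alpha> * \<tau>\<^sup>2)))
    = line_energy (\<alpha>\<^sup>2) (b / (2 * sqrt 2)) \<tau>"
proof -
  have "\<alpha> * \<tau>\<^sup>2 / \<alpha> = \<tau>\<^sup>2" using assms by simp
  then show ?thesis using energy_theta(2)[of \<alpha> "\<alpha> * \<tau>\<^sup>2" "1 / 2" b] assms by (simp add: line_energy_def)
qed

context
  fixes \<alpha> :: real
  assumes \<alpha>: "2 \<le> \<alpha>"
begin

lemma square_ge_4: "4 \<le> \<alpha>\<^sup>2"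
  using power_mono[OF \<alpha>, of 2] by simp

lemma cusp_region:
  assumes "3 * \<alpha> \<le> y"
  shows "9 \<le> pi * (y / \<alpha>)" "0 < y" "3 \<le> y / \<alpha>"
proof -
  show t: "3 \<le> y / \<alpha>" using assms \<alpha> by (simp add: le_divide_eq)
  have "3 * 3 \<le> pi * (y / \<alpha>)" using t pi_approx by (intro mult_mono) auto
  then show "9 \<le> pi * (y / \<alpha>)" by simp
  show "0 < y" using assms \<alpha> by linarith
qed

text \<open>Growth like sqrt y in the cusp: the source of coercivity for b < 2 sqrt 2 and of
  unboundedness for b > 2 sqrt 2.\<close>

lemma K_double_lower:
  assumes "3 * \<alpha> \<le> y"
  shows "sqrt (y / \<alpha>) / (8 * sqrt 2) \<le> pi * \<alpha> * K (2 * \<alpha>) (Complex x y)"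
proof -
  have "sqrt (y / \<alpha>) / (2 * sqrt 2) * (1 / 4) \<le> sqrt (y / \<alpha>) / (2 * sqrt 2) * theta_sum (pi * (y / \<alpha>) / 2) (4 * \<alpha>\<^sup>2) x"
    using theta_sum_bounds(1)[OF cusp_region(1)[OF assms] square_ge_4] cusp_region(3)[OF assms]
    by (intro mult_left_mono) auto
  then show ?thesis using energy_theta(1)[of \<alpha> y x] \<alpha> cusp_region(2)[OF assms] by simp
qed

lemma K_double_pos: "3 * \<alpha> \<le> y \<Longrightarrow> 0 < K (2 * \<alpha>) (Complex x y)"
proof -
  assume y: "3 * \<alpha> \<le> y"
  have "0 < sqrt (y / \<alpha>) / (8 * sqrt 2)" using cusp_region(3)[OF y] by simp
  then have "0 < pi * \<alpha> * K (2 * \<alpha>) (Complex x y)" using K_double_lower[OF y, of x] by linarith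
  moreover have "0 < pi * \<alpha>" using \<alpha> by simp
  ultimately show ?thesis by (rule zero_less_mult_pos)
qed

lemma critical_energy_bounds:
  assumes "3 * \<alpha> \<le> y"
  shows "sqrt (y / \<alpha>) * exp (- (pi * (y / \<alpha>)) / 2)
      \<le> pi * \<alpha> * (K \<alpha> (Complex x y) - 2 * sqrt 2 * K (2 * \<alpha>) (Complex x y))"
    and "pi * \<alpha> * (K \<alpha> (Complex x y) - 2 * sqrt 2 * K (2 * \<alpha>) (Complex x y))
      \<le> sqrt (y / \<alpha>) * ((pi * (y / \<alpha>) + 4) * exp (- (pi * (y / \<alpha>)) / 2))"
proof -
  note b = theta_sum_bounds[OF cusp_region(1)[OF assms] square_ge_4, of x]
  have t: "0 \<le> sqrt (y / \<alpha>)" using cusp_region(3)[OF assms] by simp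
  have E: "pi * \<alpha> * (K \<alpha> (Complex x y) - 2 * sqrt 2 * K (2 * \<alpha>) (Complex x y))
      = sqrt (y / \<alpha>) * (theta_sum (pi * (y / \<alpha>)) (\<alpha>\<^sup>2) x - theta_sum (pi * (y / \<alpha>) / 2) (4 * \<alpha>\<^sup>2) x)"
    using energy_theta(2)[of \<alpha> y x "2 * sqrt 2"] \<alpha> cusp_region(2)[OF assms] by simp
  show "sqrt (y / \<alpha>) * exp (- (pi * (y / \<alpha>)) / 2)
      \<le> pi * \<alpha> * (K \<alpha> (Complex x y) - 2 * sqrt 2 * K (2 * \<alpha>) (Complex x y))"
    unfolding E using b(2) t by (rule mult_left_mono)
  show "pi * \<alpha> * (K \<alpha> (Complex x y) - 2 * sqrt 2 * K (2 * \<alpha>) (Complex x y))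
      \<le> sqrt (y / \<alpha>) * ((pi * (y / \<alpha>) + 4) * exp (- (pi * (y / \<alpha>)) / 2))"
    unfolding E using b(3) t by (rule mult_left_mono)
qed

lemma energy_half_less:
  assumes y: "3 * \<alpha> \<le> y" and x: "0 \<le> x" "x < 1 / 2" and b: "0 \<le> b" "b \<le> 2 * sqrt 2"
  shows "K \<alpha> (Complex (1 / 2) y) - b * K (2 * \<alpha>) (Complex (1 / 2) y) < K \<alpha> (Complex x y) - b * K (2 * \<alpha>) (Complex x y)"
proof -
  have "0 \<le> b / (2 * sqrt 2)" "b / (2 * sqrt 2) \<le> 1" using b by (simp_all add: divide_le_eq)
  note d = theta_difference_half[OF cusp_region(1)[OF y] square_ge_4 this x]
  have t: "0 < sqrt (y / \<alpha>)" using cusp_region(3)[OF y] by simp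
  have "pi * \<alpha> * (K \<alpha> (Complex (1 / 2) y) - b * K (2 * \<alpha>) (Complex (1 / 2) y))
    < pi * \<alpha> * (K \<alpha> (Complex x y) - b * K (2 * \<alpha>) (Complex x y))"
    using energy_theta(2)[of \<alpha> y _ b] \<alpha> cusp_region(2)[OF y] mult_strict_left_mono[OF d t] by simp
  moreover have "0 < pi * \<alpha>" using \<alpha> by simp
  ultimately show ?thesis by (simp only: mult_less_cancel_left_pos)
qed

lemma hexagonal_in_domain: "hexagonal_point \<in> fundamental_domain" "Im hexagonal_point < 3 * \<alpha>"
proof -
  show "hexagonal_point \<in> fundamental_domain"
    unfolding hexagonal_point_def fundamental_domain_iff by (simp add: power_divide)
  show "Im hexagonal_point < 3 * \<alpha>" using sqrt3_bounds \<alpha> by (simp add: hexagonal_point_def)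
qed

text \<open>No pair energy is negative, every nonzero vector having value at least 29/4 > pi/3, and
  that of (0, 1) is positive.\<close>

lemma critical_energy_hexagonal_pos:
  "0 < K \<alpha> hexagonal_point - 2 * sqrt 2 * K (2 * \<alpha>) hexagonal_point"
proof -
  define w where "w = pi * \<alpha> * (2 / sqrt 3)"
  let ?b = "2 * sqrt 2"
  have w: "29 / 4 \<le> w" using energy_hexagonal_le(1)[OF \<alpha>, of 0] by (simp add: w_def)
  let ?f = "\<lambda>v. pair_energy ?b (pi * \<alpha> * qform hexagonal_point v)"
  have q: "pi * \<alpha> * qform hexagonal_point v = w * hex_norm v" for v
    by (simp add: w_def qform_hexagonal)
  have f: "?f summable_on UNIV" "infsum ?f UNIV = pi * \<alpha> * (K \<alpha> hexagonal_point - ?b * K (2 * \<alpha>) hexagonal_point)"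
    using pair_energy_sum[of \<alpha> hexagonal_point ?b] \<alpha> by (auto simp: hexagonal_point_def)
  have nonneg: "0 \<le> ?f v" for v
  proof (cases "v = 0")
    case True
    then show ?thesis by (simp add: qform_def pair_energy_def)
  next
    case False
    have "1 \<le> hex_norm v" using hex_norm_long[OF False] hex_norm_short[of v] by (cases "v \<in> short_vectors") auto
    then have "w * 1 \<le> w * hex_norm v" using w by (intro mult_left_mono) auto
    moreover have "pi / 3 \<le> 29 / 4" using pi_approx by simp
    ultimately have "pi / 3 \<le> w * hex_norm v" using w by linarith
    moreover have "0 \<le> pi / 3" by simp
    ultimately show ?thesis unfolding q by (intro pair_energy_nonneg) linarith+
  qed
  have "0 < ?f (0, 1)"
  proof -
    have "?b * exp (- w) < 1" using exp_small_bounds(2)[OF w, of ?b] by simp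
    then show ?thesis unfolding q pair_energy_factor using w by (simp add: hex_norm_def)
  qed
  also have "?f (0, 1) \<le> infsum ?f UNIV"
    using finite_sum_le_infsum[OF f(1), of "{(0, 1)}"] nonneg by simp
  finally have "0 < pi * \<alpha> * (K \<alpha> hexagonal_point - ?b * K (2 * \<alpha>) hexagonal_point)" by (simp only: f(2))
  moreover have "0 < pi * \<alpha>" using \<alpha> by simp
  ultimately show ?thesis by (rule zero_less_mult_pos)
qed

lemma fundamental_domain_uhp: "z \<in> fundamental_domain \<Longrightarrow> z \<in> upper_half_plane"
  by (simp add: fundamental_domain_def upper_half_plane_def)

lemma K_orbit_representative:
  assumes "z \<in> upper_half_plane"
  obtains u where "u \<in> fundamental_domain" "z \<in> modular_orbit u" "\<And>\<beta>. K \<beta> z = K \<beta> u"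
proof -
  obtain u where u: "u \<in> fundamental_domain" "u \<in> modular_orbit z"
    using fundamental_domain_reduction[OF assms] .
  show ?thesis
    using that[OF u(1) modular_orbit_sym[OF u(2) assms]] K_orbit[OF u(2) assms] by simp
qed

text \<open>Kept apart from the strict version because at the threshold itself only weak
  inequalities are available.\<close>

lemma minimizer_if_domain_minimal:
  assumes m: "m \<in> fundamental_domain" and z: "z \<in> modular_orbit m"
    and le: "\<And>u. u \<in> fundamental_domain \<Longrightarrow> K \<alpha> m - b * K (2 * \<alpha>) m \<le> K \<alpha> u - b * K (2 * \<alpha>) u"
  shows "is_minimizer \<alpha> b z"
proof -
  have "z \<in> upper_half_plane"
    using modular_orbit_invariant(1)[of "\<lambda>_. ()", OF _ z fundamental_domain_uhp[OF m]] by simp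
  moreover have "K \<alpha> z - b * K (2 * \<alpha>) z \<le> K \<alpha> w - b * K (2 * \<alpha>) w" if w: "w \<in> upper_half_plane" for w
  proof -
    obtain u where "u \<in> fundamental_domain" "\<And>\<beta>. K \<beta> w = K \<beta> u" using K_orbit_representative[OF w] by metis
    then show ?thesis using le[of u] K_orbit[OF z fundamental_domain_uhp[OF m]] by simp
  qed
  ultimately show ?thesis unfolding is_minimizer_def is_arg_min_def by (meson not_less)
qed

lemma minimizer_iff_orbit:
  assumes m: "m \<in> fundamental_domain"
    and less: "\<And>u. u \<in> fundamental_domain \<Longrightarrow> u \<noteq> m \<Longrightarrow> K \<alpha> m - b * K (2 * \<alpha>) m < K \<alpha> u - b * K (2 * \<alpha>) u"
  shows "is_minimizer \<alpha> b z \<longleftrightarrow> z \<in> modular_orbit m"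
proof
  assume z: "is_minimizer \<alpha> b z"
  then have "z \<in> upper_half_plane" and min: "\<not> K \<alpha> m - b * K (2 * \<alpha>) m < K \<alpha> z - b * K (2 * \<alpha>) z"
    using fundamental_domain_uhp[OF m] unfolding is_minimizer_def is_arg_min_def by auto
  then obtain u where u: "u \<in> fundamental_domain" "z \<in> modular_orbit u" "\<And>\<beta>. K \<beta> z = K \<beta> u"
    using K_orbit_representative by metis
  have "u = m" using less[OF u(1)] min u(3) by auto
  then show "z \<in> modular_orbit m" using u(2) by simp
next
  assume "z \<in> modular_orbit m"
  then show "is_minimizer \<alpha> b z"
    by (rule minimizer_if_domain_minimal[OF m]) (metis less order.strict_implies_order order_refl)
qed

section \<open>Comparison ratios and the threshold\<close>

definition excess_ratio :: "complex \<Rightarrow> real" where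
  "excess_ratio z = (K \<alpha> z - K \<alpha> hexagonal_point) / (K (2 * \<alpha>) z - K (2 * \<alpha>) hexagonal_point)"

definition threshold :: real where
  "threshold = Inf (excess_ratio ` (fundamental_domain - {hexagonal_point}))"

text \<open>The case b = 0 at parameter 2 alpha, where no height restriction applies; it makes the
  denominator of \<open>excess_ratio\<close> positive.\<close>

lemma K_double_gt_hexagonal:
  assumes "z \<in> fundamental_domain" "z \<noteq> hexagonal_point"
  shows "K (2 * \<alpha>) hexagonal_point < K (2 * \<alpha>) z"
  using energy_gt_hexagonal[of "2 * \<alpha>" 0 z] \<alpha> assms by simp

lemma excess_ratio_le_iff:
  assumes "z \<in> fundamental_domain" "z \<noteq> hexagonal_point"
  shows "b \<le> excess_ratio z
    \<longleftrightarrow> K \<alpha> hexagonal_point - b * K (2 * \<alpha>) hexagonal_point \<le> K \<alpha> z - b * K (2 * \<alpha>) z"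
    and "b < excess_ratio z
    \<longleftrightarrow> K \<alpha> hexagonal_point - b * K (2 * \<alpha>) hexagonal_point < K \<alpha> z - b * K (2 * \<alpha>) z"
  using K_double_gt_hexagonal[OF assms]
  by (simp_all add: excess_ratio_def pos_le_divide_eq pos_less_divide_eq) (auto simp: algebra_simps)

lemma critical_less_excess_ratio:
  assumes "z \<in> fundamental_domain" "z \<noteq> hexagonal_point" "Im z \<le> 3 * \<alpha>"
  shows "2 * sqrt 2 < excess_ratio z"
  unfolding excess_ratio_le_iff(2)[OF assms(1,2)]
  using energy_gt_hexagonal[OF \<alpha> _ _ assms(1,2), of "2 * sqrt 2"] assms(3) by simp

text \<open>After multiplication by pi alpha, a point above the cut has energy more than 1/10 at b =
  21/10, since the critical energy is nonnegative and the term in 2 sqrt 2 - 21/10 alone suffices;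
  the hexagonal energy is below 1/10. A uniform bound is what survives in the infimum.\<close>

lemma excess_ratio_lower:
  assumes z: "z \<in> fundamental_domain" "z \<noteq> hexagonal_point"
  shows "21 / 10 \<le> excess_ratio z"
proof (cases "Im z \<le> 3 * \<alpha>")
  case True
  have "14 / 10 \<le> sqrt 2" by (rule real_le_rsqrt) (simp add: power2_eq_square)
  then show ?thesis using critical_less_excess_ratio[OF z True] by simp
next
  case False
  define x y where "x = Re z" and "y = Im z"
  have zxy: "z = Complex x y" by (simp add: x_def y_def)
  have y: "3 * \<alpha> \<le> y" using False by (simp add: y_def)
  have s2: "1414 / 1000 \<le> sqrt 2" "sqrt 2 \<le> 1415 / 1000"
    by (rule real_le_rsqrt, simp add: power2_eq_square) (rule real_le_lsqrt, simp_all add: power2_eq_square)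
  have "17 / 10 \<le> sqrt (y / \<alpha>)"
  proof (rule real_le_rsqrt)
    have "(17 / 10)\<^sup>2 \<le> (3 :: real)" by (simp add: power2_eq_square)
    then show "(17 / 10)\<^sup>2 \<le> y / \<alpha>" using cusp_region(3)[OF y] by (rule order_trans)
  qed
  then have "(17 / 10) / (8 * (1415 / 1000)) \<le> sqrt (y / \<alpha>) / (8 * sqrt 2)"
    using s2 cusp_region(3)[OF y] by (intro frac_le) (simp_all del: zero_le_divide_iff)
  then have K2: "15 / 100 \<le> pi * \<alpha> * K (2 * \<alpha>) z"
    using K_double_lower[OF y, of x] by (simp add: zxy)
  have "728 / 1000 * (15 / 100) \<le> (2 * sqrt 2 - 21 / 10) * (pi * \<alpha> * K (2 * \<alpha>) z)"
    using s2 K2 by (intro mult_mono) auto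
  moreover have "0 \<le> pi * \<alpha> * (K \<alpha> z - 2 * sqrt 2 * K (2 * \<alpha>) z)"
  proof -
    have "0 \<le> sqrt (y / \<alpha>) * exp (- (pi * (y / \<alpha>)) / 2)" using cusp_region(3)[OF y] by simp
    then show ?thesis using critical_energy_bounds(1)[OF y, of x] by (simp add: zxy)
  qed
  moreover have "pi * \<alpha> * (K \<alpha> z - 21 / 10 * K (2 * \<alpha>) z)
    = pi * \<alpha> * (K \<alpha> z - 2 * sqrt 2 * K (2 * \<alpha>) z) + (2 * sqrt 2 - 21 / 10) * (pi * \<alpha> * K (2 * \<alpha>) z)"
    by (simp add: algebra_simps)
  ultimately have low: "1 / 10 \<le> pi * \<alpha> * (K \<alpha> z - 21 / 10 * K (2 * \<alpha>) z)" by simp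
  define w where "w = pi * \<alpha> * (2 / sqrt 3)"
  have w: "29 / 4 \<le> w"
    and hex: "pi * \<alpha> * (K \<alpha> hexagonal_point - 21 / 10 * K (2 * \<alpha>) hexagonal_point) \<le> (6 * w + 17 / 100) * exp (- w)"
    using energy_hexagonal_le[OF \<alpha>, of "21 / 10"] by (simp_all add: w_def)
  have "(6 * w + 17 / 100) * exp (- w) = 6 * (w * exp (- w)) + 17 / 100 * exp (- w)" by (simp add: algebra_simps)
  also have "\<dots> \<le> 6 * (725 / 140000) + 17 / 100 * (1 / 1400)"
    using exp_small_bounds(3,4)[OF w, of 0] by (intro add_mono mult_left_mono) auto
  finally have "(6 * w + 17 / 100) * exp (- w) < 1 / 10" by simp
  then have "pi * \<alpha> * (K \<alpha> hexagonal_point - 21 / 10 * K (2 * \<alpha>) hexagonal_point) \<le> pi * \<alpha> * (K \<alpha> z - 21 / 10 * K (2 * \<alpha>) z)"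
    using hex low by linarith
  moreover have "0 < pi * \<alpha>" using \<alpha> by simp
  ultimately show ?thesis unfolding excess_ratio_le_iff(1)[OF z] by (simp only: mult_le_cancel_left_pos)
qed

lemma cusp_point_in_domain: "3 * \<alpha> \<le> y \<Longrightarrow> Complex (1 / 2) y \<in> fundamental_domain - {hexagonal_point}"
proof -
  assume y: "3 * \<alpha> \<le> y"
  then have "1 \<le> y" using \<alpha> by linarith
  then have "1 * 1 \<le> y * y" by (intro mult_mono) auto
  then have "Complex (1 / 2) y \<in> fundamental_domain"
    unfolding fundamental_domain_iff using \<open>1 \<le> y\<close> by (simp add: power2_eq_square)
  moreover have "Complex (1 / 2) y \<noteq> hexagonal_point" 
    using hexagonal_in_domain(2) y by (metis complex.sel(2) not_less)
  ultimately show ?thesis by simp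
qed

lemma critical_energy_small:
  assumes "0 < e"
  obtains T where "3 \<le> T"
    "\<And>t. T \<le> t \<Longrightarrow> pi * \<alpha> * (K \<alpha> (Complex (1 / 2) (\<alpha> * t)) - 2 * sqrt 2 * K (2 * \<alpha>) (Complex (1 / 2) (\<alpha> * t))) < e"
proof -
  have "((\<lambda>t. sqrt t * ((pi * t + 4) * exp (- (pi * t) / 2))) \<longlongrightarrow> 0) at_top" by real_asymp
  then have "eventually (\<lambda>t. sqrt t * ((pi * t + 4) * exp (- (pi * t) / 2)) < e) at_top"
    using assms by (rule order_tendstoD)
  then obtain N where N: "\<And>t. N \<le> t \<Longrightarrow> sqrt t * ((pi * t + 4) * exp (- (pi * t) / 2)) < e"
    unfolding eventually_at_top_linorder by blast
  show ?thesis
  proof (rule that[of "max 3 N"])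
    fix t assume t: "max 3 N \<le> t"
    then have y: "3 * \<alpha> \<le> \<alpha> * t" using \<alpha> mult_left_mono[of 3 t \<alpha>] by simp
    have "\<alpha> * t / \<alpha> = t" using \<alpha> by simp
    then show "pi * \<alpha> * (K \<alpha> (Complex (1 / 2) (\<alpha> * t)) - 2 * sqrt 2 * K (2 * \<alpha>) (Complex (1 / 2) (\<alpha> * t))) < e"
      using critical_energy_bounds(2)[OF y, of "1 / 2"] N[of t] t by simp
  qed simp
qed

text \<open>The strict upper bound: at b = 2 sqrt 2 a high point of the line x = 1/2 has less energy
  than the positive hexagonal value, so its ratio is below 2 sqrt 2.\<close>

lemma threshold_bounds: "21 / 10 \<le> threshold" "threshold < 2 * sqrt 2"
    "\<And>z. z \<in> fundamental_domain \<Longrightarrow> z \<noteq> hexagonal_point \<Longrightarrow> threshold \<le> excess_ratio z"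
proof -
  let ?S = "fundamental_domain - {hexagonal_point}"
  have ne: "excess_ratio ` ?S \<noteq> {}" using cusp_point_in_domain[of "3 * \<alpha>"] by blast
  have low: "21 / 10 \<le> r" if "r \<in> excess_ratio ` ?S" for r using that excess_ratio_lower by auto
  show "21 / 10 \<le> threshold" unfolding threshold_def using ne low by (rule cInf_greatest)
  have bdd: "bdd_below (excess_ratio ` ?S)" using low by (rule bdd_belowI)
  show le: "threshold \<le> excess_ratio z" if "z \<in> fundamental_domain" "z \<noteq> hexagonal_point" for z
    unfolding threshold_def using that by (intro cInf_lower bdd) auto
  have pa: "0 < pi * \<alpha>" using \<alpha> by simp
  then have "0 < pi * \<alpha> * (K \<alpha> hexagonal_point - 2 * sqrt 2 * K (2 * \<alpha>) hexagonal_point)"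
    using critical_energy_hexagonal_pos by (rule mult_pos_pos)
  then obtain T where T: "3 \<le> T" "pi * \<alpha> * (K \<alpha> (Complex (1 / 2) (\<alpha> * T)) - 2 * sqrt 2 * K (2 * \<alpha>) (Complex (1 / 2) (\<alpha> * T)))
      < pi * \<alpha> * (K \<alpha> hexagonal_point - 2 * sqrt 2 * K (2 * \<alpha>) hexagonal_point)"
    using critical_energy_small by (metis order_refl)
  let ?z = "Complex (1 / 2) (\<alpha> * T)"
  have z: "?z \<in> fundamental_domain" "?z \<noteq> hexagonal_point"
    using cusp_point_in_domain[of "\<alpha> * T"] T(1) \<alpha> mult_left_mono[of 3 T \<alpha>] by auto
  have "\<not> 2 * sqrt 2 \<le> excess_ratio ?z"
    unfolding excess_ratio_le_iff(1)[OF z] not_le using T(2) pa by (simp only: mult_less_cancel_left_pos)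
  then show "threshold < 2 * sqrt 2" using le[OF z] by simp
qed

section \<open>The minimizer in the cusp and its limit\<close>

text \<open>Moving to x = 1/2 lowers the energy above the cut, so the problem is one-dimensional for
  tau >= sqrt 3: coercivity and compactness give a minimum, strict convexity its uniqueness. A point
  with ratio below \<open>b\<close> puts this minimum under the hexagonal value, which excludes
  everything up to the cut.\<close>

lemma cusp_minimizer:
  assumes b: "threshold < b" "b < 2 * sqrt 2"
  obtains Y where "3 * \<alpha> < Y" "\<And>z. is_minimizer \<alpha> b z \<longleftrightarrow> z \<in> modular_orbit (Complex (1 / 2) Y)"
proof -
  define F where "F z = K \<alpha> z - b * K (2 * \<alpha>) z" for z
  define \<beta> where "\<beta> = b / (2 * sqrt 2)"
  define \<phi> where "\<phi> = line_energy (\<alpha>\<^sup>2) \<beta>"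
  have pa: "0 < pi * \<alpha>" using \<alpha> by simp
  have b2: "21 / 10 < b" using threshold_bounds(1) b by simp
  have "7 / 10 * (2 * sqrt 2) \<le> b" using sqrt2_le b2 by simp
  then have \<beta>: "7 / 10 \<le> \<beta>" "\<beta> \<le> 1" using b by (simp_all add: \<beta>_def le_divide_eq divide_le_eq)
  have F_phi: "pi * \<alpha> * F (Complex (1 / 2) (\<alpha> * \<tau>\<^sup>2)) = \<phi> \<tau>" if "0 < \<tau>" for \<tau>
    using energy_line[of \<alpha> \<tau> b] \<alpha> that by (simp add: F_def \<phi>_def \<beta>_def)
  have less_iff: "F u < F v \<longleftrightarrow> pi * \<alpha> * F u < pi * \<alpha> * F v" for u v
    using pa by (simp only: mult_less_cancel_left_pos)
  have F_near: "F hexagonal_point < F z" if "z \<in> fundamental_domain" "z \<noteq> hexagonal_point" "Im z \<le> 3 * \<alpha>" for z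
    using energy_gt_hexagonal[OF \<alpha> _ _ that(1,2), of b] b b2 that(3) by (simp add: F_def)
  have s3: "sqrt 3 \<in> wave_domain" "0 < sqrt 3"
  proof -
    have "91 / (10 * pi) < 3" using pi_approx by (simp add: divide_less_eq)
    then show "sqrt 3 \<in> wave_domain" by (simp add: wave_domain_def)
  qed simp
  have dom: "\<tau> \<in> wave_domain" "0 < \<tau>" "3 * \<alpha> \<le> \<alpha> * \<tau>\<^sup>2" if "sqrt 3 \<le> \<tau>" for \<tau>
  proof -
    show "0 < \<tau>" using s3(2) that by (rule less_le_trans)
    show "\<tau> \<in> wave_domain" using s3(1) that unfolding wave_domain_def greaterThan_iff by (rule less_le_trans)
    have "(sqrt 3)\<^sup>2 \<le> \<tau>\<^sup>2" using that by (intro power_mono) auto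
    then show "3 * \<alpha> \<le> \<alpha> * \<tau>\<^sup>2" using \<alpha> mult_left_mono[of 3 "\<tau>\<^sup>2" \<alpha>] by simp
  qed
  define H where "H = pi * \<alpha> * F hexagonal_point"
  have "Inf (excess_ratio ` (fundamental_domain - {hexagonal_point})) < b" using b by (simp add: threshold_def)
  moreover have "excess_ratio ` (fundamental_domain - {hexagonal_point}) \<noteq> {}"
    using cusp_point_in_domain[of "3 * \<alpha>"] by blast
  ultimately have "\<exists>r \<in> excess_ratio ` (fundamental_domain - {hexagonal_point}). r < b"
    by (rule cInf_lessD[rotated])
  then obtain z0 where z0: "z0 \<in> fundamental_domain" "z0 \<noteq> hexagonal_point" "excess_ratio z0 < b"
    by blast
  then have Fz0: "F z0 < F hexagonal_point"
    using excess_ratio_le_iff(1)[OF z0(1,2), of b] by (simp add: F_def)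
  then have Im0: "3 * \<alpha> < Im z0" using F_near[OF z0(1,2)] by fastforce
  define \<tau>0 where "\<tau>0 = sqrt (Im z0 / \<alpha>)"
  have \<tau>0: "sqrt 3 \<le> \<tau>0" "\<alpha> * \<tau>0\<^sup>2 = Im z0"
    using Im0 \<alpha> by (simp_all add: \<tau>0_def le_divide_eq)
  have half: "F (Complex (1 / 2) (Im z)) \<le> F z" "Re z \<noteq> 1 / 2 \<Longrightarrow> F (Complex (1 / 2) (Im z)) < F z"
    if "z \<in> fundamental_domain" "3 * \<alpha> \<le> Im z" for z
  proof -
    have x: "0 \<le> Re z" "Re z \<le> 1 / 2" using that by (auto simp: fundamental_domain_def)
    have *: "Complex (Re z) (Im z) = z" by simp
    show less: "F (Complex (1 / 2) (Im z)) < F z" if "Re z \<noteq> 1 / 2"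
      using energy_half_less[OF \<open>3 * \<alpha> \<le> Im z\<close> x(1), of b] x that b b2 by (simp add: F_def *)
    show "F (Complex (1 / 2) (Im z)) \<le> F z"
    proof (cases "Re z = 1 / 2")
      case True
      then have "Complex (1 / 2) (Im z) = z" by (simp add: complex_eq_iff)
      then show ?thesis by simp
    qed (use less in simp)
  qed
  have phi0: "\<phi> \<tau>0 < H"
  proof -
    have "F (Complex (1 / 2) (Im z0)) < F hexagonal_point" using half(1)[OF z0(1)] Im0 Fz0 by linarith
    then show ?thesis using F_phi[OF dom(2)[OF \<tau>0(1)]] by (simp only: H_def less_iff \<tau>0(2))
  qed
  \<comment> \<open>The energy is the critical one, which is nonnegative, plus (2 sqrt 2 - b) times
    the \<open>K (2 * \<alpha>)\<close> term, which grows at least linearly in tau.\<close>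
  have coercive: "(2 * sqrt 2 - b) / (8 * sqrt 2) * \<tau> \<le> \<phi> \<tau>" if \<tau>: "sqrt 3 \<le> \<tau>" for \<tau>
  proof -
    let ?z = "Complex (1 / 2) (\<alpha> * \<tau>\<^sup>2)"
    have q: "\<alpha> * \<tau>\<^sup>2 / \<alpha> = \<tau>\<^sup>2" using \<alpha> by simp
    have "\<phi> \<tau> = pi * \<alpha> * (K \<alpha> ?z - 2 * sqrt 2 * K (2 * \<alpha>) ?z) + (2 * sqrt 2 - b) * (pi * \<alpha> * K (2 * \<alpha>) ?z)"
      using F_phi[OF dom(2)[OF \<tau>]] by (simp add: F_def algebra_simps)
    moreover have "0 \<le> pi * \<alpha> * (K \<alpha> ?z - 2 * sqrt 2 * K (2 * \<alpha>) ?z)"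
    proof -
      have "0 \<le> sqrt (\<tau>\<^sup>2) * exp (- (pi * \<tau>\<^sup>2) / 2)" by simp
      then show ?thesis using critical_energy_bounds(1)[OF dom(3)[OF \<tau>], of "1 / 2"] unfolding q by (rule order_trans)
    qed
    moreover have "(2 * sqrt 2 - b) * (\<tau> / (8 * sqrt 2)) \<le> (2 * sqrt 2 - b) * (pi * \<alpha> * K (2 * \<alpha>) ?z)"
      using K_double_lower[OF dom(3)[OF \<tau>], of "1 / 2"] dom(2)[OF \<tau>] b unfolding q by (intro mult_left_mono) auto
    ultimately show ?thesis by simp
  qed
  define c where "c = (2 * sqrt 2 - b) / (8 * sqrt 2)"
  have c: "0 < c" using b by (simp add: c_def)
  \<comment> \<open>Beyond |H| / c the linear lower bound exceeds the hexagonal value; including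
    \<open>\<tau>0\<close> guarantees that the minimum over the interval lies below
    \<open>H\<close>.\<close>
  define T where "T = max \<tau>0 (\<bar>H\<bar> / c)"
  have T: "sqrt 3 \<le> T" "\<tau>0 \<le> T" using \<tau>0 by (auto simp: T_def)
  have "continuous_on {sqrt 3..T} \<phi>"
    unfolding \<phi>_def using line_energy_continuous[OF square_ge_4 \<beta>] by (rule continuous_on_subset) (use dom(1) in auto)
  then obtain \<tau>m where \<tau>m: "sqrt 3 \<le> \<tau>m" "\<And>\<tau>. sqrt 3 \<le> \<tau> \<Longrightarrow> \<tau> \<le> T \<Longrightarrow> \<phi> \<tau>m \<le> \<phi> \<tau>"
    using continuous_attains_inf[of "{sqrt 3..T}" \<phi>] T by auto
  have phim: "\<phi> \<tau>m < H" using \<tau>m(2)[OF \<tau>0(1) T(2)] phi0 by simp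
  have min: "\<phi> \<tau>m \<le> \<phi> \<tau>" if "sqrt 3 \<le> \<tau>" for \<tau>
  proof (cases "\<tau> \<le> T")
    case True
    then show ?thesis using \<tau>m(2) that by simp
  next
    case False
    then have "\<bar>H\<bar> / c < \<tau>" by (simp add: T_def)
    then have "\<bar>H\<bar> < c * \<tau>" using c by (simp add: divide_less_eq mult.commute)
    then show ?thesis using coercive[OF that] phim by (simp add: c_def)
  qed
  have unique: "\<tau> = \<tau>m" if "sqrt 3 \<le> \<tau>" "\<phi> \<tau> \<le> \<phi> \<tau>m" for \<tau>
  proof (rule ccontr)
    have strict: "\<phi> ((u + v) / 2) < (\<phi> u + \<phi> v) / 2" if "sqrt 3 \<le> u" "u < v" for u v
      unfolding \<phi>_def using that dom(1) by (intro line_energy_midpoint square_ge_4 \<beta>) auto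
    assume "\<tau> \<noteq> \<tau>m"
    then have "\<phi> ((\<tau> + \<tau>m) / 2) < (\<phi> \<tau> + \<phi> \<tau>m) / 2"
      using strict[of \<tau> \<tau>m] strict[of \<tau>m \<tau>] that(1) \<tau>m(1) by (cases \<tau> \<tau>m rule: linorder_cases) (auto simp: add.commute)
    moreover have "\<phi> \<tau>m \<le> \<phi> ((\<tau> + \<tau>m) / 2)" using that(1) \<tau>m(1) by (intro min) simp
    ultimately show False using that(2) by simp
  qed
  define Y where "Y = \<alpha> * \<tau>m\<^sup>2"
  let ?m = "Complex (1 / 2) Y"
  have Y: "3 * \<alpha> \<le> Y" unfolding Y_def by (rule dom(3)[OF \<tau>m(1)])
  have m: "?m \<in> fundamental_domain" "?m \<noteq> hexagonal_point" using cusp_point_in_domain[OF Y] by auto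
  have Fm: "pi * \<alpha> * F ?m = \<phi> \<tau>m" unfolding Y_def by (rule F_phi[OF dom(2)[OF \<tau>m(1)]])
  then have Fm_hex: "F ?m < F hexagonal_point" using phim by (simp only: H_def less_iff)
  \<comment> \<open>The endpoint of the interval still belongs to the region where the hexagonal
    point wins.\<close>
  have "Y \<noteq> 3 * \<alpha>"
  proof
    assume "Y = 3 * \<alpha>"
    then show False using F_near[OF m] Fm_hex by simp
  qed
  then have Y3: "3 * \<alpha> < Y" using Y by simp
  have less: "F ?m < F u" if u: "u \<in> fundamental_domain" "u \<noteq> ?m" for u
  proof (cases "Im u \<le> 3 * \<alpha>")
    case True
    then show ?thesis using F_near[OF u(1)] Fm_hex by (cases "u = hexagonal_point") auto
  next
    case False
    define \<tau> where "\<tau> = sqrt (Im u / \<alpha>)"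
    have \<tau>: "sqrt 3 \<le> \<tau>" "\<alpha> * \<tau>\<^sup>2 = Im u" using False \<alpha> by (simp_all add: \<tau>_def le_divide_eq)
    have Fu: "pi * \<alpha> * F (Complex (1 / 2) (Im u)) = \<phi> \<tau>" using F_phi[OF dom(2)[OF \<tau>(1)]] \<tau>(2) by simp
    show ?thesis
    proof (cases "Re u = 1 / 2")
      case True
      then have u_eq: "u = Complex (1 / 2) (Im u)" by (simp add: complex_eq_iff)
      have "\<tau> \<noteq> \<tau>m" using u(2) u_eq \<tau>(2) by (metis Y_def)
      then have "\<phi> \<tau>m < \<phi> \<tau>" using unique[OF \<tau>(1)] by fastforce
      then show ?thesis using Fu Fm u_eq less_iff by metis
    next
      case False2: False
      have "F (Complex (1 / 2) (Im u)) < F u" using half(2)[OF u(1)] False False2 by simp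
      moreover have "F ?m \<le> F (Complex (1 / 2) (Im u))"
        using min[OF \<tau>(1)] Fu Fm less_iff by (metis not_less)
      ultimately show ?thesis by simp
    qed
  qed
  show ?thesis
    using that[OF Y3] minimizer_iff_orbit[OF m(1), of b] less by (simp add: F_def)
qed

text \<open>On the line, points between the cut and a fixed height have energy at least m > 0 for
  every b below 2 sqrt 2, whereas a suitable fixed point higher up has energy below m once
  \<open>b\<close> is close to 2 sqrt 2. A minimizer must therefore rise above any given
  height.\<close>

lemma cusp_minimizer_tendsto:
  assumes y: "\<And>b. threshold < b \<Longrightarrow> b < 2 * sqrt 2 \<Longrightarrow> 3 * \<alpha> < y b \<and> is_minimizer \<alpha> b (Complex (1 / 2) (y b))"
  shows "filterlim y at_top (at_left (2 * sqrt 2))"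
  unfolding filterlim_at_top
proof
  fix Z :: real
  have pa: "0 < pi * \<alpha>" using \<alpha> by simp
  define T where "T = max 3 (Z / \<alpha>)"
  define m where "m = exp (- (pi * T) / 2)"
  have m: "0 < m" by (simp add: m_def)
  obtain T' where T': "3 \<le> T'" "pi * \<alpha> * (K \<alpha> (Complex (1 / 2) (\<alpha> * T')) - 2 * sqrt 2 * K (2 * \<alpha>) (Complex (1 / 2) (\<alpha> * T'))) < m / 2"
    using critical_energy_small[of "m / 2"] m by (metis half_gt_zero order_refl)
  let ?w = "Complex (1 / 2) (\<alpha> * T')"
  have wY: "3 * \<alpha> \<le> \<alpha> * T'" using T'(1) \<alpha> mult_left_mono[of 3 T' \<alpha>] by simp
  define k where "k = pi * \<alpha> * K (2 * \<alpha>) ?w"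
  have k: "0 < k" unfolding k_def using pa K_double_pos[OF wY] by (rule mult_pos_pos)
  \<comment> \<open>For b > b0 the term (2 sqrt 2 - b) k stays below m/2, and the critical energy of
    the comparison point is below m/2 as well.\<close>
  define b0 where "b0 = max threshold (2 * sqrt 2 - m / (2 * k))"
  have b0: "b0 < 2 * sqrt 2" using threshold_bounds(2) m k by (simp add: b0_def)
  have "Z \<le> y b" if b: "b0 < b" "b < 2 * sqrt 2" for b
  proof (rule ccontr)
    assume neg: "\<not> Z \<le> y b"
    have yb: "3 * \<alpha> < y b" "is_minimizer \<alpha> b (Complex (1 / 2) (y b))" using y[of b] b by (auto simp: b0_def)
    let ?z = "Complex (1 / 2) (y b)"
    have t: "3 \<le> y b / \<alpha>" "y b / \<alpha> \<le> T"
      using yb(1) neg \<alpha> by (auto simp: T_def le_divide_eq divide_right_mono le_max_iff_disj)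
    have "pi * (y b / \<alpha>) \<le> pi * T" using t(2) by (rule mult_left_mono) simp
    then have "m \<le> exp (- (pi * (y b / \<alpha>)) / 2)" by (simp only: m_def exp_le_cancel_iff) simp
    also have "\<dots> = 1 * exp (- (pi * (y b / \<alpha>)) / 2)" by simp
    also have "\<dots> \<le> sqrt (y b / \<alpha>) * exp (- (pi * (y b / \<alpha>)) / 2)" using t(1) by (intro mult_right_mono) auto
    also have "\<dots> \<le> pi * \<alpha> * (K \<alpha> ?z - 2 * sqrt 2 * K (2 * \<alpha>) ?z)"
      using critical_energy_bounds(1)[of "y b" "1 / 2"] yb(1) by simp
    also have "\<dots> \<le> pi * \<alpha> * (K \<alpha> ?z - b * K (2 * \<alpha>) ?z)"
      using pa b K_double_pos[of "y b" "1 / 2"] yb(1) by (intro mult_left_mono diff_left_mono mult_right_mono) auto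
    finally have low: "m \<le> pi * \<alpha> * (K \<alpha> ?z - b * K (2 * \<alpha>) ?z)" .
    have "2 * sqrt 2 - b < m / (2 * k)" using b by (simp add: b0_def)
    then have "(2 * sqrt 2 - b) * k < m / (2 * k) * k" using k by (intro mult_strict_right_mono)
    then have "(2 * sqrt 2 - b) * k < m / 2" using k by simp
    moreover have "pi * \<alpha> * (K \<alpha> ?w - b * K (2 * \<alpha>) ?w)
      = pi * \<alpha> * (K \<alpha> ?w - 2 * sqrt 2 * K (2 * \<alpha>) ?w) + (2 * sqrt 2 - b) * k"
      by (simp add: k_def algebra_simps)
    ultimately have "pi * \<alpha> * (K \<alpha> ?w - b * K (2 * \<alpha>) ?w) < pi * \<alpha> * (K \<alpha> ?z - b * K (2 * \<alpha>) ?z)"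
      using T'(2) low by linarith
    then have "K \<alpha> ?w - b * K (2 * \<alpha>) ?w < K \<alpha> ?z - b * K (2 * \<alpha>) ?z"
      using pa by (simp only: mult_less_cancel_left_pos)
    moreover have "?w \<in> upper_half_plane" using wY \<alpha> by (simp add: upper_half_plane_def)
    ultimately show False using yb(2) by (auto simp: is_minimizer_def is_arg_min_def)
  qed
  then show "\<forall>\<^sub>F b in at_left (2 * sqrt 2). Z \<le> y b"
    unfolding eventually_at_left_field using b0 by blast
qed

lemma no_minimizer:
  assumes b: "2 * sqrt 2 \<le> b"
  shows "\<not> is_minimizer \<alpha> b z"
proof
  assume min: "is_minimizer \<alpha> b z"
  have pa: "0 < pi * \<alpha>" using \<alpha> by simp
  have zH: "z \<in> upper_half_plane" using min by (simp add: is_minimizer_def is_arg_min_def)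
  define E where "E = pi * \<alpha> * (K \<alpha> z - b * K (2 * \<alpha>) z)"
  have ge: "E \<le> pi * \<alpha> * (K \<alpha> (Complex (1 / 2) y) - b * K (2 * \<alpha>) (Complex (1 / 2) y))" if "3 * \<alpha> \<le> y" for y
  proof -
    have "Complex (1 / 2) y \<in> upper_half_plane" using that \<alpha> by (simp add: upper_half_plane_def)
    then have "K \<alpha> z - b * K (2 * \<alpha>) z \<le> K \<alpha> (Complex (1 / 2) y) - b * K (2 * \<alpha>) (Complex (1 / 2) y)"
      using min by (auto simp: is_minimizer_def is_arg_min_def not_less)
    then show ?thesis unfolding E_def using pa by (intro mult_left_mono) auto
  qed
  show False
  proof (cases "b = 2 * sqrt 2")
    case True
    obtain u where u: "u \<in> fundamental_domain" "\<And>\<beta>. K \<beta> z = K \<beta> u" using K_orbit_representative[OF zH] by metis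
    \<comment> \<open>Positivity at every point of the domain: the critical energy tends to 0 in the
      cusp, so its infimum is not attained.\<close>
    have "0 < K \<alpha> u - b * K (2 * \<alpha>) u"
    proof (cases "Im u \<le> 3 * \<alpha>")
      case inner: True
      then show ?thesis
        using critical_energy_hexagonal_pos energy_gt_hexagonal[OF \<alpha> _ _ u(1), of b] True
        by (cases "u = hexagonal_point") auto
    next
      case False
      define x y where "x = Re u" and "y = Im u"
      have uxy: "u = Complex x y" by (simp add: x_def y_def)
      have y: "3 * \<alpha> \<le> y" using False by (simp add: y_def)
      have "0 < sqrt (y / \<alpha>) * exp (- (pi * (y / \<alpha>)) / 2)" using cusp_region(3)[OF y] by simp
      then have "0 < pi * \<alpha> * (K \<alpha> u - b * K (2 * \<alpha>) u)"
        using critical_energy_bounds(1)[OF y, of x] unfolding uxy True by (rule less_le_trans)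
      then show ?thesis using pa by (rule zero_less_mult_pos)
    qed
    then have "0 < E" using pa u(2) by (simp add: E_def)
    then obtain T where T: "3 \<le> T" "pi * \<alpha> * (K \<alpha> (Complex (1 / 2) (\<alpha> * T)) - 2 * sqrt 2 * K (2 * \<alpha>) (Complex (1 / 2) (\<alpha> * T))) < E"
      using critical_energy_small by (metis order_refl)
    moreover have "3 * \<alpha> \<le> \<alpha> * T" using T(1) \<alpha> mult_left_mono[of 3 T \<alpha>] by simp
    ultimately show False using ge[of "\<alpha> * T"] True by simp
  next
    case False
    obtain T where T: "3 \<le> T" "\<And>t. T \<le> t \<Longrightarrow> pi * \<alpha> * (K \<alpha> (Complex (1 / 2) (\<alpha> * t)) - 2 * sqrt 2 * K (2 * \<alpha>) (Complex (1 / 2) (\<alpha> * t))) < 1"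
      using critical_energy_small[of 1] by auto
    define c where "c = (b - 2 * sqrt 2) / (8 * sqrt 2)"
    have c: "0 < c" using b False by (simp add: c_def)
    \<comment> \<open>Here sqrt t >= (1 + |E|) / c makes the subtracted term at least 1 + |E|, while
      the critical energy at this height is below 1.\<close>
    define t where "t = max T (((1 + \<bar>E\<bar>) / c)\<^sup>2)"
    have t: "T \<le> t" "3 \<le> t" using T(1) by (auto simp: t_def)
    let ?w = "Complex (1 / 2) (\<alpha> * t)"
    have y: "3 * \<alpha> \<le> \<alpha> * t" using t(2) \<alpha> mult_left_mono[of 3 t \<alpha>] by simp
    have q: "\<alpha> * t / \<alpha> = t" using \<alpha> by simp
    have "(1 + \<bar>E\<bar>) / c \<le> sqrt t" using c by (intro real_le_rsqrt) (simp add: t_def)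
    then have "1 + \<bar>E\<bar> \<le> c * sqrt t" using c by (simp add: divide_le_eq mult.commute)
    also have "\<dots> = (b - 2 * sqrt 2) * (sqrt t / (8 * sqrt 2))" by (simp add: c_def)
    also have "\<dots> \<le> (b - 2 * sqrt 2) * (pi * \<alpha> * K (2 * \<alpha>) ?w)"
      using K_double_lower[OF y, of "1 / 2"] b unfolding q by (intro mult_left_mono) auto
    finally have "pi * \<alpha> * (K \<alpha> ?w - 2 * sqrt 2 * K (2 * \<alpha>) ?w) - (b - 2 * sqrt 2) * (pi * \<alpha> * K (2 * \<alpha>) ?w) < E"
      using T(2)[OF t(1)] by linarith
    moreover have "pi * \<alpha> * (K \<alpha> ?w - b * K (2 * \<alpha>) ?w)
      = pi * \<alpha> * (K \<alpha> ?w - 2 * sqrt 2 * K (2 * \<alpha>) ?w) - (b - 2 * sqrt 2) * (pi * \<alpha> * K (2 * \<alpha>) ?w)"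
      by (simp add: algebra_simps)
    ultimately show False using ge[OF y] by linarith
  qed
qed

end

theorem theorem1p1:
  fixes \<alpha> :: real
  assumes "\<alpha> \<ge> 2"
  shows "\<exists>b\<^sub>c\<^sub>1 b\<^sub>c\<^sub>2 :: real.
    2 < b\<^sub>c\<^sub>1 \<and> b\<^sub>c\<^sub>1 < b\<^sub>c\<^sub>2 \<and> b\<^sub>c\<^sub>2 = 2 * sqrt 2 \<and>
    (\<forall>b \<le> b\<^sub>c\<^sub>1. \<forall>z \<in> modular_orbit (cis (pi / 3)). is_minimizer \<alpha> b z) \<and>
    (\<forall>b < b\<^sub>c\<^sub>1. \<forall>z. is_minimizer \<alpha> b z \<longrightarrow> z \<in> modular_orbit (cis (pi / 3))) \<and>
    (\<exists>y :: real \<Rightarrow> real.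
       (\<forall>b. b\<^sub>c\<^sub>1 < b \<and> b < b\<^sub>c\<^sub>2 \<longrightarrow>
          y b > sqrt 3 / 2 \<and>
          (\<forall>z. is_minimizer \<alpha> b z \<longleftrightarrow> z \<in> modular_orbit (Complex (1 / 2) (y b)))) \<and>
       filterlim y at_top (at_left (2 * sqrt 2))) \<and>
    (\<forall>b \<ge> b\<^sub>c\<^sub>2. \<not> (\<exists>z. is_minimizer \<alpha> b z))"
proof -
  note \<alpha> = assms
  define b1 where "b1 = threshold \<alpha>"
  note tb = threshold_bounds[OF \<alpha>, folded b1_def]
  have hex: "hexagonal_point \<in> fundamental_domain" by (rule hexagonal_in_domain(1)[OF \<alpha>])
  have 1: "is_minimizer \<alpha> b z" if "b \<le> b1" "z \<in> modular_orbit hexagonal_point" for b z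
  proof (rule minimizer_if_domain_minimal[OF \<alpha> hex that(2)])
    fix u assume u: "u \<in> fundamental_domain"
    show "K \<alpha> hexagonal_point - b * K (2 * \<alpha>) hexagonal_point \<le> K \<alpha> u - b * K (2 * \<alpha>) u"
    proof (cases "u = hexagonal_point")
      case False
      have "b \<le> excess_ratio \<alpha> u" using tb(3)[OF u False] that(1) by (rule order_trans[rotated])
      then show ?thesis by (simp only: excess_ratio_le_iff(1)[OF \<alpha> u False])
    qed simp
  qed
  \<comment> \<open>Strictness of b < b1 matters: at b = b1 another point could attain the infimum
    of the ratios and tie with the hexagonal point.\<close>
  have 2: "is_minimizer \<alpha> b z \<longleftrightarrow> z \<in> modular_orbit hexagonal_point" if "b < b1" for b z
  proof (rule minimizer_iff_orbit[OF \<alpha> hex])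
    fix u assume u: "u \<in> fundamental_domain" "u \<noteq> hexagonal_point"
    show "K \<alpha> hexagonal_point - b * K (2 * \<alpha>) hexagonal_point < K \<alpha> u - b * K (2 * \<alpha>) u"
      using that tb(3)[OF u] unfolding excess_ratio_le_iff(2)[OF \<alpha> u, symmetric] by (rule less_le_trans)
  qed
  define P where "P b Y \<longleftrightarrow> 3 * \<alpha> < Y \<and> (\<forall>z. is_minimizer \<alpha> b z \<longleftrightarrow> z \<in> modular_orbit (Complex (1 / 2) Y))" for b Y
  \<comment> \<open>Outside the interval between the thresholds the choice may be arbitrary; the
    limit only sees \<open>b\<close> just below 2 sqrt 2.\<close>
  define y where "y b = (SOME Y. P b Y)" for b
  have y: "P b (y b)" if b: "b1 < b" "b < 2 * sqrt 2" for b
  proof -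
    obtain Y where "P b Y" using cusp_minimizer[OF \<alpha>, of b] b unfolding P_def b1_def by blast
    then show ?thesis unfolding y_def by (rule someI)
  qed
  have lim: "filterlim y at_top (at_left (2 * sqrt 2))"
  proof (rule cusp_minimizer_tendsto[OF \<alpha>])
    fix b assume "threshold \<alpha> < b" "b < 2 * sqrt 2"
    then have Pb: "P b (y b)" using y by (simp add: b1_def)
    then have "Complex (1 / 2) (y b) \<in> upper_half_plane" using \<alpha> by (auto simp: P_def upper_half_plane_def)
    then show "3 * \<alpha> < y b \<and> is_minimizer \<alpha> b (Complex (1 / 2) (y b))"
      using Pb modular_orbit_refl by (auto simp: P_def)
  qed
  have pos: "sqrt 3 / 2 < y b" if "P b (y b)" for b
    using that sqrt3_bounds \<alpha> unfolding P_def by linarith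
  show ?thesis
  proof (rule exI[of _ b1], rule exI[of _ "2 * sqrt 2"], intro conjI allI impI ballI)
    show "2 < b1" using tb(1) by simp
    show "b1 < 2 * sqrt 2" by (rule tb(2))
    show "2 * sqrt 2 = 2 * sqrt 2" ..
    fix b z assume "b \<le> b1" "z \<in> modular_orbit (cis (pi / 3))"
    then show "is_minimizer \<alpha> b z" using 1 by (simp add: cis_hexagonal)
  next
    fix b z assume "b < b1" "is_minimizer \<alpha> b z"
    then show "z \<in> modular_orbit (cis (pi / 3))" using 2 by (simp add: cis_hexagonal)
  next
    show "\<exists>y :: real \<Rightarrow> real.
       (\<forall>b. b1 < b \<and> b < 2 * sqrt 2 \<longrightarrow>
          y b > sqrt 3 / 2 \<and>
          (\<forall>z. is_minimizer \<alpha> b z \<longleftrightarrow> z \<in> modular_orbit (Complex (1 / 2) (y b)))) \<and>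
       filterlim y at_top (at_left (2 * sqrt 2))"
      using y pos lim by (intro exI[of _ y]) (auto simp: P_def)
  next
    fix b assume "2 * sqrt 2 \<le> b"
    then show "\<not> (\<exists>z. is_minimizer \<alpha> b z)" using no_minimizer[OF \<alpha>] by blast
  qed
qed

end
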